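(* Fix an integer $k\ge1$. Let $x:\mathbb T\to\mathbb R^2$ be a smooth regular input in the class described in the context (uniform bounds on $x$ and on its velocity $v=(\mathcal F_\tau(x)-x)/\tau$, and $I_hx$ in the coercivity neighborhood). Then, for $0<\tau\le1$ and all sufficiently small $h$, $$\|\mathcal F_{h,\tau}(I_hx)-I_h\mathcal F_\tau(x)\|_{H^1(\mathbb T)}\le Ch^{k+1},$$ where the constant $C$ is uniform in $h$ and $\tau$.
   Context: **Geometry.** $\mathbb T=\mathbb R/\mathbb Z$, $J(a,b)=(b,-a)$. For a regular counterclockwise $x:\mathbb T\to\mathbb R^2$: $\mathbf t=x'/|x'|$, $\mathbf n=J\mathbf t$, $\partial_s=|x'|^{-1}\partial_\rho$, $ds=|x'|\,d\rho$. **Time-semidiscrete step operator.** For smooth regular $x$, $\mathcal F_\tau(x)\in H^1(\mathbb T;\mathbb R^2)$ is the unique solution of $\int\bigl(\tfrac{\mathcal F_\tau(x)-x}{\tau}\cdot\mathbf n\bigr)(\phi\cdot\mathbf n)\,ds+\int\partial_s\mathcal F_\tau(x)\cdot\partial_s\phi\,ds=0$ for all $\phi\in H^1(\mathbb T;\mathbb R^2)$. **Finite elements.** $\mathcal T_h$ is a family of periodic quasi-uniform partitions of $\mathbb T$, $h=\max_K|K|$, quasi-uniformity constant independent of $h$. $V_h=\{\eta_h\in C^0(\mathbb T):\eta_h|_K\in P^k(K)\ \forall K\}$. On each $K$ use the $(k+1)$-point Gauss--Lobatto rule, nodes $\rho_i$ ($i\in K$), positive weights $w_{K,i}$ scaled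 to $K$ (exact for degree $\le2k-1$); $I_h$ is nodal interpolation. For regular $\widetilde x_h\in V_h^2$ set $$\mu_i=\sum_{K\ni i}w_{K,i}|(\widetilde x_h|_K)'(\rho_i)|,\qquad \omega_i=\mu_i^{-1}\sum_{K\ni i}w_{K,i}\,J(\widetilde x_h|_K)'(\rho_i),$$ $$a_{\widetilde x_h}(u,\phi)=\int_{\mathbb T}\frac{u'\cdot\phi'}{|\widetilde x_h'|}\,d\rho,\qquad b_{\widetilde x_h,h}(u,\phi)=\sum_i\mu_i\,(u(\rho_i)\cdot\omega_i)(\phi(\rho_i)\cdot\omega_i).$$ $\mathcal F_{h,\tau}(\widetilde x_h)\in V_h^2$ is the solution of $a_{\widetilde x_h}(\mathcal F_{h,\tau}(\widetilde x_h),\phi_h)+\tau^{-1}b_{\widetilde x_h,h}(\mathcal F_{h,\tau}(\widetilde x_h)-\widetilde x_h,\phi_h)=0$ for all $\phi_h\in V_h^2$. **Class of inputs.** Fix constants $c_*>0$, $C_*$, $C_r$ ($r=1,2,\dots$) independent of $h,\tau$. The inputs $x$ are smooth with $c_*\le|x'|\le C_*$ and, for each integer $r\ge1$, $$\|x\|_{W^{r+1,\infty}}+\|v\|_{W^{r,\infty}}+\bigl\||x'|(v\cdot\mathbf n)\mathbf n\bigr\|_{W^{r,\infty}}\le C_r,\qquad v=\frac{\mathcal F_\tau(x)-x}{\tau}.$$ Moreover $I_hx$ lies in a fixed $W^{1,\infty}$ neighborhood $\mathcal N$ of the time-semidiscrete BGN parametrizations $x^m$ ($x^{m+1}=\mathcal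 F_\tau(x^m)$, $0\le m\le M$, $M\tau=T$, $x^0$ the constant-speed counterclockwise parametrization of the initial curve of a smooth embedded closed curve-shortening flow on $[0,T]$), on which regularity is uniform and, uniformly in small $h$, there is $c>0$ with $a_{\widetilde x_h}(u_h,u_h)+b_{\widetilde x_h,h}(u_h,u_h)\ge c\|u_h\|_{H^1}^2$ for every $\widetilde x_h\in V_h^2\cap\mathcal N$ and every $u_h\in V_h^2$. $C$ may depend on $k$, the mesh family, $c_*,C_*,C_r$ and the coercivity neighborhood and constants, but not on $h,\tau$. *)

theory Defs
  imports
    "HOL-Complex_Analysis.Complex_Analysis"
    "HOL-Probability.Essential_Supremum"
    "HOL-Computational_Algebra.Polynomial"
begin

text \<open>Functions on \<open>\<T> = \<real>/\<int>\<close> are rendered as 1-periodic functions on \<open>\<real>\<close>; integrals over \<open>\<T>\<close> are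
  integrals over \<open>{0..1}\<close>.\<close>

type_synonym plane = "real ^ 2"

definition periodic1 :: "(real \<Rightarrow> 'a) \<Rightarrow> bool" where
  "periodic1 f \<longleftrightarrow> (\<forall>\<rho>. f (\<rho> + 1) = f \<rho>)"

text \<open>The derivative with respect to \<open>\<rho>\<close>. It is used for smooth functions, for piecewise polynomials
  (where it is meaningless at the finitely many break points per period) and for Sobolev functions,
  which are absolutely continuous, so that the pointwise derivative exists almost everywhere and
  is the weak derivative.\<close>

definition dd :: "(real \<Rightarrow> plane) \<Rightarrow> real \<Rightarrow> plane" where
  "dd f \<rho> = vector_derivative f (at \<rho>)"

text \<open>Absolute continuity, as validity of the fundamental theorem of calculus for the
  Lebesgue integrable a.e. derivative.\<close>

definition abs_cont :: "(real \<Rightarrow> plane) \<Rightarrow> bool" where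
  "abs_cont f \<longleftrightarrow> (\<forall>a b. a \<le> b \<longrightarrow>
     dd f absolutely_integrable_on {a..b} \<and> (dd f has_integral (f b - f a)) {a..b})"

text \<open>\<open>H\<^sup>1(\<T>;\<real>\<^sup>2)\<close> and \<open>W\<^sup>r\<^sup>,\<^sup>\<infinity>(\<T>;\<real>\<^sup>2)\<close>, each element given by its continuous representative (so that point
  values, and hence nodal interpolation, make sense). Only \<open>r \<ge> 1\<close> is used.\<close>

definition H1 :: "(real \<Rightarrow> plane) set" where
  "H1 = {u. periodic1 u \<and> abs_cont u \<and> (\<lambda>\<rho>. (norm (dd u \<rho>))\<^sup>2) integrable_on {0..1}}"

definition H1_norm :: "(real \<Rightarrow> plane) \<Rightarrow> real" where
  "H1_norm u = sqrt (integral {0..1} (\<lambda>\<rho>. (norm (u \<rho>))\<^sup>2 + (norm (dd u \<rho>))\<^sup>2))"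

definition Winf_norm :: "nat \<Rightarrow> (real \<Rightarrow> plane) \<Rightarrow> ereal" where
  "Winf_norm r f = (\<Sum>j\<le>r. esssup (lebesgue_on {0..1}) (\<lambda>\<rho>. ereal (norm ((dd ^^ j) f \<rho>))))"

definition Winf :: "nat \<Rightarrow> (real \<Rightarrow> plane) set" where
  "Winf r = {f. periodic1 f \<and> (\<forall>j<r. abs_cont ((dd ^^ j) f)) \<and> Winf_norm r f < \<infinity>}"


subsection \<open>Geometry of closed plane curves\<close>

definition J :: "plane \<Rightarrow> plane" where
  "J a = vector [a $ 2, - (a $ 1)]"

definition smooth_regular :: "(real \<Rightarrow> plane) \<Rightarrow> bool" where
  "smooth_regular x \<longleftrightarrow> periodic1 x \<and> (\<forall>j \<rho>. (dd ^^ j) x differentiable (at \<rho>)) \<and> (\<forall>\<rho>. dd x \<rho> \<noteq> 0)"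

definition speed :: "(real \<Rightarrow> plane) \<Rightarrow> real \<Rightarrow> real" where
  "speed x \<rho> = norm (dd x \<rho>)"

definition tangent :: "(real \<Rightarrow> plane) \<Rightarrow> real \<Rightarrow> plane" where
  "tangent x \<rho> = (1 / speed x \<rho>) *\<^sub>R dd x \<rho>"

definition normal :: "(real \<Rightarrow> plane) \<Rightarrow> real \<Rightarrow> plane" where
  "normal x \<rho> = J (tangent x \<rho>)"

definition arc_deriv :: "(real \<Rightarrow> plane) \<Rightarrow> (real \<Rightarrow> plane) \<Rightarrow> real \<Rightarrow> plane" where
  "arc_deriv x f \<rho> = (1 / speed x \<rho>) *\<^sub>R dd f \<rho>"

definition arc_integral :: "(real \<Rightarrow> plane) \<Rightarrow> (real \<Rightarrow> real) \<Rightarrow> real" where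
  "arc_integral x g = integral {0..1} (\<lambda>\<rho>. g \<rho> * speed x \<rho>)"

definition counterclockwise :: "(real \<Rightarrow> plane) \<Rightarrow> bool" where
  "counterclockwise x \<longleftrightarrow>
     (let \<gamma> = (\<lambda>\<rho>. Complex (x \<rho> $ 1) (x \<rho> $ 2))
      in simple_path \<gamma> \<and> (\<forall>z \<in> inside (path_image \<gamma>). winding_number \<gamma> z = 1))"

text \<open>Joint smoothness on \<open>\<real> \<times> [0,T]\<close>: \<open>g j l\<close> is \<open>\<partial>\<^sub>\<rho>\<^sup>j \<partial>\<^sub>t\<^sup>l\<close> of the function, with one-sided
  time derivatives at the end points.\<close>

definition smooth_family :: "real \<Rightarrow> (real \<Rightarrow> real \<Rightarrow> plane) \<Rightarrow> bool" where
  "smooth_family T X \<longleftrightarrow> (\<exists>g :: nat \<Rightarrow> nat \<Rightarrow> real \<Rightarrow> real \<Rightarrow> plane. g 0 0 = X \<and>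
     (\<forall>j l. continuous_on ({0..T} \<times> UNIV) (\<lambda>(t, \<rho>). g j l t \<rho>) \<and>
        (\<forall>t\<in>{0..T}. \<forall>\<rho>.
           (g j l t has_vector_derivative g (Suc j) l t \<rho>) (at \<rho>) \<and>
           ((\<lambda>s. g j l s \<rho>) has_vector_derivative g j (Suc l) t \<rho>) (at t within {0..T}))))"

text \<open>Curve shortening flow of embedded closed curves: the normal velocity equals the normal
  component of the curvature vector \<open>\<partial>\<^sub>s \<partial>\<^sub>s X\<close>; the tangential velocity is unconstrained, as the flow is
  one of curves and not of parametrizations.\<close>

definition curve_shortening_flow :: "real \<Rightarrow> (real \<Rightarrow> real \<Rightarrow> plane) \<Rightarrow> bool" where
  "curve_shortening_flow T X \<longleftrightarrow> smooth_family T X \<and>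
     (\<forall>t\<in>{0..T}. smooth_regular (X t) \<and> simple_path (X t) \<and>
        (\<forall>\<rho>. vector_derivative (\<lambda>s. X s \<rho>) (at t within {0..T}) \<bullet> normal (X t) \<rho>
              = arc_deriv (X t) (arc_deriv (X t) (X t)) \<rho> \<bullet> normal (X t) \<rho>))"

definition const_speed_param :: "(real \<Rightarrow> plane) \<Rightarrow> plane set \<Rightarrow> bool" where
  "const_speed_param x \<Gamma> \<longleftrightarrow> smooth_regular x \<and> simple_path x \<and> path_image x = \<Gamma> \<and>
     (\<exists>L. \<forall>\<rho>. speed x \<rho> = L) \<and> counterclockwise x"


subsection \<open>The time-semidiscrete step\<close>

text \<open>\<open>bgn_step \<tau> x X\<close> means \<open>X = \<F>\<^sub>\<tau>(x)\<close>.\<close>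

definition bgn_step :: "real \<Rightarrow> (real \<Rightarrow> plane) \<Rightarrow> (real \<Rightarrow> plane) \<Rightarrow> bool" where
  "bgn_step \<tau> x X \<longleftrightarrow> X \<in> H1 \<and> (\<forall>\<phi>\<in>H1.
     arc_integral x (\<lambda>\<rho>. (((1 / \<tau>) *\<^sub>R (X \<rho> - x \<rho>)) \<bullet> normal x \<rho>) * (\<phi> \<rho> \<bullet> normal x \<rho>))
     + arc_integral x (\<lambda>\<rho>. arc_deriv x X \<rho> \<bullet> arc_deriv x \<phi> \<rho>) = 0)"

definition velocity :: "real \<Rightarrow> (real \<Rightarrow> plane) \<Rightarrow> (real \<Rightarrow> plane) \<Rightarrow> real \<Rightarrow> plane" where
  "velocity \<tau> x X \<rho> = (1 / \<tau>) *\<^sub>R (X \<rho> - x \<rho>)"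

definition bgn_sequence :: "real \<Rightarrow> nat \<Rightarrow> (real \<Rightarrow> plane) \<Rightarrow> (nat \<Rightarrow> real \<Rightarrow> plane) \<Rightarrow> bool" where
  "bgn_sequence \<tau> M x0 xs \<longleftrightarrow> xs 0 = x0 \<and>
     (\<forall>m<M. smooth_regular (xs m) \<and> bgn_step \<tau> (xs m) (xs (Suc m)))"


subsection \<open>Finite elements\<close>

text \<open>A partition of \<open>\<T>\<close> into \<open>cells P\<close> elements \<open>{pt P j..pt P (Suc j)}\<close>, \<open>j < cells P\<close>; the last break point
  is the first one shifted by a period. Values of \<open>pt P\<close> beyond \<open>cells P\<close> are irrelevant.\<close>

record mesh =
  cells :: nat
  pt :: "nat \<Rightarrow> real"

definition is_mesh :: "mesh \<Rightarrow> bool" where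
  "is_mesh P \<longleftrightarrow> 1 \<le> cells P \<and> (\<forall>j<cells P. pt P j < pt P (Suc j)) \<and> pt P (cells P) = pt P 0 + 1"

definition elem :: "mesh \<Rightarrow> nat \<Rightarrow> real set" where
  "elem P j = {pt P j..pt P (Suc j)}"

definition len :: "mesh \<Rightarrow> nat \<Rightarrow> real" where
  "len P j = pt P (Suc j) - pt P j"

definition mesh_size :: "mesh \<Rightarrow> real" where
  "mesh_size P = Max (len P ` {..<cells P})"

definition quasi_uniform :: "real \<Rightarrow> mesh \<Rightarrow> bool" where
  "quasi_uniform \<sigma> P \<longleftrightarrow> (\<forall>j<cells P. mesh_size P \<le> \<sigma> * len P j)"

definition Vh :: "nat \<Rightarrow> mesh \<Rightarrow> (real \<Rightarrow> real) set" where
  "Vh k P = {\<eta>. continuous_on UNIV \<eta> \<and> periodic1 \<eta> \<and>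
     (\<forall>j<cells P. \<exists>q :: real poly. degree q \<le> k \<and> (\<forall>\<rho>\<in>elem P j. \<eta> \<rho> = poly q \<rho>))}"

definition Vh2 :: "nat \<Rightarrow> mesh \<Rightarrow> (real \<Rightarrow> plane) set" where
  "Vh2 k P = {u. \<forall>i. (\<lambda>\<rho>. u \<rho> $ i) \<in> Vh k P}"

text \<open>The Gauss--Lobatto rule with \<open>k + 1\<close> points on the reference interval \<open>[0,1]\<close>: both end points are
  nodes and the rule is exact up to degree \<open>2k - 1\<close>. This determines \<open>\<xi> l\<close> and \<open>w l\<close> for \<open>l \<le> k\<close>.\<close>

definition gauss_lobatto :: "nat \<Rightarrow> (nat \<Rightarrow> real) \<Rightarrow> (nat \<Rightarrow> real) \<Rightarrow> bool" where
  "gauss_lobatto k \<xi> w \<longleftrightarrow> \<xi> 0 = 0 \<and> \<xi> k = 1 \<and> (\<forall>l<k. \<xi> l < \<xi> (Suc l)) \<and> (\<forall>l\<le>k. 0 < w l) \<and>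
     (\<forall>q :: real poly. degree q \<le> 2 * k - 1 \<longrightarrow>
        (\<Sum>l\<le>k. w l * poly q (\<xi> l)) = integral {0..1} (poly q))"

definition lnode :: "(nat \<Rightarrow> real) \<Rightarrow> mesh \<Rightarrow> nat \<Rightarrow> nat \<Rightarrow> real" where
  "lnode \<xi> P j l = pt P j + len P j * \<xi> l"

text \<open>The global nodes \<open>\<rho>\<^sub>i\<close>, one representative for each point of \<open>\<T>\<close>. A global node is identified with
  this representative.\<close>

definition nodes :: "nat \<Rightarrow> (nat \<Rightarrow> real) \<Rightarrow> mesh \<Rightarrow> real set" where
  "nodes k \<xi> P = {lnode \<xi> P j l | j l. j < cells P \<and> l \<le> k} \<inter> {pt P 0..<pt P (cells P)}"

text \<open>The pairs (element \<open>K\<close>, local index) of the global node \<open>\<rho>\<close>: one for an interior node of an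
  element, two for a vertex. Nodes are compared modulo 1.\<close>

definition incident :: "nat \<Rightarrow> (nat \<Rightarrow> real) \<Rightarrow> mesh \<Rightarrow> real \<Rightarrow> (nat \<times> nat) set" where
  "incident k \<xi> P \<rho> = {(j, l). j < cells P \<and> l \<le> k \<and> lnode \<xi> P j l - \<rho> \<in> \<int>}"

text \<open>\<open>(y|\<^sub>K)'\<close> at a local node; at vertices this is the one-sided derivative from inside \<open>K\<close>.\<close>

definition elem_deriv :: "(nat \<Rightarrow> real) \<Rightarrow> mesh \<Rightarrow> (real \<Rightarrow> plane) \<Rightarrow> nat \<Rightarrow> nat \<Rightarrow> plane" where
  "elem_deriv \<xi> P y j l = vector_derivative y (at (lnode \<xi> P j l) within elem P j)"

definition mu :: "nat \<Rightarrow> (nat \<Rightarrow> real) \<Rightarrow> (nat \<Rightarrow> real) \<Rightarrow> mesh \<Rightarrow> (real \<Rightarrow> plane) \<Rightarrow> real \<Rightarrow> real" where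
  "mu k \<xi> w P y \<rho> = (\<Sum>(j, l)\<in>incident k \<xi> P \<rho>. (len P j * w l) * norm (elem_deriv \<xi> P y j l))"

definition omega :: "nat \<Rightarrow> (nat \<Rightarrow> real) \<Rightarrow> (nat \<Rightarrow> real) \<Rightarrow> mesh \<Rightarrow> (real \<Rightarrow> plane) \<Rightarrow> real \<Rightarrow> plane" where
  "omega k \<xi> w P y \<rho> = (1 / mu k \<xi> w P y \<rho>) *\<^sub>R
     (\<Sum>(j, l)\<in>incident k \<xi> P \<rho>. (len P j * w l) *\<^sub>R J (elem_deriv \<xi> P y j l))"

definition a_form :: "(real \<Rightarrow> plane) \<Rightarrow> (real \<Rightarrow> plane) \<Rightarrow> (real \<Rightarrow> plane) \<Rightarrow> real" where
  "a_form y u \<phi> = integral {0..1} (\<lambda>\<rho>. (dd u \<rho> \<bullet> dd \<phi> \<rho>) / norm (dd y \<rho>))"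

definition b_form ::
  "nat \<Rightarrow> (nat \<Rightarrow> real) \<Rightarrow> (nat \<Rightarrow> real) \<Rightarrow> mesh \<Rightarrow> (real \<Rightarrow> plane) \<Rightarrow> (real \<Rightarrow> plane) \<Rightarrow> (real \<Rightarrow> plane) \<Rightarrow> real"
where
  "b_form k \<xi> w P y u \<phi> = (\<Sum>\<rho>\<in>nodes k \<xi> P.
     mu k \<xi> w P y \<rho> * (u \<rho> \<bullet> omega k \<xi> w P y \<rho>) * (\<phi> \<rho> \<bullet> omega k \<xi> w P y \<rho>))"

definition interp :: "nat \<Rightarrow> (nat \<Rightarrow> real) \<Rightarrow> mesh \<Rightarrow> (real \<Rightarrow> plane) \<Rightarrow> real \<Rightarrow> plane" where
  "interp k \<xi> P f = (THE u. u \<in> Vh2 k P \<and> (\<forall>\<rho>\<in>nodes k \<xi> P. u \<rho> = f \<rho>))"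

text \<open>\<open>\<F>\<^sub>h\<^sub>,\<^sub>\<tau>(y)\<close>.\<close>

definition fe_step ::
  "nat \<Rightarrow> (nat \<Rightarrow> real) \<Rightarrow> (nat \<Rightarrow> real) \<Rightarrow> mesh \<Rightarrow> real \<Rightarrow> (real \<Rightarrow> plane) \<Rightarrow> real \<Rightarrow> plane"
where
  "fe_step k \<xi> w P \<tau> y = (THE Y. Y \<in> Vh2 k P \<and> (\<forall>\<phi>\<in>Vh2 k P.
     a_form y Y \<phi> + (1 / \<tau>) * b_form k \<xi> w P y (\<lambda>\<rho>. Y \<rho> - y \<rho>) \<phi> = 0))"


subsection \<open>The class of inputs\<close>

definition admissible_input ::
  "real \<Rightarrow> real \<Rightarrow> (nat \<Rightarrow> real) \<Rightarrow> real \<Rightarrow> (real \<Rightarrow> plane) \<Rightarrow> (real \<Rightarrow> plane) \<Rightarrow> bool"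
where
  "admissible_input c_low c_up Cr \<tau> x X \<longleftrightarrow>
     smooth_regular x \<and> (\<forall>\<rho>. c_low \<le> speed x \<rho> \<and> speed x \<rho> \<le> c_up) \<and> bgn_step \<tau> x X \<and>
     (let v = velocity \<tau> x X;
          z = (\<lambda>\<rho>. speed x \<rho> *\<^sub>R ((v \<rho> \<bullet> normal x \<rho>) *\<^sub>R normal x \<rho>))
      in \<forall>r\<ge>1. x \<in> Winf (r + 1) \<and> v \<in> Winf r \<and> z \<in> Winf r \<and>
           Winf_norm (r + 1) x + Winf_norm r v + Winf_norm r z \<le> ereal (Cr r))"

text \<open>\<open>N\<close> contains a \<open>W\<^sup>1\<^sup>,\<^sup>\<infinity>\<close> tube, of a radius independent of the time step, around the time-semidiscrete
  parametrizations for all steps \<open>\<tau> = T/M \<le> \<tau>0\<close>. The bound \<open>\<tau>0\<close> only reflects that these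
  parametrizations are under control for small time steps.\<close>

definition bgn_neighborhood ::
  "real \<Rightarrow> real \<Rightarrow> (real \<Rightarrow> plane) \<Rightarrow> (real \<Rightarrow> plane) set \<Rightarrow> bool"
where
  "bgn_neighborhood T \<tau>0 x0 N \<longleftrightarrow> N \<subseteq> Winf 1 \<and>
     (\<exists>\<delta>>0. \<forall>\<tau> M xs. 0 < \<tau> \<and> \<tau> \<le> \<tau>0 \<and> real M * \<tau> = T \<and> bgn_sequence \<tau> M x0 xs \<longrightarrow>
        (\<forall>m\<le>M. \<forall>y\<in>Winf 1. Winf_norm 1 (\<lambda>\<rho>. y \<rho> - xs m \<rho>) < ereal \<delta> \<longrightarrow> y \<in> N))"

definition uniformly_regular :: "(real \<Rightarrow> plane) set \<Rightarrow> bool" where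
  "uniformly_regular N \<longleftrightarrow> (\<exists>r>0. \<exists>R. \<forall>y\<in>N. AE \<rho> in lebesgue. r \<le> norm (dd y \<rho>) \<and> norm (dd y \<rho>) \<le> R)"

definition uniformly_coercive ::
  "nat \<Rightarrow> (nat \<Rightarrow> real) \<Rightarrow> (nat \<Rightarrow> real) \<Rightarrow> mesh set \<Rightarrow> (real \<Rightarrow> plane) set \<Rightarrow> bool"
where
  "uniformly_coercive k \<xi> w \<T> N \<longleftrightarrow> (\<exists>c>0. \<exists>h1>0. \<forall>P\<in>\<T>. mesh_size P \<le> h1 \<longrightarrow>
     (\<forall>y\<in>Vh2 k P \<inter> N. \<forall>u\<in>Vh2 k P.
        a_form y u u + b_form k \<xi> w P y u u \<ge> c * (H1_norm u)\<^sup>2))"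

end

theory Submission
  imports Defs
begin

text \<open>Write \<open>y\<close> and \<open>Z\<close> for the interpolants of \<open>x\<close> and \<open>X\<close>. By coercivity, \<open>\<tau> \<le> 1\<close> and the weak form of the
  time-semidiscrete step, the \<open>H\<^sup>1\<close> norm of the difference of the discrete solution and \<open>Z\<close> is bounded by the
  consistency errors of the stiffness term \<open>a\<close> at \<open>Z\<close> and of the lumped term \<open>b\<close> at the velocity, which do not involve \<open>\<tau>\<close>.
  The derivative of an interpolation error is only \<open>O(h\<^bsup>k\<^esup>)\<close>, but on an element of length \<open>L\<close> its leading part is
  \<open>L\<^bsup>k\<^esup> r(s) d\<close> with a constant vector \<open>d\<close> and a fixed polynomial \<open>r\<close> of degree \<open>k\<close> that is orthogonal to polynomials of degree
  below \<open>k\<close> and annihilated by the Gauss--Lobatto rule. Both forms are linearized at \<open>x\<close>, with quadratic remainder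
  \<open>O(h\<^bsup>2k\<^esup>)\<close>, and the smooth coefficients are frozen on each element, at the price of a factor \<open>O(h)\<close>. The leading part then
  drops out: in the stiffness term by orthogonality to \<open>\<phi>'\<close>, in the lumped term, after also freezing \<open>\<phi>\<close>, by the
  quadrature property. What remains is the error of the quadrature rule for \<open>\<bar>x'\<bar> (v \<bullet> n) (n \<bullet> \<phi>)\<close>.\<close>

section \<open>Interpolation on the reference element\<close>

text \<open>At the nodes Z = y + \<tau> v holds exactly, with v the velocity, and the lumped form
  reads nodal values only; so (1/\<tau>) b (Z - y, \<phi>) = b (v, \<phi>), and neither a factor
  1/\<tau> nor an interpolation error of v appears. The obstacle is that \<phi> is controlled in H^1
  alone, and inverse estimates would cost powers of h. Cell by cell, \<phi> therefore enters only
  through its sup norm and its variation over the element (\<open>cvar\<close>). The lengths sum to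
  1 and the variations to at most the H^1 norm, so on an element of length L an error L^(k+2)
  against the sup norm and an error L^(k+1) against the variation are both affordable. Quadratic
  remainders fit because 2 k \<ge> k + 1 for every k \<ge> 1.\<close>

lemma pderiv_sum: "pderiv (\<Sum>i\<in>A. f i) = (\<Sum>i\<in>A. pderiv (f i))"
  by (induction A rule: infinite_finite_induct) (simp_all add: pderiv_add)

locale lobatto_rule =
  fixes k :: nat and \<xi> w :: "nat \<Rightarrow> real"
  assumes k_pos: "k \<ge> 1" and rule: "gauss_lobatto k \<xi> w"
begin

lemma xi_0: "\<xi> 0 = 0" and xi_k: "\<xi> k = 1"
  and xi_Suc: "l < k \<Longrightarrow> \<xi> l < \<xi> (Suc l)" and w_pos: "l \<le> k \<Longrightarrow> 0 < w l"
  and exact: "degree q \<le> 2 * k - 1 \<Longrightarrow> (\<Sum>l\<le>k. w l * poly q (\<xi> l)) = integral {0..1} (poly q)"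
  using rule by (auto simp: gauss_lobatto_def)

lemma xi_less: "i < j \<Longrightarrow> j \<le> k \<Longrightarrow> \<xi> i < \<xi> j"
proof (induction j)
  case (Suc j)
  then show ?case
    using xi_Suc[of j] by (cases "i = j") auto
qed simp

lemma xi_inj: "i \<le> k \<Longrightarrow> j \<le> k \<Longrightarrow> \<xi> i = \<xi> j \<longleftrightarrow> i = j"
  by (metis less_irrefl linorder_neqE_nat xi_less)

lemma xi_bounds: "l \<le> k \<Longrightarrow> 0 \<le> \<xi> l \<and> \<xi> l \<le> 1"
  using xi_less[of 0 l] xi_less[of l k] xi_0 xi_k by (cases "l = 0"; cases "l = k") auto

lemma sum_w: "(\<Sum>l\<le>k. w l) = 1"
  using exact[of 1] by (simp add: poly_1[abs_def])

text \<open>The Lagrange basis of the nodes. Expanding in it makes \<open>ref_interp\<close> linear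
  in the nodal values by construction.\<close>

definition lag :: "nat \<Rightarrow> real poly" where
  "lag l = (\<Prod>m\<in>{..k} - {l}. smult (1 / (\<xi> l - \<xi> m)) [:- \<xi> m, 1:])"

definition ref_interp :: "(real \<Rightarrow> real) \<Rightarrow> real poly" where
  "ref_interp g = (\<Sum>l\<le>k. smult (g (\<xi> l)) (lag l))"

lemma degree_lag: assumes "l \<le> k" shows "degree (lag l) \<le> k"
proof -
  have "degree (lag l) \<le> (\<Sum>m\<in>{..k} - {l}. degree (smult (1 / (\<xi> l - \<xi> m)) [:- \<xi> m, 1:]))"
    unfolding lag_def by (rule order_trans[OF degree_prod_sum_le]) (simp_all add: o_def)
  also have "\<dots> \<le> (\<Sum>m\<in>{..k} - {l}. 1)"
    by (intro sum_mono) simp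
  also have "\<dots> = k" using assms by (simp add: card_Diff_singleton)
  finally show ?thesis .
qed

lemma lag_node: assumes "l \<le> k" "m \<le> k" shows "poly (lag l) (\<xi> m) = (if l = m then 1 else 0)"
proof (cases "l = m")
  case True
  have "\<xi> m - \<xi> n \<noteq> 0" if "n \<in> {..k} - {m}" for n
    using that xi_inj[of m n] assms by auto
  then show ?thesis
    using True by (auto simp: lag_def poly_prod diff_divide_distrib[symmetric] intro!: prod.neutral)
next
  case False
  then show ?thesis
    using assms by (auto simp: lag_def poly_prod intro!: prod_zero bexI[of _ m])
qed

lemma degree_ref_interp: "degree (ref_interp g) \<le> k"
  unfolding ref_interp_def
  by (intro degree_sum_le) (auto intro: order_trans[OF degree_smult_le] degree_lag)

lemma ref_interp_node: "m \<le> k \<Longrightarrow> poly (ref_interp g) (\<xi> m) = g (\<xi> m)"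
  by (simp add: ref_interp_def poly_sum lag_node if_distrib cong: if_cong)

lemma poly_eq_nodes:
  fixes p q :: "real poly"
  assumes "degree p \<le> k" "degree q \<le> k" "\<And>l. l \<le> k \<Longrightarrow> poly p (\<xi> l) = poly q (\<xi> l)"
  shows "p = q"
proof (rule poly_eqI_degree[where A = "\<xi> ` {..k}"])
  have "card (\<xi> ` {..k}) = Suc k"
    using xi_inj by (subst card_image) (auto intro!: inj_onI)
  then show "card (\<xi> ` {..k}) > degree p" "card (\<xi> ` {..k}) > degree q"
    using assms by auto
qed (use assms in auto)

lemma ref_interp_poly: "degree p \<le> k \<Longrightarrow> ref_interp (poly p) = p"
  by (intro poly_eq_nodes) (auto simp: degree_ref_interp ref_interp_node)

lemma ref_interp_add: "ref_interp (\<lambda>s. f s + g s) = ref_interp f + ref_interp g"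
  by (simp add: ref_interp_def smult_add_left sum.distrib)

lemma ref_interp_cmult: "ref_interp (\<lambda>s. c * g s) = smult c (ref_interp g)"
  by (simp add: ref_interp_def poly_eq_poly_eq_iff[symmetric] fun_eq_iff poly_sum sum_distrib_left mult.assoc)

text \<open>The derivative of the interpolation error of \<open>s\<^bsup>k+1\<^esup>\<close>, which is the leading part of the derivative
  of every interpolation error.\<close>

definition res_poly :: "real poly" where
  "res_poly = pderiv (monom 1 (k + 1) - ref_interp (\<lambda>s. s ^ (k + 1)))"

lemma degree_res_poly: "degree res_poly \<le> k"
proof -
  have "degree (monom 1 (k + 1) - ref_interp (\<lambda>s. s ^ (k + 1))) \<le> k + 1"
    by (intro degree_diff_le) (auto simp: degree_monom_eq intro: order_trans[OF degree_ref_interp])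
  then show ?thesis by (simp add: res_poly_def degree_pderiv)
qed

lemma poly_has_integral:
  fixes p :: "real poly"
  shows "(poly (pderiv p) has_integral (poly p 1 - poly p 0)) {0..1}"
  by (intro fundamental_theorem_of_calculus)
     (auto simp: has_real_derivative_iff_has_vector_derivative[symmetric] intro: DERIV_subset[OF poly_DERIV])

text \<open>Integrate by parts, with E the interpolation error of s^(k+1), so that E' =
  \<open>res_poly\<close>. The boundary terms vanish because both end points are nodes. The other
  term E q' has degree at most (k+1) + (k-2) = 2k-1, so the rule integrates it exactly, and gives 0
  since E vanishes at all nodes.\<close>

lemma res_poly_orthogonal:
  assumes "degree q \<le> k - 1"
  shows "integral {0..1} (\<lambda>s. poly res_poly s * poly q s) = 0"
proof -
  define E where "E = monom 1 (k + 1) - ref_interp (\<lambda>s. s ^ (k + 1))"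
  have E: "poly E (\<xi> l) = 0" if "l \<le> k" for l
    using that by (simp add: E_def ref_interp_node poly_monom)
  have dE: "degree E \<le> k + 1"
    unfolding E_def
    by (intro degree_diff_le) (auto simp: degree_monom_eq intro: order_trans[OF degree_ref_interp])
  \<comment> \<open>Constant q is treated apart: with subtraction truncated at 0, the degree count
    would give k + 1, which exceeds 2k - 1 when k = 1.\<close>
  have deg: "degree (E * pderiv q) \<le> 2 * k - 1"
  proof (cases "pderiv q = 0")
    case False
    then have "degree q \<noteq> 0" by (simp add: pderiv_eq_0_iff)
    then show ?thesis
      using degree_mult_le[of E "pderiv q"] dE assms by (simp add: degree_pderiv)
  qed simp
  have int: "poly r integrable_on {0..1}" for r :: "real poly"
    by (intro integrable_continuous_real continuous_intros)
  have "integral {0..1} (poly (E * pderiv q)) = (\<Sum>l\<le>k. w l * poly (E * pderiv q) (\<xi> l))"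
    using exact[OF deg] by simp
  also have "\<dots> = 0" by (intro sum.neutral) (simp add: E)
  finally have 1: "integral {0..1} (poly (E * pderiv q)) = 0" .
  have "integral {0..1} (poly (pderiv (E * q))) = poly (E * q) 1 - poly (E * q) 0"
    using poly_has_integral by (rule integral_unique)
  also have "\<dots> = 0" using E[of 0] E[of k] by (simp add: xi_0 xi_k)
  finally have "0 = integral {0..1} (poly (E * pderiv q + pderiv E * q))"
    by (simp add: pderiv_mult mult.commute del: poly_add poly_mult)
  also have "\<dots> = integral {0..1} (\<lambda>s. poly (E * pderiv q) s + poly (pderiv E * q) s)"
    by (intro arg_cong[of _ _ "integral {0..1}"] ext) (rule poly_add)
  also have "\<dots> = integral {0..1} (poly (E * pderiv q)) + integral {0..1} (poly (pderiv E * q))"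
    by (rule integral_add[OF int int])
  finally have 2: "integral {0..1} (poly (pderiv E * q)) = 0" using 1 by simp
  have "res_poly = pderiv E" by (simp add: res_poly_def E_def)
  moreover have "(\<lambda>s. poly res_poly s * poly q s) = poly (res_poly * q)" by auto
  ultimately show ?thesis using 2 by simp
qed

text \<open>The rule is exact on \<open>res_poly\<close> because k \<le> 2k - 1, so this is
  orthogonality to the constant 1.\<close>

lemma res_poly_quadrature: "(\<Sum>l\<le>k. w l * poly res_poly (\<xi> l)) = 0"
proof -
  have "(\<Sum>l\<le>k. w l * poly res_poly (\<xi> l)) = integral {0..1} (poly res_poly)"
    using degree_res_poly k_pos by (intro exact) auto
  then show ?thesis using res_poly_orthogonal[of 1] by simp
qed

end

section \<open>Taylor polynomials and the leading term of the interpolation error\<close>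

lemma poly_bounded_01: "\<exists>B\<ge>0. \<forall>s\<in>{0..1}. \<bar>poly (p :: real poly) s\<bar> \<le> B"
proof -
  have "bounded (poly p ` {0..1})"
    by (intro compact_imp_bounded compact_continuous_image) (auto intro!: continuous_intros)
  then obtain B where B: "\<And>s. s \<in> {0..1} \<Longrightarrow> \<bar>poly p s\<bar> \<le> B"
    by (force simp: bounded_iff)
  with order_trans[OF abs_ge_zero B[of 0]] show ?thesis by (intro exI[of _ B]) auto
qed

text \<open>The family g lists a function together with its successive derivatives, so that
  differentiating is shifting the index. The argument n counts terms; the degree is at most n -
  1.\<close>

definition taylor_poly :: "nat \<Rightarrow> (nat \<Rightarrow> real \<Rightarrow> real) \<Rightarrow> real poly" where
  "taylor_poly n g = (\<Sum>m<n. monom (g m 0 / fact m) m)"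

lemma degree_taylor_poly: "degree (taylor_poly n g) \<le> n - 1"
  unfolding taylor_poly_def
  by (intro degree_sum_le) (auto intro: order_trans[OF degree_monom_le])

text \<open>The power of s in the Lagrange remainder is simply bounded by 1: for a function pulled
  back from an element of length L, the smallness L^n already sits in g n.\<close>

lemma taylor_poly_error:
  assumes "\<And>m s. m < n \<Longrightarrow> (g m has_real_derivative g (Suc m) s) (at s)" "\<And>s. \<bar>g n s\<bar> \<le> M"
    and "s \<in> {0..1}"
  shows "\<bar>g 0 s - poly (taylor_poly n g) s\<bar> \<le> M"
proof -
  have "\<exists>t. \<bar>t\<bar> \<le> \<bar>s\<bar> \<and> g 0 s = (\<Sum>m<n. g m 0 / fact m * s ^ m) + g n t / fact n * s ^ n"
    by (rule Maclaurin_bi_le) (use assms in auto)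
  then obtain t where t: "g 0 s = (\<Sum>m<n. g m 0 / fact m * s ^ m) + g n t / fact n * s ^ n"
    by blast
  have "\<bar>g n t / fact n * s ^ n\<bar> = \<bar>g n t\<bar> * (s ^ n / fact n)"
    using assms(3) by (simp add: abs_mult)
  also have "\<dots> \<le> M * 1"
  proof (intro mult_mono assms)
    have "s ^ n \<le> 1" using assms(3) by (intro power_le_one) auto
    then show "s ^ n / fact n \<le> 1" using order_trans[OF _ fact_ge_1] by simp
  qed (use assms(2)[of t] assms(3) in auto)
  finally show ?thesis by (simp add: t taylor_poly_def poly_sum poly_monom)
qed

lemma pderiv_taylor_poly: "pderiv (taylor_poly (Suc n) g) = taylor_poly n (\<lambda>m. g (Suc m))"
proof -
  have "pderiv (taylor_poly (Suc n) g) = (\<Sum>m<Suc n. pderiv (monom (g m 0 / fact m) m))"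
    by (simp add: taylor_poly_def pderiv_sum del: sum.lessThan_Suc)
  also have "\<dots> = taylor_poly n (\<lambda>m. g (Suc m))"
    unfolding sum.lessThan_Suc_shift taylor_poly_def
    by (auto simp: pderiv_monom monom_0 intro!: sum.cong)
  finally show ?thesis .
qed

text \<open>Split g 0 into its Taylor polynomial T of degree k + 1 and a remainder R. Interpolation
  reproduces the part of T of degree at most k; the top monomial leaves exactly a multiple of
  \<open>res_poly\<close>. The interpolant of R is a combination of the Lagrange basis with
  coefficients bounded by M.\<close>

lemma (in lobatto_rule) ref_interp_error:
  "\<exists>C\<ge>0. \<forall>g M. (\<forall>m s. m < k + 2 \<longrightarrow> (g m has_real_derivative g (Suc m) s) (at s)) \<and> (\<forall>s. \<bar>g (k + 2) s\<bar> \<le> M) \<longrightarrow>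
    (\<forall>s\<in>{0..1}. \<bar>poly (pderiv (ref_interp (g 0))) s - g 1 s + g (k + 1) 0 / fact (k + 1) * poly res_poly s\<bar> \<le> C * M)"
proof -
  have "\<exists>B. \<forall>l. B l \<ge> 0 \<and> (\<forall>s\<in>{0..1}. \<bar>poly (pderiv (lag l)) s\<bar> \<le> B l)"
    by (intro choice allI) (use poly_bounded_01 in auto)
  then obtain B where B: "\<And>l. B l \<ge> 0" "\<And>l s. s \<in> {0..1} \<Longrightarrow> \<bar>poly (pderiv (lag l)) s\<bar> \<le> B l"
    by metis
  \<comment> \<open>The 1 accounts for the Taylor remainder of g 1, the sum for the derivative of
    the interpolated remainder R.\<close>
  define C where "C = 1 + (\<Sum>l\<le>k. B l)"
  have "\<bar>poly (pderiv (ref_interp (g 0))) s - g 1 s + g (k + 1) 0 / fact (k + 1) * poly res_poly s\<bar> \<le> C * M"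
    if g: "\<And>m s. m < k + 2 \<Longrightarrow> (g m has_real_derivative g (Suc m) s) (at s)" "\<And>s. \<bar>g (k + 2) s\<bar> \<le> M"
      and s: "s \<in> {0..1}" for g M s
  proof -
    define T where "T = taylor_poly (k + 2) g"
    define c where "c = g (k + 1) 0 / fact (k + 1)"
    define R where "R = (\<lambda>s. g 0 s - poly T s)"
    have T: "T = taylor_poly (k + 1) g + smult c (monom 1 (k + 1))"
      by (simp add: T_def c_def taylor_poly_def smult_monom)
    have R: "\<bar>R s\<bar> \<le> M" if "s \<in> {0..1}" for s
      unfolding R_def T_def using that g by (intro taylor_poly_error) auto
    have "\<bar>g 1 s - poly (taylor_poly (k + 1) (\<lambda>m. g (Suc m))) s\<bar> \<le> M"
      using taylor_poly_error[of "k + 1" "\<lambda>m. g (Suc m)" M s] g s by auto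
    then have R': "\<bar>g 1 s - poly (pderiv T) s\<bar> \<le> M"
      by (simp add: T_def pderiv_taylor_poly)
    have "ref_interp (poly T) = ref_interp (poly (taylor_poly (k + 1) g)) + smult c (ref_interp (\<lambda>s. s ^ (k + 1)))"
      unfolding ref_interp_add[symmetric] ref_interp_cmult[symmetric] by (intro arg_cong[of _ _ ref_interp] ext) (simp add: T poly_monom)
    then have IT: "ref_interp (poly T) = T - smult c (monom 1 (k + 1) - ref_interp (\<lambda>s. s ^ (k + 1)))"
      using degree_taylor_poly[of "k + 1" g]
      by (simp add: T ref_interp_poly smult_diff_right)
    have "g 0 = (\<lambda>s. poly T s + R s)" by (auto simp: R_def)
    then have "ref_interp (g 0) = ref_interp (poly T) + ref_interp R"
      by (simp add: ref_interp_add)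
    then have D: "pderiv (ref_interp (g 0)) = pderiv T - smult c res_poly + pderiv (ref_interp R)"
      by (simp add: IT res_poly_def pderiv_add pderiv_diff pderiv_smult)
    have "poly (pderiv (ref_interp R)) s = (\<Sum>l\<le>k. R (\<xi> l) * poly (pderiv (lag l)) s)"
      by (simp add: ref_interp_def pderiv_sum pderiv_smult poly_sum)
    also have "\<bar>\<dots>\<bar> \<le> (\<Sum>l\<le>k. \<bar>R (\<xi> l) * poly (pderiv (lag l)) s\<bar>)" by (rule sum_abs)
    also have "\<dots> \<le> (\<Sum>l\<le>k. M * B l)"
      unfolding abs_mult
      by (intro sum_mono mult_mono R B s) (use xi_bounds R[OF s] in auto)
    finally have "\<bar>poly (pderiv (ref_interp R)) s\<bar> \<le> (\<Sum>l\<le>k. B l) * M"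
      by (simp add: sum_distrib_left mult.commute)
    with R' show ?thesis
      unfolding D c_def[symmetric] C_def by (simp add: algebra_simps abs_le_iff)
  qed
  moreover have "C \<ge> 0" using B by (simp add: C_def sum_nonneg)
  ultimately show ?thesis by blast
qed

section \<open>Smooth periodic functions\<close>

lemma has_vector_derivative_translate:
  fixes f :: "real \<Rightarrow> 'a::real_normed_vector"
  shows "(f has_vector_derivative D) (at (x + c)) \<longleftrightarrow> ((\<lambda>t. f (t + c)) has_vector_derivative D) (at x)"
proof -
  have *: "((\<lambda>t. f (t + c)) has_vector_derivative D) (at x)"
    if "(f has_vector_derivative D) (at (x + c))" for f :: "real \<Rightarrow> 'a" and x c
  proof -
    have "((\<lambda>t. t + c) has_vector_derivative 1) (at x)" by (auto intro!: derivative_eq_intros)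
    from vector_diff_chain_at[OF this that] show ?thesis by (simp add: o_def)
  qed
  show ?thesis
    using *[of f x c] *[of "\<lambda>t. f (t + c)" "x + c" "- c"] by auto
qed

text \<open>True even where f has no derivative, as at break points: the choice behind
  \<open>vector_derivative\<close> is made from the same candidates at \<rho> and at \<rho> +
  1.\<close>

lemma periodic1_dd: "periodic1 f \<Longrightarrow> periodic1 (dd f)"
  by (auto simp: periodic1_def dd_def vector_derivative_def has_vector_derivative_translate)

lemma periodic1_int:
  assumes "periodic1 f" shows "f (\<rho> + of_int n) = f \<rho>"
proof -
  have nat: "f (\<rho> + real m) = f \<rho>" for \<rho> m
  proof (induction m)
    case (Suc m)
    have "f (\<rho> + real (Suc m)) = f ((\<rho> + real m) + 1)" by (simp add: algebra_simps)
    also have "\<dots> = f (\<rho> + real m)" using assms unfolding periodic1_def by blast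
    finally show ?case using Suc by simp
  qed simp
  show ?thesis
  proof (cases "n \<ge> 0")
    case True then show ?thesis using nat[of \<rho> "nat n"] by simp
  next
    case False then show ?thesis using nat[of "\<rho> + of_int n" "nat (- n)"] by simp
  qed
qed

lemma periodic1_Ints: "periodic1 f \<Longrightarrow> x - y \<in> \<int> \<Longrightarrow> f x = f y"
  by (auto elim!: Ints_cases) (metis add.commute diff_add_cancel periodic1_int)

lemma periodic1_reduce: "periodic1 f \<Longrightarrow> f \<rho> = f (frac \<rho>)"
  by (intro periodic1_Ints) (simp_all add: frac_def)

text \<open>The working form of the input class: genuine derivatives of every order, with pointwise
  bounds up to order m in place of essential suprema.\<close>

definition bounded_smooth :: "nat \<Rightarrow> real \<Rightarrow> (real \<Rightarrow> plane) \<Rightarrow> bool" where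
  "bounded_smooth m B f \<longleftrightarrow> periodic1 f \<and>
     (\<forall>j \<rho>. ((dd ^^ j) f has_vector_derivative (dd ^^ Suc j) f \<rho>) (at \<rho>)) \<and>
     (\<forall>j\<le>m. \<forall>\<rho>. norm ((dd ^^ j) f \<rho>) \<le> B)"

lemma abs_cont_eq:
  assumes "abs_cont f" "a \<le> b" shows "f b = f a + integral {a..b} (dd f)"
proof -
  have "(dd f has_integral (f b - f a)) {a..b}" using assms by (simp add: abs_cont_def)
  then show ?thesis by (simp add: integral_unique)
qed

lemma abs_cont_continuous:
  assumes "abs_cont f" shows "continuous_on UNIV f"
proof -
  have "isCont f x" for x
  proof -
    have "dd f absolutely_integrable_on {x - 1..x + 1}"
      using assms by (simp add: abs_cont_def)
    then have int: "dd f integrable_on {x - 1..x + 1}"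
      by (simp add: absolutely_integrable_on_def)
    have "continuous_on {x - 1..x + 1} (\<lambda>b. f (x - 1) + integral {x - 1..b} (dd f))"
      by (intro continuous_intros indefinite_integral_continuous_1 int)
    then have "continuous_on {x - 1..x + 1} f"
      by (rule continuous_on_eq) (rule abs_cont_eq[OF assms, symmetric], simp)
    then show ?thesis
      by (rule continuous_on_interior) simp
  qed
  then show ?thesis by (simp add: continuous_at_imp_continuous_on)
qed

lemma abs_cont_has_derivative:
  assumes "abs_cont f" "continuous_on UNIV (dd f)"
  shows "(f has_vector_derivative dd f x) (at x)"
proof -
  have "((\<lambda>u. f (x - 1) + integral {x - 1..u} (dd f)) has_vector_derivative dd f x) (at x within {x - 1..x + 1})"
    using integral_has_vector_derivative[of "x - 1" "x + 1" "dd f" x] assms(2)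
    by (auto intro!: derivative_eq_intros continuous_on_subset[OF assms(2)])
  then have "(f has_vector_derivative dd f x) (at x within {x - 1..x + 1})"
    by (rule has_vector_derivative_transform[rotated 2]) (simp, rule abs_cont_eq[OF assms(1)], simp)
  then show ?thesis by (simp add: at_within_Icc_at)
qed

lemma esssup_norm_nonneg:
  fixes f :: "real \<Rightarrow> plane"
  shows "0 \<le> esssup (lebesgue_on {0..1}) (\<lambda>\<rho>. ereal (norm (f \<rho>)))"
proof -
  have "esssup (lebesgue_on {0..1::real}) (\<lambda>\<rho>. 0) \<le> esssup (lebesgue_on {0..1}) (\<lambda>\<rho>. ereal (norm (f \<rho>)))"
    by (intro esssup_AE_mono) auto
  \<comment> \<open>This rests on the interval having positive measure; over a null space the
    essential supremum would be -\<infinity>.\<close>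
  moreover have "esssup (lebesgue_on {0..1::real}) (\<lambda>\<rho>. 0 :: ereal) = 0"
    by (intro esssup_const) (simp add: emeasure_restrict_space)
  ultimately show ?thesis by simp
qed

lemma Winf_norm_nonneg: "0 \<le> Winf_norm r f"
  unfolding Winf_norm_def by (intro sum_nonneg esssup_norm_nonneg)

text \<open>The points of the open interval where the bound fails form a set that is open by
  continuity and also null, hence empty. Closure and periodicity give the remaining points.\<close>

lemma esssup_norm_bound:
  assumes "continuous_on UNIV f" "periodic1 f"
    and "esssup (lebesgue_on {0..1}) (\<lambda>\<rho>. ereal (norm (f \<rho> :: plane))) \<le> ereal B"
  shows "norm (f \<rho>) \<le> B"
proof -
  have "AE \<rho> in lebesgue_on {0..1}. ereal (norm (f \<rho>)) \<le> ereal B"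
    using esssup_AE[of "\<lambda>\<rho>. ereal (norm (f \<rho>))" "lebesgue_on {0..1}"]
    by (rule eventually_mono) (use assms(3) order_trans in blast)
  then have "AE \<rho> in lebesgue. \<rho> \<in> {0..1} \<longrightarrow> norm (f \<rho>) \<le> B"
    by (subst (asm) AE_restrict_space_iff) auto
  then have "negligible {\<rho>. \<not> (\<rho> \<in> {0..1} \<longrightarrow> norm (f \<rho>) \<le> B)}"
    by (auto simp: negligible_iff_null_sets eventually_ae_filter Collect_conj_eq intro: completion.complete2)
  then have "negligible ({0<..<1} \<inter> {\<rho>. B < norm (f \<rho>)})"
    by (rule negligible_subset) auto
  moreover have "open ({0<..<1} \<inter> {\<rho>. B < norm (f \<rho>)})"
    by (intro open_Int open_Collect_less continuous_intros assms)
  ultimately have "{0<..<1} \<inter> {\<rho>. B < norm (f \<rho>)} = {}"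
    using open_not_negligible by blast
  then have "norm (f \<rho>) \<le> B" if "\<rho> \<in> {0<..<1}" for \<rho> using that by force
  then have "norm (f (frac \<rho>)) \<le> B"
    by (intro continuous_on_closure_norm_le[of "{0<..<1}" f])
       (auto intro: continuous_on_subset[OF assms(1)] simp: less_imp_le frac_lt_1)
  then show ?thesis using periodic1_reduce[OF assms(2)] by simp
qed

text \<open>Membership for every r makes each derivative absolutely continuous, hence continuous, so
  that the a.e. derivative of the preceding one is a derivative everywhere.\<close>

lemma Winf_bounded_smooth:
  assumes W: "\<And>r. r \<ge> 1 \<Longrightarrow> f \<in> Winf r" and B: "Winf_norm m f \<le> ereal B"
  shows "bounded_smooth m B f"
proof -
  have per: "periodic1 f" using W[of 1] by (simp add: Winf_def)
  then have perj: "periodic1 ((dd ^^ j) f)" for j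
    by (induction j) (auto intro: periodic1_dd)
  have ac: "abs_cont ((dd ^^ j) f)" for j
    using W[of "Suc j"] by (simp add: Winf_def)
  have cont: "continuous_on UNIV ((dd ^^ j) f)" for j
    by (rule abs_cont_continuous[OF ac])
  have "norm ((dd ^^ j) f \<rho>) \<le> B" if "j \<le> m" for j \<rho>
  proof (rule esssup_norm_bound[OF cont perj])
    have "esssup (lebesgue_on {0..1}) (\<lambda>\<rho>. ereal (norm ((dd ^^ j) f \<rho>))) \<le> Winf_norm m f"
      unfolding Winf_norm_def
      using sum_mono2[of "{..m}" "{j}" "\<lambda>j. esssup (lebesgue_on {0..1}) (\<lambda>\<rho>. ereal (norm ((dd ^^ j) f \<rho>)))"] that
      by (simp add: esssup_norm_nonneg)
    then show "esssup (lebesgue_on {0..1}) (\<lambda>\<rho>. ereal (norm ((dd ^^ j) f \<rho>))) \<le> ereal B"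
      using B by (rule order_trans)
  qed
  moreover have "((dd ^^ j) f has_vector_derivative (dd ^^ Suc j) f \<rho>) (at \<rho>)" for j \<rho>
    using abs_cont_has_derivative[OF ac, of j \<rho>] cont[of "Suc j"] by simp
  ultimately show ?thesis using per by (simp add: bounded_smooth_def)
qed

context
  fixes m :: nat and B :: real and f :: "real \<Rightarrow> plane"
  assumes smooth: "bounded_smooth m B f"
begin

lemma bounded_smooth_periodic: "periodic1 f"
  and bounded_smooth_deriv: "((dd ^^ j) f has_vector_derivative (dd ^^ Suc j) f \<rho>) (at \<rho>)"
  and bounded_smooth_bound: "j \<le> m \<Longrightarrow> norm ((dd ^^ j) f \<rho>) \<le> B"
  using smooth by (auto simp: bounded_smooth_def)

lemma bounded_smooth_continuous: "continuous_on S ((dd ^^ j) f)"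
  using bounded_smooth_deriv
  by (intro continuous_at_imp_continuous_on) (auto intro: has_vector_derivative_continuous)

lemma bounded_smooth_Lipschitz:
  assumes "j < m" shows "norm ((dd ^^ j) f a - (dd ^^ j) f b) \<le> B * \<bar>a - b\<bar>"
proof -
  have "norm ((dd ^^ j) f a - (dd ^^ j) f b) \<le> B * norm (a - b)"
  proof (rule differentiable_bound[where S = UNIV and f' = "\<lambda>\<rho> h. h *\<^sub>R (dd ^^ Suc j) f \<rho>"])
    show "onorm (\<lambda>h. h *\<^sub>R (dd ^^ Suc j) f \<rho>) \<le> B" for \<rho>
      using bounded_smooth_bound[of "Suc j" \<rho>] assms
      by (intro onorm_bound order_trans[OF norm_ge_zero])
         (auto simp: mult.commute[of B] intro!: mult_left_mono)
  qed (use bounded_smooth_deriv in \<open>auto simp: has_vector_derivative_def\<close>)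
  then show ?thesis by simp
qed

end

lemma bounded_smooth_mono: "bounded_smooth m B f \<Longrightarrow> m' \<le> m \<Longrightarrow> B \<le> B' \<Longrightarrow> bounded_smooth m' B' f"
  unfolding bounded_smooth_def by (meson order_trans)

text \<open>Serves to bound X = x + \<tau> v, uniformly in \<tau> \<le> 1, by the bounds on x and
  v.\<close>

lemma bounded_smooth_add_scale:
  assumes f: "bounded_smooth m A f" and g: "bounded_smooth m B g"
  shows "bounded_smooth m (A + \<bar>c\<bar> * B) (\<lambda>\<rho>. f \<rho> + c *\<^sub>R g \<rho>)"
proof -
  have D: "((\<lambda>\<rho>. (dd ^^ j) f \<rho> + c *\<^sub>R (dd ^^ j) g \<rho>) has_vector_derivative
      (dd ^^ Suc j) f \<rho> + c *\<^sub>R (dd ^^ Suc j) g \<rho>) (at \<rho>)" for j \<rho>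
    using bounded_smooth_deriv[OF f, of j \<rho>] bounded_smooth_deriv[OF g, of j \<rho>]
    by (auto intro!: derivative_eq_intros)
  have eq: "(dd ^^ j) (\<lambda>\<rho>. f \<rho> + c *\<^sub>R g \<rho>) = (\<lambda>\<rho>. (dd ^^ j) f \<rho> + c *\<^sub>R (dd ^^ j) g \<rho>)" for j
  proof (induction j)
    case (Suc j)
    then show ?case
      using vector_derivative_at[OF D[of j]] unfolding funpow.simps o_apply Suc
      by (auto simp: dd_def[of "\<lambda>\<rho>. (dd ^^ j) f \<rho> + c *\<^sub>R (dd ^^ j) g \<rho>"])
  qed simp
  have "norm ((dd ^^ j) f \<rho> + c *\<^sub>R (dd ^^ j) g \<rho>) \<le> A + \<bar>c\<bar> * B" if "j \<le> m" for j \<rho>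
    using bounded_smooth_bound[OF f that, of \<rho>] bounded_smooth_bound[OF g that, of \<rho>]
    by (intro norm_triangle_le add_mono) (auto intro!: mult_left_mono)
  moreover have "periodic1 (\<lambda>\<rho>. f \<rho> + c *\<^sub>R g \<rho>)"
    using bounded_smooth_periodic[OF f] bounded_smooth_periodic[OF g] by (simp add: periodic1_def)
  ultimately show ?thesis
    using D by (simp add: bounded_smooth_def eq del: funpow.simps)
qed

section \<open>Integrals over one period\<close>

lemma has_integral_translate:
  fixes g :: "real \<Rightarrow> 'a::real_normed_vector"
  assumes "(g has_integral I) {a..b}"
  shows "((\<lambda>x. g (x + c)) has_integral I) {a - c..b - c}"
  using has_integral_affinity[of g I a b 1 c] assms by (simp add: image_add_atLeastAtMost[of "- c", simplified])

text \<open>A mesh may start anywhere, whereas integrals over the circle are taken over [0,1]. After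
  an integer shift the interval starts at some b in [0,1); the piece beyond 1 is then moved back by
  one period.\<close>

lemma has_integral_period:
  fixes g :: "real \<Rightarrow> 'a::banach"
  assumes per: "periodic1 g" and I: "(g has_integral I) {a..a + 1}"
  shows "(g has_integral I) {0..1}"
proof -
  define b where "b = frac a"
  have b: "0 \<le> b" "b < 1" "b = a - of_int \<lfloor>a\<rfloor>" by (simp_all add: b_def frac_lt_1) (simp add: frac_def)
  have "(g has_integral I) {b..b + 1}"
    using has_integral_translate[OF I, of "of_int \<lfloor>a\<rfloor>"] unfolding b(3)
    by (simp add: periodic1_int[OF per] algebra_simps)
  then have int: "g integrable_on {b..b + 1}" "integral {b..b + 1} g = I" by auto
  have 1: "g integrable_on {b..1}" "g integrable_on {1..b + 1}"
    using integrable_subinterval_real[OF int(1)] b by auto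
  have "((\<lambda>x. g (x + 1)) has_integral integral {1..b + 1} g) {1 - 1..b + 1 - 1}"
    using 1 by (intro has_integral_translate) auto
  then have "(g has_integral integral {1..b + 1} g) {0..b}"
    using per by (simp add: periodic1_def)
  then have "(g has_integral (integral {1..b + 1} g + integral {b..1} g)) {0..1}"
    using b 1 by (intro has_integral_combine[of 0 b 1]) auto
  moreover have "integral {b..1} g + integral {1..b + 1} g = I"
    using Henstock_Kurzweil_Integration.integral_combine[OF _ _ int(1), of 1] int b by auto
  ultimately show ?thesis by (simp add: add.commute)
qed

lemma has_integral_rescale:
  fixes g :: "real \<Rightarrow> 'a::real_normed_vector"
  assumes "L > 0" "((\<lambda>s. g (a + L * s)) has_integral I) {0..1}"
  shows "(g has_integral L *\<^sub>R I) {a..a + L}"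
proof -
  have "((\<lambda>x. g (a + L * ((1 / L) *\<^sub>R x + (- a / L)))) has_integral (1 / \<bar>1 / L\<bar> ^ DIM(real)) *\<^sub>R I)
      ((\<lambda>x. (1 / (1 / L)) *\<^sub>R x + - ((1 / (1 / L)) *\<^sub>R (- a / L))) ` cbox 0 1)"
    using assms by (intro has_integral_affinity) auto
  moreover have "(\<lambda>x. L * x + a) ` {0..1} = {a..a + L}"
    using assms image_affinity_atLeastAtMost[of L a 0 1] by (simp add: add.commute)
  ultimately show ?thesis using assms by (simp add: field_simps)
qed

lemma has_integral_mesh:
  fixes g :: "real \<Rightarrow> 'a::banach"
  assumes P: "is_mesh P" and per: "periodic1 g"
    and I: "\<And>j. j < cells P \<Longrightarrow> ((\<lambda>s. g (pt P j + len P j * s)) has_integral I j) {0..1}"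
  shows "(g has_integral (\<Sum>j<cells P. len P j *\<^sub>R I j)) {0..1}"
proof -
  have "(g has_integral (\<Sum>j<n. len P j *\<^sub>R I j)) {pt P 0..pt P n} \<and> pt P 0 \<le> pt P n" if "n \<le> cells P" for n
    using that
  proof (induction n)
    case (Suc n)
    then have lt: "pt P n < pt P (Suc n)" using P by (auto simp: is_mesh_def)
    have "(g has_integral len P n *\<^sub>R I n) {pt P n..pt P n + len P n}"
      using Suc.prems I[of n] lt by (intro has_integral_rescale) (auto simp: len_def)
    then have "(g has_integral len P n *\<^sub>R I n) {pt P n..pt P (Suc n)}" by (simp add: len_def)
    then show ?case
      using Suc lt has_integral_combine[of "pt P 0" "pt P n" "pt P (Suc n)" g] by auto
  qed auto
  from this[of "cells P"] show ?thesis
    using P per by (intro has_integral_period[where a = "pt P 0"]) (auto simp: is_mesh_def)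
qed

section \<open>The finite element space\<close>

lemma has_vector_derivative_vec_poly:
  fixes p :: "'n::finite \<Rightarrow> real poly"
  shows "((\<lambda>s. \<chi> i. poly (p i) s) has_vector_derivative (\<chi> i. poly (pderiv (p i)) s)) (at s within S)"
  unfolding has_vector_derivative_def
proof (subst has_derivative_componentwise_within, intro ballI)
  fix b :: "real ^ 'n" assume "b \<in> Basis"
  then obtain i where b: "b = axis i 1" by (auto simp: Basis_vec_def)
  have "(poly (p i) has_real_derivative poly (pderiv (p i)) s) (at s within S)"
    by (rule DERIV_subset[OF poly_DERIV]) simp
  then show "((\<lambda>s. (\<chi> i. poly (p i) s) \<bullet> b) has_derivative (\<lambda>h. h *\<^sub>R (\<chi> i. poly (pderiv (p i)) s) \<bullet> b)) (at s within S)"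
    by (simp add: b inner_axis has_field_derivative_def mult_commute_abs)
qed

locale fem = lobatto_rule +
  fixes P :: mesh
  assumes mesh: "is_mesh P"
begin

definition loc :: "nat \<Rightarrow> real \<Rightarrow> real" where
  "loc j s = pt P j + len P j * s"

lemma cells_pos: "0 < cells P" and pt_less: "j < cells P \<Longrightarrow> pt P j < pt P (Suc j)"
  and pt_cells: "pt P (cells P) = pt P 0 + 1"
  using mesh by (auto simp: is_mesh_def)

lemma len_pos: "j < cells P \<Longrightarrow> 0 < len P j"
  using pt_less by (simp add: len_def)

lemma pt_mono: "i \<le> j \<Longrightarrow> j \<le> cells P \<Longrightarrow> pt P i \<le> pt P j"
proof (induction j)
  case (Suc j)
  then show ?case using pt_less[of j] by (cases "i = Suc j") auto
qed simp

lemma sum_len: "(\<Sum>j<cells P. len P j) = 1"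
  using sum_lessThan_telescope[of "pt P" "cells P"] by (simp add: len_def pt_cells)

lemma len_le: "j < cells P \<Longrightarrow> len P j \<le> mesh_size P"
  unfolding mesh_size_def by (intro Max_ge) auto

lemma mesh_size_pos: "0 < mesh_size P"
  using len_le[of 0] len_pos[of 0] cells_pos by simp

lemma loc_0: "loc j 0 = pt P j" and loc_1: "loc j 1 = pt P (Suc j)"
  by (simp_all add: loc_def len_def)

lemma lnode_loc: "lnode \<xi> P j l = loc j (\<xi> l)"
  by (simp add: lnode_def loc_def)

lemma elem_loc: assumes "j < cells P" shows "elem P j = loc j ` {0..1}"
proof -
  have "loc j ` {0..1} = {pt P j..pt P j + len P j}"
    using image_affinity_atLeastAtMost[of "len P j" "pt P j" 0 1] len_pos[OF assms]
    by (simp add: loc_def[abs_def] add.commute)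
  then show ?thesis by (simp add: elem_def len_def)
qed

lemma loc_bounds:
  assumes "j < cells P" "0 \<le> s" "s \<le> 1"
  shows "pt P j \<le> loc j s" "loc j s \<le> pt P (Suc j)" "pt P 0 \<le> loc j s" "loc j s \<le> pt P 0 + 1"
proof -
  have "loc j s \<in> elem P j" using assms by (simp add: elem_loc)
  then show "pt P j \<le> loc j s" "loc j s \<le> pt P (Suc j)" by (auto simp: elem_def)
  then show "pt P 0 \<le> loc j s" "loc j s \<le> pt P 0 + 1"
    using pt_mono[of 0 j] pt_mono[of "Suc j" "cells P"] assms pt_cells by auto
qed

lemma loc_less: "j < cells P \<Longrightarrow> s < 1 \<Longrightarrow> loc j s < pt P (Suc j)"
  using mult_strict_left_mono[of s 1 "len P j"] len_pos[of j] unfolding loc_1[symmetric] by (simp add: loc_def)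

text \<open>With the half-open range, s = 0 is the only parameter of a break point, so derivative
  arguments have just this one value to treat separately.\<close>

lemma loc_cover:
  obtains j s n where "j < cells P" "0 \<le> s" "s < 1" "\<rho> = loc j s + of_int n"
proof -
  define r where "r = pt P 0 + frac (\<rho> - pt P 0)"
  have r: "pt P 0 \<le> r" "r < pt P (cells P)" by (auto simp: r_def pt_cells frac_lt_1)
  have "\<exists>j<n. pt P j \<le> r \<and> r < pt P (Suc j)" if "r < pt P n" for n
    using that
  proof (induction n)
    case (Suc n)
    then show ?case by (cases "r < pt P n") (auto intro: less_SucI)
  qed (use r in simp)
  then obtain j where j: "j < cells P" "pt P j \<le> r" "r < pt P (Suc j)" using r by blast
  define s where "s = (r - pt P j) / len P j"
  have s: "r = loc j s" "0 \<le> s" "s < 1"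
    using j len_pos[OF j(1)] by (auto simp: s_def loc_def field_simps) (simp add: len_def)
  have "\<rho> = r + of_int \<lfloor>\<rho> - pt P 0\<rfloor>" by (simp add: r_def frac_def)
  then show ?thesis using that j(1) s by metis
qed

text \<open>For u in \<open>Vh2\<close> these are the components of u on element j in the coordinate
  s. For any other function they are those of its nodal interpolant, so interpolation leaves
  \<open>cpoly\<close> unchanged.\<close>

definition cpoly :: "(real \<Rightarrow> plane) \<Rightarrow> nat \<Rightarrow> 2 \<Rightarrow> real poly" where
  "cpoly u j i = ref_interp (\<lambda>s. u (loc j s) $ i)"

text \<open>The derivative with respect to \<rho>, hence the factor 1 / \<open>len P j\<close>.
  Unlike \<open>dd\<close>, it is meaningful up to the end points of the element, where it is the
  one-sided derivative.\<close>

definition cderiv :: "(real \<Rightarrow> plane) \<Rightarrow> nat \<Rightarrow> real \<Rightarrow> plane" where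
  "cderiv u j s = (1 / len P j) *\<^sub>R (\<chi> i. poly (pderiv (cpoly u j i)) s)"

lemma degree_cpoly: "degree (cpoly u j i) \<le> k"
  by (simp add: cpoly_def degree_ref_interp)

lemma Vh2_continuous: "u \<in> Vh2 k P \<Longrightarrow> continuous_on S u"
  unfolding Vh2_def Vh_def
  by (rule continuous_on_subset[of UNIV]) (auto intro: continuous_on_vec_lambda[of _ "\<lambda>i x. u x $ i", simplified])

lemma Vh2_periodic: "u \<in> Vh2 k P \<Longrightarrow> periodic1 u"
  by (auto simp: Vh2_def Vh_def periodic1_def vec_eq_iff)

lemma Vh2_cpoly:
  assumes "u \<in> Vh2 k P" "j < cells P" "0 \<le> s" "s \<le> 1"
  shows "u (loc j s) $ i = poly (cpoly u j i) s"
proof -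
  obtain q :: "real poly" where q: "degree q \<le> k" "\<And>\<rho>. \<rho> \<in> elem P j \<Longrightarrow> u \<rho> $ i = poly q \<rho>"
    using assms(1,2) by (auto simp: Vh2_def Vh_def) metis
  define p where "p = pcompose q [:pt P j, len P j:]"
  have "degree p \<le> k"
    using q(1) len_pos[OF assms(2)] by (simp add: p_def degree_pcompose)
  moreover have p: "u (loc j s) $ i = poly p s" if "0 \<le> s" "s \<le> 1" for s
  proof -
    have "loc j s \<in> elem P j" using that assms(2) by (simp add: elem_loc)
    from q(2)[OF this] show ?thesis by (simp add: p_def poly_pcompose loc_def mult.commute)
  qed
  moreover have "cpoly u j i = ref_interp (poly p)"
    unfolding cpoly_def ref_interp_def using p xi_bounds by (intro sum.cong refl) auto
  ultimately show ?thesis using assms by (simp add: ref_interp_poly)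
qed

lemma Vh2_deriv_within:
  assumes u: "u \<in> Vh2 k P" and j: "j < cells P" and s: "0 \<le> s" "s \<le> 1"
  shows "(u has_vector_derivative cderiv u j s) (at (loc j s) within elem P j)"
proof -
  define U where "U = (\<lambda>t. \<chi> i. poly (cpoly u j i) t)"
  have L: "len P j > 0" by (rule len_pos[OF j])
  have inv: "(loc j s - pt P j) / len P j = s" for s using L by (simp add: loc_def)
  have "((\<lambda>\<rho>. (\<rho> - pt P j) / len P j) has_vector_derivative 1 / len P j) (at (loc j s) within elem P j)"
    using L by (auto simp: has_real_derivative_iff_has_vector_derivative[symmetric] intro!: derivative_eq_intros)
  moreover have "(U has_vector_derivative (\<chi> i. poly (pderiv (cpoly u j i)) s))
      (at ((loc j s - pt P j) / len P j) within (\<lambda>\<rho>. (\<rho> - pt P j) / len P j) ` elem P j)"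
    unfolding inv U_def by (rule has_vector_derivative_vec_poly)
  ultimately have D: "((U \<circ> (\<lambda>\<rho>. (\<rho> - pt P j) / len P j)) has_vector_derivative cderiv u j s) (at (loc j s) within elem P j)"
    unfolding cderiv_def by (rule vector_diff_chain_within)
  show ?thesis
  proof (rule has_vector_derivative_transform[OF _ _ D])
    fix x assume "x \<in> elem P j"
    then obtain t where "x = loc j t" "0 \<le> t" "t \<le> 1" using elem_loc[OF j] by auto
    then show "u x = (U \<circ> (\<lambda>\<rho>. (\<rho> - pt P j) / len P j)) x"
      using Vh2_cpoly[OF u j] by (simp add: inv U_def vec_eq_iff)
  qed (use s elem_loc[OF j] in auto)
qed

lemma Vh2_deriv:
  assumes u: "u \<in> Vh2 k P" and j: "j < cells P" and s: "0 < s" "s < 1"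
  shows "(u has_vector_derivative cderiv u j s) (at (loc j s))"
proof -
  have "pt P j < loc j s" using mult_pos_pos[OF len_pos[OF j] s(1)] by (simp add: loc_def)
  moreover have "loc j s < pt P (Suc j)" using loc_less[OF j s(2)] .
  ultimately have "at (loc j s) within elem P j = at (loc j s)"
    unfolding elem_def by (rule at_within_Icc_at)
  then show ?thesis using Vh2_deriv_within[OF u j, of s] s by simp
qed

lemma Vh2_dd: "u \<in> Vh2 k P \<Longrightarrow> j < cells P \<Longrightarrow> 0 < s \<Longrightarrow> s < 1 \<Longrightarrow> dd u (loc j s) = cderiv u j s"
  unfolding dd_def by (intro vector_derivative_at Vh2_deriv)

lemma elem_deriv_eq:
  assumes "u \<in> Vh2 k P" "j < cells P" "l \<le> k"
  shows "elem_deriv \<xi> P u j l = cderiv u j (\<xi> l)"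
proof -
  have "loc j (\<xi> l) \<in> {pt P j..pt P (Suc j)}"
    using loc_bounds[OF assms(2)] xi_bounds[OF assms(3)] by auto
  then show ?thesis
    using Vh2_deriv_within[OF assms(1,2), of "\<xi> l"] xi_bounds[OF assms(3)] pt_less[OF assms(2)]
    unfolding elem_deriv_def lnode_loc elem_def by (intro vector_derivative_within_closed_interval) auto
qed

lemma cderiv_continuous: "continuous_on S (cderiv u j)"
  unfolding cderiv_def by (intro continuous_intros)

text \<open>The fundamental theorem of calculus on one element. The right-hand side is the variation
  of u there, which is summable over the elements; this is the price of freezing a test function on
  an element.\<close>

lemma Vh2_cell_increment:
  assumes u: "u \<in> Vh2 k P" and j: "j < cells P" and s: "0 \<le> s" "s \<le> 1"
  shows "norm (u (loc j s) - u (pt P j)) \<le> len P j * integral {0..1} (\<lambda>t. norm (cderiv u j t))"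
proof -
  define U where "U = (\<lambda>t. \<chi> i. poly (cpoly u j i) t)"
  have U: "u (loc j t) = U t" if "0 \<le> t" "t \<le> 1" for t
    using Vh2_cpoly[OF u j] that by (simp add: U_def vec_eq_iff)
  have int: "(\<lambda>t. norm (cderiv u j t)) integrable_on {a..b}" "cderiv u j integrable_on {a..b}" for a b
    by (intro integrable_continuous_real continuous_intros cderiv_continuous)+
  have "(\<chi> i. poly (pderiv (cpoly u j i)) t) = len P j *\<^sub>R cderiv u j t" for t
    using len_pos[OF j] by (simp add: cderiv_def)
  then have "(U has_vector_derivative len P j *\<^sub>R cderiv u j t) (at t within {0..s})" for t
    using has_vector_derivative_vec_poly[of "cpoly u j" t "{0..s}"] by (simp add: U_def)
  then have "((\<lambda>t. len P j *\<^sub>R cderiv u j t) has_integral (U s - U 0)) {0..s}"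
    using s by (intro fundamental_theorem_of_calculus) auto
  then have "U s - U 0 = len P j *\<^sub>R integral {0..s} (cderiv u j)"
    by (metis integral_cmul integral_unique)
  then have "norm (U s - U 0) = len P j * norm (integral {0..s} (cderiv u j))"
    using len_pos[OF j] by simp
  also have "\<dots> \<le> len P j * integral {0..s} (\<lambda>t. norm (cderiv u j t))"
    using len_pos[OF j] by (intro mult_left_mono integral_norm_bound_integral int) auto
  also have "\<dots> \<le> len P j * integral {0..1} (\<lambda>t. norm (cderiv u j t))"
    using len_pos[OF j] s by (intro mult_left_mono integral_subset_le int) auto
  finally show ?thesis using U[of s] U[of 0] s by (simp add: loc_0)
qed

lemma Vh2_add: "u \<in> Vh2 k P \<Longrightarrow> v \<in> Vh2 k P \<Longrightarrow> (\<lambda>\<rho>. u \<rho> + v \<rho>) \<in> Vh2 k P"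
proof -
  have "(\<lambda>\<rho>. f \<rho> + g \<rho>) \<in> Vh k P" if f: "f \<in> Vh k P" and g: "g \<in> Vh k P" for f g
  proof -
    have "\<exists>q :: real poly. degree q \<le> k \<and> (\<forall>\<rho>\<in>elem P j. f \<rho> + g \<rho> = poly q \<rho>)" if "j < cells P" for j
    proof -
      obtain p q where "degree p \<le> k" "\<forall>\<rho>\<in>elem P j. f \<rho> = poly p \<rho>" "degree q \<le> k" "\<forall>\<rho>\<in>elem P j. g \<rho> = poly q \<rho>"
        using f g \<open>j < cells P\<close> unfolding Vh_def by blast
      then show ?thesis by (intro exI[of _ "p + q"]) (auto intro: degree_add_le)
    qed
    then show ?thesis using f g by (auto simp: Vh_def periodic1_def intro!: continuous_intros)
  qed
  then show "u \<in> Vh2 k P \<Longrightarrow> v \<in> Vh2 k P \<Longrightarrow> ?thesis" by (simp add: Vh2_def)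
qed

lemma Vh2_scale: "u \<in> Vh2 k P \<Longrightarrow> (\<lambda>\<rho>. c *\<^sub>R u \<rho>) \<in> Vh2 k P"
proof -
  have "(\<lambda>\<rho>. c * f \<rho>) \<in> Vh k P" if f: "f \<in> Vh k P" for f
  proof -
    have "\<exists>q :: real poly. degree q \<le> k \<and> (\<forall>\<rho>\<in>elem P j. c * f \<rho> = poly q \<rho>)" if "j < cells P" for j
    proof -
      obtain p where "degree p \<le> k" "\<forall>\<rho>\<in>elem P j. f \<rho> = poly p \<rho>"
        using f \<open>j < cells P\<close> unfolding Vh_def by blast
      then show ?thesis by (intro exI[of _ "smult c p"]) (auto intro: order_trans[OF degree_smult_le])
    qed
    then show ?thesis using f by (auto simp: Vh_def periodic1_def intro!: continuous_intros)
  qed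
  then show "u \<in> Vh2 k P \<Longrightarrow> ?thesis" by (simp add: Vh2_def)
qed

lemma Vh2_diff: "u \<in> Vh2 k P \<Longrightarrow> v \<in> Vh2 k P \<Longrightarrow> (\<lambda>\<rho>. u \<rho> - v \<rho>) \<in> Vh2 k P"
  using Vh2_add[of u "\<lambda>\<rho>. (- 1) *\<^sub>R v \<rho>"] Vh2_scale[of v "- 1"] by simp

lemma cderiv_add: "cderiv (\<lambda>\<rho>. u \<rho> + v \<rho>) j s = cderiv u j s + cderiv v j s"
  by (simp add: cderiv_def cpoly_def ref_interp_def pderiv_sum pderiv_smult poly_sum vec_eq_iff
      sum.distrib add_divide_distrib distrib_right)

lemma cderiv_scale: "cderiv (\<lambda>\<rho>. c *\<^sub>R u \<rho>) j s = c *\<^sub>R cderiv u j s"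
  by (simp add: cderiv_def cpoly_def ref_interp_def pderiv_sum pderiv_smult poly_sum vec_eq_iff
      sum_distrib_left mult.assoc)

subsection \<open>Nodes\<close>

lemma finite_nodes: "finite (nodes k \<xi> P)"
proof (rule finite_subset)
  show "nodes k \<xi> P \<subseteq> (\<lambda>(j, l). lnode \<xi> P j l) ` ({..<cells P} \<times> {..k})"
    by (auto simp: nodes_def)
qed simp

text \<open>The only local nodes outside the half-open period are those at \<open>pt P 0\<close> +
  1, and \<open>pt P 0\<close> represents them.\<close>

lemma lnode_representative:
  assumes "j < cells P" "l \<le> k"
  obtains \<rho> where "\<rho> \<in> nodes k \<xi> P" "lnode \<xi> P j l - \<rho> \<in> \<int>"
proof (cases "lnode \<xi> P j l < pt P (cells P)")
  case True
  then have "lnode \<xi> P j l \<in> nodes k \<xi> P"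
    using assms loc_bounds[OF assms(1)] xi_bounds[OF assms(2)] by (auto simp: nodes_def lnode_loc)
  then show ?thesis using that[of "lnode \<xi> P j l"] by simp
next
  case False
  then have "lnode \<xi> P j l = pt P 0 + 1"
    using loc_bounds[OF assms(1)] xi_bounds[OF assms(2)] by (auto simp: lnode_loc pt_cells intro: antisym)
  moreover have "pt P 0 \<in> nodes k \<xi> P"
    using cells_pos by (auto simp: nodes_def lnode_loc xi_0 loc_0 pt_cells intro!: exI[of _ 0])
  ultimately show ?thesis using that[of "pt P 0"] by simp
qed

lemma nodes_inject:
  assumes "\<rho> \<in> nodes k \<xi> P" "\<rho>' \<in> nodes k \<xi> P" "\<rho> - \<rho>' \<in> \<int>"
  shows "\<rho> = \<rho>'"
proof -
  obtain n :: int where n: "\<rho> - \<rho>' = of_int n" using assms(3) by (auto elim: Ints_cases)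
  moreover have "\<bar>\<rho> - \<rho>'\<bar> < 1" using assms(1,2) by (auto simp: nodes_def pt_cells)
  ultimately have "n = 0" by simp
  then show ?thesis using n by simp
qed

text \<open>The incident sets partition the pairs of element and local index. This turns sums over
  global nodes into element-wise quadrature sums.\<close>

lemma sum_nodes_incident:
  fixes F :: "nat \<Rightarrow> nat \<Rightarrow> 'a::comm_monoid_add"
  shows "(\<Sum>\<rho>\<in>nodes k \<xi> P. \<Sum>(j, l)\<in>incident k \<xi> P \<rho>. F j l) = (\<Sum>j<cells P. \<Sum>l\<le>k. F j l)"
proof -
  have fin: "finite (incident k \<xi> P \<rho>)" for \<rho>
    by (rule finite_subset[of _ "{..<cells P} \<times> {..k}"]) (auto simp: incident_def)
  have dis: "incident k \<xi> P \<rho> \<inter> incident k \<xi> P \<rho>' = {}"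
    if "\<rho> \<in> nodes k \<xi> P" "\<rho>' \<in> nodes k \<xi> P" "\<rho> \<noteq> \<rho>'" for \<rho> \<rho>'
  proof -
    have "\<rho> - \<rho>' \<in> \<int>" if "x - \<rho> \<in> \<int>" "x - \<rho>' \<in> \<int>" for x
      using Ints_diff[OF that(2,1)] by simp
    then show ?thesis using nodes_inject that by (auto simp: incident_def)
  qed
  have un: "(\<Union>\<rho>\<in>nodes k \<xi> P. incident k \<xi> P \<rho>) = {..<cells P} \<times> {..k}"
    by (auto simp: incident_def intro: lnode_representative)
  have "(\<Sum>\<rho>\<in>nodes k \<xi> P. \<Sum>(j, l)\<in>incident k \<xi> P \<rho>. F j l) = (\<Sum>(j, l)\<in>{..<cells P} \<times> {..k}. F j l)"
    unfolding un[symmetric] using finite_nodes fin dis by (subst sum.UNION_disjoint) auto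
  then show ?thesis by (simp add: sum.cartesian_product)
qed

lemma incident_value:
  "periodic1 f \<Longrightarrow> (j, l) \<in> incident k \<xi> P \<rho> \<Longrightarrow> f (loc j (\<xi> l)) = f \<rho>"
  by (auto simp: incident_def lnode_loc intro: periodic1_Ints)

lemma incident_nonempty: "\<rho> \<in> nodes k \<xi> P \<Longrightarrow> incident k \<xi> P \<rho> \<noteq> {}"
  by (auto simp: nodes_def incident_def) force

lemma nodal_values:
  assumes "periodic1 u" "periodic1 v" "\<And>\<rho>. \<rho> \<in> nodes k \<xi> P \<Longrightarrow> u \<rho> = v \<rho>" "j < cells P" "l \<le> k"
  shows "u (loc j (\<xi> l)) = v (loc j (\<xi> l))"
  using lnode_representative[OF assms(4,5)] assms(1-3) by (metis lnode_loc periodic1_Ints)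

lemma Vh2_nodal_unique:
  assumes u: "u \<in> Vh2 k P" and v: "v \<in> Vh2 k P" and eq: "\<And>\<rho>. \<rho> \<in> nodes k \<xi> P \<Longrightarrow> u \<rho> = v \<rho>"
  shows "u = v"
proof
  fix \<rho>
  obtain j s n where j: "j < cells P" "0 \<le> s" "s < 1" "\<rho> = loc j s + of_int n" by (rule loc_cover)
  have "cpoly u j i = cpoly v j i" for i
    using nodal_values[OF Vh2_periodic[OF u] Vh2_periodic[OF v] eq j(1)]
    by (simp add: cpoly_def ref_interp_def)
  then have "u (loc j s) = v (loc j s)"
    using Vh2_cpoly[OF u j(1)] Vh2_cpoly[OF v j(1)] j by (simp add: vec_eq_iff)
  then show "u \<rho> = v \<rho>"
    using Vh2_periodic[OF u] Vh2_periodic[OF v] j(4) by (simp add: periodic1_int)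
qed

subsection \<open>Nodal interpolation\<close>

text \<open>The interpolant is glued from the increments of the element polynomials, with the arguments clipped to the
  elements, which makes it continuous; it is then periodized.\<close>

lemma interp_exists:
  assumes per: "periodic1 f"
  shows "\<exists>u\<in>Vh2 k P. \<forall>\<rho>\<in>nodes k \<xi> P. u \<rho> = f \<rho>"
proof -
  define Q where "Q = (\<lambda>j s. \<chi> i. poly (cpoly f j i) s)"
  define clip where "clip = (\<lambda>j r. max 0 (min 1 ((r - pt P j) / len P j)))"
  define g where "g = (\<lambda>r. f (pt P 0) + (\<Sum>j<cells P. Q j (clip j r) - f (pt P j)))"
  define u where "u = (\<lambda>r. g (pt P 0 + frac (r - pt P 0)))"
  have Q: "Q j (\<xi> l) = f (loc j (\<xi> l))" if "l \<le> k" for j l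
    using that by (simp add: Q_def cpoly_def ref_interp_node vec_eq_iff)
  have Q0: "Q j 0 = f (pt P j)" and Q1: "Q j 1 = f (pt P (Suc j))" for j
    using Q[of 0 j] Q[of k j] by (simp_all add: xi_0 xi_k loc_0 loc_1)
  have fper: "f (pt P (cells P)) = f (pt P 0)" using per by (simp add: pt_cells periodic1_def)
  have clip0: "clip j r = 0" if "j < cells P" "r \<le> pt P j" for j r
    using that len_pos[OF that(1)] by (simp add: clip_def max_def min_def field_simps)
  have clip1: "clip j r = 1" if "j < cells P" "pt P (Suc j) \<le> r" for j r
  proof -
    have "1 \<le> (r - pt P j) / len P j"
      using that len_pos[OF that(1)] by (simp add: le_divide_eq) (simp add: len_def)
    then show ?thesis by (simp add: clip_def)
  qed
  \<comment> \<open>Elements to the left of j contribute their full increments, which telescope to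
    \<open>f (pt P j) - f (pt P 0)\<close>; those to the right contribute 0.\<close>
  have g_loc: "g (loc j s) = Q j s" if j: "j < cells P" and s: "0 \<le> s" "s \<le> 1" for j s
  proof -
    have "(\<Sum>i<cells P. Q i (clip i (loc j s)) - f (pt P i))
        = (\<Sum>i<cells P. if i < j then f (pt P (Suc i)) - f (pt P i) else if i = j then Q j s - f (pt P j) else 0)"
    proof (intro sum.cong refl)
      fix i assume "i \<in> {..<cells P}"
      then have i: "i < cells P" by simp
      consider "i < j" | "i = j" | "j < i" by linarith
      then show "Q i (clip i (loc j s)) - f (pt P i)
          = (if i < j then f (pt P (Suc i)) - f (pt P i) else if i = j then Q j s - f (pt P j) else 0)"
      proof cases
        case 1
        then show ?thesis
          using clip1[OF i] loc_bounds(1)[OF j s] pt_mono[of "Suc i" j] j by (simp add: Q1)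
      next
        case 2
        then show ?thesis using s len_pos[OF j] by (simp add: clip_def loc_def)
      next
        case 3
        then show ?thesis
          using clip0[OF i] loc_bounds(2)[OF j s] pt_mono[of "Suc j" i] i by (simp add: Q0)
      qed
    qed
    also have "\<dots> = (\<Sum>i\<in>{..<j}. f (pt P (Suc i)) - f (pt P i)) + (\<Sum>i\<in>{j}. Q j s - f (pt P j))"
    proof (subst sum.mono_neutral_right[of "{..<cells P}" "insert j {..<j}"])
      show "insert j {..<j} \<subseteq> {..<cells P}" using j by auto
    qed auto
    finally show ?thesis
      using sum_lessThan_telescope[of "\<lambda>i. f (pt P i)" j] by (simp add: g_def)
  qed
  have g_left: "g r = f (pt P 0)" if "r \<le> pt P 0" for r
    unfolding g_def using clip0[OF _ order_trans[OF that pt_mono[of 0]]] Q0 by simp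
  have g_right: "g r = f (pt P 0)" if "pt P 0 + 1 \<le> r" for r
  proof -
    have "(\<Sum>j<cells P. Q j (clip j r) - f (pt P j)) = (\<Sum>j<cells P. f (pt P (Suc j)) - f (pt P j))"
      using clip1[OF _ order_trans[OF pt_mono[of _ "cells P"]]] that Q1 by (intro sum.cong) (auto simp: pt_cells)
    then show ?thesis
      using sum_lessThan_telescope[of "\<lambda>i. f (pt P i)" "cells P"] by (simp add: g_def fper)
  qed
  have "continuous_on UNIV (\<lambda>r. Q j (clip j r))" if "j < cells P" for j
    unfolding Q_def clip_def using len_pos[OF that] by (intro continuous_intros) auto
  then have cont_g: "continuous_on S (\<lambda>x. g (h x))" if "continuous_on S h" for S and h :: "real \<Rightarrow> real"
    unfolding g_def
    by (intro continuous_intros continuous_on_compose2[of UNIV "\<lambda>r. Q _ (clip _ r)" S h] that) auto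
  have cont: "continuous_on UNIV u"
  proof (rule continuous_at_imp_continuous_on, intro ballI)
    fix r0 :: real
    define n where "n = \<lfloor>r0 - pt P 0\<rfloor>"
    define V where "V = {pt P 0 + of_int n - 1<..<pt P 0 + of_int n + 1}"
    \<comment> \<open>On V the integer part jumps only at \<open>pt P 0\<close> + n. On either side
      of it, one of the two g terms is the periodized value and the other has its constant value
      \<open>f (pt P 0)\<close>, which is subtracted. This exhibits u near r0 as a sum of continuous
      functions.\<close>
    have eq: "u r = g (r - of_int n) + g (r - of_int n + 1) - f (pt P 0)" if "r \<in> V" for r
    proof (cases "pt P 0 + of_int n \<le> r")
      case True
      then have "\<lfloor>r - pt P 0\<rfloor> = n" using that by (simp add: V_def floor_eq_iff)
      then show ?thesis using g_right[of "r - of_int n + 1"] True by (simp add: u_def frac_def)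
    next
      case False
      then have "\<lfloor>r - pt P 0\<rfloor> = n - 1" using that by (simp add: V_def floor_eq_iff)
      then have "pt P 0 + frac (r - pt P 0) = r - of_int n + 1" by (simp add: frac_def)
      then show ?thesis using g_left[of "r - of_int n"] False by (simp add: u_def)
    qed
    have "continuous_on V (\<lambda>r. g (r - of_int n) + g (r - of_int n + 1) - f (pt P 0))"
      by (intro continuous_intros cont_g)
    then have "continuous_on V u" by (rule continuous_on_eq) (simp add: eq)
    moreover have "r0 \<in> V" using floor_correct[of "r0 - pt P 0"] by (simp add: V_def n_def algebra_simps)
    ultimately show "isCont u r0" by (simp add: V_def continuous_on_eq_continuous_at)
  qed
  have "u (r + 1) = u r" for r
    using frac_1_eq[of "r - pt P 0"] by (simp add: u_def algebra_simps)
  then have peru: "periodic1 u" by (simp add: periodic1_def)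
  have u_loc: "u (loc j s) = Q j s" if "j < cells P" "0 \<le> s" "s \<le> 1" for j s
  proof (cases "loc j s < pt P 0 + 1")
    case True
    then have "frac (loc j s - pt P 0) = loc j s - pt P 0"
      using loc_bounds(3)[OF that] by (simp add: frac_eq)
    then show ?thesis using g_loc[OF that] by (simp add: u_def)
  next
    case False
    then have "loc j s = pt P 0 + 1" using loc_bounds(4)[OF that] by simp
    then show ?thesis using g_loc[OF that] g_right[of "loc j s"] g_left[of "pt P 0"] by (simp add: u_def)
  qed
  have "(\<lambda>\<rho>. u \<rho> $ i) \<in> Vh k P" for i
  proof -
    have "\<exists>q :: real poly. degree q \<le> k \<and> (\<forall>\<rho>\<in>elem P j. u \<rho> $ i = poly q \<rho>)" if j: "j < cells P" for j
    proof (intro exI[of _ "pcompose (cpoly f j i) [:- pt P j / len P j, 1 / len P j:]"] conjI ballI)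
      show "degree (pcompose (cpoly f j i) [:- pt P j / len P j, 1 / len P j:]) \<le> k"
        using len_pos[OF j] by (simp add: degree_pcompose degree_cpoly)
      fix \<rho> assume "\<rho> \<in> elem P j"
      then obtain s where s: "\<rho> = loc j s" "0 \<le> s" "s \<le> 1" using elem_loc[OF j] by auto
      have "- pt P j / len P j + \<rho> * (1 / len P j) = s"
        using s(1) len_pos[OF j] by (simp add: loc_def field_simps)
      then show "u \<rho> $ i = poly (pcompose (cpoly f j i) [:- pt P j / len P j, 1 / len P j:]) \<rho>"
        using u_loc[OF j s(2,3)] s(1) by (simp add: poly_pcompose Q_def)
    qed
    then show ?thesis
      using peru cont by (auto simp: Vh_def periodic1_def intro!: continuous_intros)
  qed
  then have "u \<in> Vh2 k P" by (simp add: Vh2_def)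
  moreover have "u \<rho> = f \<rho>" if \<rho>: "\<rho> \<in> nodes k \<xi> P" for \<rho>
  proof -
    obtain j l where "j < cells P" "l \<le> k" "\<rho> = loc j (\<xi> l)"
      using \<rho> unfolding nodes_def lnode_loc by blast
    then show ?thesis using u_loc[of j "\<xi> l"] Q[of l j] xi_bounds[of l] by simp
  qed
  ultimately show ?thesis by blast
qed

lemma interp:
  assumes "periodic1 f"
  shows interp_Vh2: "interp k \<xi> P f \<in> Vh2 k P"
    and interp_node: "\<rho> \<in> nodes k \<xi> P \<Longrightarrow> interp k \<xi> P f \<rho> = f \<rho>"
    and cpoly_interp: "j < cells P \<Longrightarrow> cpoly (interp k \<xi> P f) j i = cpoly f j i"
proof -
  have "\<exists>!u. u \<in> Vh2 k P \<and> (\<forall>\<rho>\<in>nodes k \<xi> P. u \<rho> = f \<rho>)"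
    using interp_exists[OF assms] Vh2_nodal_unique by (metis (no_types, lifting))
  then have *: "interp k \<xi> P f \<in> Vh2 k P \<and> (\<forall>\<rho>\<in>nodes k \<xi> P. interp k \<xi> P f \<rho> = f \<rho>)"
    unfolding interp_def by (rule theI')
  then show "interp k \<xi> P f \<in> Vh2 k P" "\<rho> \<in> nodes k \<xi> P \<Longrightarrow> interp k \<xi> P f \<rho> = f \<rho>" by auto
  show "cpoly (interp k \<xi> P f) j i = cpoly f j i" if "j < cells P"
    using nodal_values[OF Vh2_periodic assms _ that, of "interp k \<xi> P f"] *
    by (simp add: cpoly_def ref_interp_def)
qed

subsection \<open>Integrals and norms of finite element functions\<close>

text \<open>Agreement on the open elements suffices, since end points are negligible. Hence g may be
  built from \<open>dd\<close>, whose values at break points are arbitrary.\<close>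

lemma has_integral_cells:
  fixes g :: "real \<Rightarrow> 'a::banach"
  assumes "periodic1 g" "\<And>j. j < cells P \<Longrightarrow> continuous_on {0..1} (\<Phi> j)"
    and "\<And>j s. j < cells P \<Longrightarrow> 0 < s \<Longrightarrow> s < 1 \<Longrightarrow> g (loc j s) = \<Phi> j s"
  shows "(g has_integral (\<Sum>j<cells P. len P j *\<^sub>R integral {0..1} (\<Phi> j))) {0..1}"
proof (rule has_integral_mesh[OF mesh assms(1)])
  fix j assume j: "j < cells P"
  have "(\<Phi> j has_integral integral {0..1} (\<Phi> j)) {0..1}"
    using assms(2)[OF j] by (intro integrable_integral integrable_continuous_real)
  then have "((\<lambda>s. g (loc j s)) has_integral integral {0..1} (\<Phi> j)) {0..1}"
    by (rule has_integral_spike_finite[of "{0, 1}", rotated 2]) (use assms(3)[OF j] in auto)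
  then show "((\<lambda>s. g (pt P j + len P j * s)) has_integral integral {0..1} (\<Phi> j)) {0..1}"
    by (simp add: loc_def)
qed

lemma Vh2_dd_bounded:
  assumes u: "u \<in> Vh2 k P"
  obtains B where "\<And>\<rho>. norm (dd u \<rho>) \<le> B"
proof -
  have "\<exists>B. \<forall>s\<in>{0..1}. norm (cderiv u j s) \<le> B" for j
    using compact_imp_bounded[OF compact_continuous_image[OF cderiv_continuous[of "{0..1}" u j] compact_Icc]]
    by (auto simp: bounded_iff)
  then obtain B where B: "\<And>j s. 0 \<le> s \<Longrightarrow> s \<le> 1 \<Longrightarrow> norm (cderiv u j s) \<le> B j"
    by (metis atLeastAtMost_iff)
  \<comment> \<open>The second summand covers whatever value \<open>dd\<close> happens to take at a
    break point.\<close>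
  define C where "C = (\<Sum>j<cells P. B j + norm (dd u (pt P j)))"
  have B0: "0 \<le> B j" for j using order_trans[OF norm_ge_zero B[of 0 j]] by simp
  have "norm (dd u \<rho>) \<le> C" for \<rho>
  proof -
    obtain j s n where j: "j < cells P" "0 \<le> s" "s < 1" "\<rho> = loc j s + of_int n" by (rule loc_cover)
    have "norm (dd u \<rho>) = norm (dd u (loc j s))"
      using periodic1_int[OF periodic1_dd[OF Vh2_periodic[OF u]]] j(4) by simp
    also have "\<dots> \<le> B j + norm (dd u (pt P j))"
      using Vh2_dd[OF u j(1), of s] B[of s j] j B0[of j] by (cases "s = 0") (auto simp: loc_0 add_increasing2)
    also have "\<dots> \<le> C"
      unfolding C_def using j(1) B0 by (intro member_le_sum) auto
    finally show ?thesis .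
  qed
  then show ?thesis using that by blast
qed

text \<open>Makes finite element functions admissible test functions in the weak form of the
  time-semidiscrete step.\<close>

lemma Vh2_H1:
  assumes u: "u \<in> Vh2 k P" shows "u \<in> H1"
proof -
  obtain B where B: "\<And>\<rho>. norm (dd u \<rho>) \<le> B" using Vh2_dd_bounded[OF u] by blast
  have "dd u absolutely_integrable_on {a..b} \<and> (dd u has_integral (u b - u a)) {a..b}" if "a \<le> b" for a b
  proof -
    \<comment> \<open>The break points of all periods that lie in [a,b]: finitely many exceptions
      for the fundamental theorem of calculus.\<close>
    define S where "S = (\<Union>j<cells P. (\<lambda>n. pt P j + of_int n) ` {n :: int. a \<le> pt P j + of_int n \<and> pt P j + of_int n \<le> b})"
    have "{n :: int. a \<le> pt P j + of_int n \<and> pt P j + of_int n \<le> b} \<subseteq> {\<lfloor>a - pt P j\<rfloor>..\<lceil>b - pt P j\<rceil>}" for j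
      by (auto simp: floor_le_iff le_ceiling_iff)
    then have "finite S" unfolding S_def by (intro finite_UN_I finite_imageI) (auto intro: finite_subset)
    have I: "(dd u has_integral (u b - u a)) {a..b}"
    proof (rule fundamental_theorem_of_calculus_interior_strong[OF \<open>finite S\<close> that])
      fix \<rho> assume \<rho>: "\<rho> \<in> {a<..<b} - S"
      obtain j s n where j: "j < cells P" "0 \<le> s" "s < 1" "\<rho> = loc j s + of_int n" by (rule loc_cover)
      have "s \<noteq> 0" using \<rho> j by (force simp: S_def loc_0)
      then have "(u has_vector_derivative cderiv u j s) (at (loc j s))"
        using Vh2_deriv[OF u j(1)] j by simp
      moreover have "(\<lambda>t. u (t + of_int n)) = u" by (simp add: periodic1_int[OF Vh2_periodic[OF u]])
      ultimately have "(u has_vector_derivative cderiv u j s) (at \<rho>)"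
        unfolding j(4) by (subst has_vector_derivative_translate) simp
      then show "(u has_vector_derivative dd u \<rho>) (at \<rho>)"
        by (simp add: dd_def vector_derivative_at)
    qed (rule Vh2_continuous[OF u])
    moreover have "dd u absolutely_integrable_on {a..b}"
      using B I by (intro absolutely_integrable_integrable_bound[where g = "\<lambda>_. B"]) auto
    ultimately show ?thesis by simp
  qed
  moreover have "((\<lambda>\<rho>. (norm (dd u \<rho>))\<^sup>2) has_integral
      (\<Sum>j<cells P. len P j *\<^sub>R integral {0..1} (\<lambda>s. (norm (cderiv u j s))\<^sup>2))) {0..1}"
    using periodic1_dd[OF Vh2_periodic[OF u]]
    by (intro has_integral_cells continuous_intros cderiv_continuous) (auto simp: Vh2_dd[OF u] periodic1_def)
  ultimately show ?thesis
    using Vh2_periodic[OF u] by (auto simp: H1_def abs_cont_def)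
qed

end

section \<open>One-dimensional Sobolev bounds and the variation over elements\<close>

lemma square_integral_le_integral_square:
  fixes f :: "real \<Rightarrow> real"
  assumes f: "f integrable_on {0..1}" and f2: "(\<lambda>\<rho>. (f \<rho>)\<^sup>2) integrable_on {0..1}"
  shows "(integral {0..1} f)\<^sup>2 \<le> integral {0..1} (\<lambda>\<rho>. (f \<rho>)\<^sup>2)"
proof -
  \<comment> \<open>The mean of f; the estimate says that the variance, the integral of (f - a)^2,
    is nonnegative.\<close>
  define a where "a = integral {0..1} f"
  have "((\<lambda>\<rho>. (f \<rho>)\<^sup>2 - 2 * a * f \<rho> + a\<^sup>2) has_integral
      (integral {0..1} (\<lambda>\<rho>. (f \<rho>)\<^sup>2) - 2 * a * integral {0..1} f + a\<^sup>2)) {0..1}"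
    using has_integral_const_real[of "a\<^sup>2" 0 1] integrable_integral[OF f] integrable_integral[OF f2]
    by (intro has_integral_add has_integral_diff has_integral_mult_right) auto
  then have "0 \<le> integral {0..1} (\<lambda>\<rho>. (f \<rho>)\<^sup>2) - 2 * a * integral {0..1} f + a\<^sup>2"
  proof (rule has_integral_nonneg)
    show "0 \<le> (f \<rho>)\<^sup>2 - 2 * a * f \<rho> + a\<^sup>2" for \<rho>
      using zero_le_power2[of "f \<rho> - a"] by (simp add: power2_diff mult.commute mult.left_commute)
  qed
  then show ?thesis by (simp add: a_def power2_eq_square)
qed

text \<open>The variation is bounded by Cauchy-Schwarz on the unit interval. For the sup norm, u t
  differs from every u s by at most the variation; averaging over s adds the mean of the norm of u.
  Each contributes one of the two copies of the H^1 norm.\<close>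

lemma H1_norm_bounds:
  assumes u: "u \<in> H1"
  shows H1_norm_variation: "integral {0..1} (\<lambda>\<rho>. norm (dd u \<rho>)) \<le> H1_norm u"
    and H1_norm_sup: "norm (u \<rho>) \<le> 2 * H1_norm u"
    and H1_norm_nonneg: "0 \<le> H1_norm u"
proof -
  have per: "periodic1 u" and ac: "abs_cont u" and d2: "(\<lambda>\<rho>. (norm (dd u \<rho>))\<^sup>2) integrable_on {0..1}"
    using u by (auto simp: H1_def)
  have cont: "continuous_on S u" for S
    using abs_cont_continuous[OF ac] by (rule continuous_on_subset) simp
  have ai: "dd u absolutely_integrable_on {a..b}" if "a \<le> b" for a b
    using ac that by (simp add: abs_cont_def)
  have d: "(\<lambda>\<rho>. norm (dd u \<rho>)) integrable_on {a..b}" "dd u integrable_on {a..b}" if "a \<le> b" for a b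
    using ai[OF that] by (auto simp: absolutely_integrable_on_def)
  have i: "(\<lambda>\<rho>. norm (u \<rho>)) integrable_on {0..1}" "(\<lambda>\<rho>. (norm (u \<rho>))\<^sup>2) integrable_on {0..1}"
    by (intro integrable_continuous_real continuous_intros cont)+
  have nn: "0 \<le> integral {0..1} (\<lambda>\<rho>. (norm (u \<rho>))\<^sup>2)" "0 \<le> integral {0..1} (\<lambda>\<rho>. (norm (dd u \<rho>))\<^sup>2)"
    using i d2 by (auto intro!: integral_nonneg)
  have H: "(H1_norm u)\<^sup>2 = integral {0..1} (\<lambda>\<rho>. (norm (u \<rho>))\<^sup>2) + integral {0..1} (\<lambda>\<rho>. (norm (dd u \<rho>))\<^sup>2)"
    and H0: "0 \<le> H1_norm u"
    unfolding H1_norm_def integral_add[OF i(2) d2] using nn by simp_all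
  have a: "integral {0..1} (\<lambda>\<rho>. norm (dd u \<rho>)) \<le> H1_norm u"
    using square_integral_le_integral_square[OF d(1)[OF zero_le_one] d2] nn H by (intro power2_le_imp_le[OF _ H0]) linarith
  have b: "integral {0..1} (\<lambda>\<rho>. norm (u \<rho>)) \<le> H1_norm u"
    using square_integral_le_integral_square[OF i] nn H by (intro power2_le_imp_le[OF _ H0]) linarith
  have inc: "norm (u t - u s) \<le> H1_norm u" if "0 \<le> s" "s \<le> t" "t \<le> 1" for s t
  proof -
    have "norm (u t - u s) = norm (integral {s..t} (dd u))"
      using abs_cont_eq[OF ac that(2)] by simp
    also have "\<dots> \<le> integral {s..t} (\<lambda>\<rho>. norm (dd u \<rho>))"
      by (intro integral_norm_bound_integral d that) auto
    also have "\<dots> \<le> integral {0..1} (\<lambda>\<rho>. norm (dd u \<rho>))"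
      using that by (intro integral_subset_le d) auto
    finally show ?thesis using a by simp
  qed
  have sup: "norm (u t) \<le> 2 * H1_norm u" if t: "0 \<le> t" "t \<le> 1" for t
  proof -
    have "norm (u t) - H1_norm u \<le> norm (u s)" if "s \<in> {0..1}" for s
      using inc[of s t] inc[of t s] norm_triangle_ineq2[of "u t" "u s"] t that
      by (cases "s \<le> t") (auto simp: norm_minus_commute)
    then have "integral {0..1} (\<lambda>s :: real. norm (u t) - H1_norm u) \<le> integral {0..1} (\<lambda>s. norm (u s))"
      using i by (intro integral_le) auto
    then show ?thesis using b by simp
  qed
  show "integral {0..1} (\<lambda>\<rho>. norm (dd u \<rho>)) \<le> H1_norm u" "0 \<le> H1_norm u" by fact+
  show "norm (u \<rho>) \<le> 2 * H1_norm u"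
    unfolding periodic1_reduce[OF per, of \<rho>] by (rule sup) (auto simp: frac_lt_1 less_imp_le)
qed

context fem
begin

text \<open>The total variation of u over element j; the factor \<open>len P j\<close> undoes the
  change of variable.\<close>

definition cvar :: "(real \<Rightarrow> plane) \<Rightarrow> nat \<Rightarrow> real" where
  "cvar u j = len P j * integral {0..1} (\<lambda>s. norm (cderiv u j s))"

lemma cvar_nonneg: "j < cells P \<Longrightarrow> 0 \<le> cvar u j"
  unfolding cvar_def
  by (intro mult_nonneg_nonneg less_imp_le[OF len_pos] integral_nonneg integrable_continuous_real
      continuous_intros cderiv_continuous) auto

lemma sum_cvar: assumes u: "u \<in> Vh2 k P" shows "(\<Sum>j<cells P. cvar u j) \<le> H1_norm u"
proof -
  have "((\<lambda>\<rho>. norm (dd u \<rho>)) has_integral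
      (\<Sum>j<cells P. len P j *\<^sub>R integral {0..1} (\<lambda>s. norm (cderiv u j s)))) {0..1}"
    using periodic1_dd[OF Vh2_periodic[OF u]]
    by (intro has_integral_cells continuous_intros cderiv_continuous) (auto simp: Vh2_dd[OF u] periodic1_def)
  then show ?thesis
    using H1_norm_variation[OF Vh2_H1[OF u]] by (simp add: cvar_def integral_unique)
qed

lemma H1_norm_eq_0:
  assumes u: "u \<in> Vh2 k P" and "H1_norm u = 0" shows "u \<rho> = 0"
  using H1_norm_sup[OF Vh2_H1[OF u], of \<rho>] assms(2) by simp

end

section \<open>Linearization estimates\<close>

lemma J_add: "J (a + b) = J a + J b" and J_scale: "J (c *\<^sub>R a) = c *\<^sub>R J a"
  and J_0: "J 0 = 0" and J_minus: "J (a - b) = J a - J b"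
  by (simp_all add: J_def vec_eq_iff forall_2)

lemma norm_J: "norm (J a) = norm a"
  by (simp add: J_def norm_eq_sqrt_inner inner_vec_def sum_2 add.commute)

lemma J_sum: "J (\<Sum>i\<in>I. f i) = (\<Sum>i\<in>I. J (f i))"
  by (induction I rule: infinite_finite_induct) (auto simp: J_add J_0)

text \<open>The lower bound is Cauchy-Schwarz for q and q + d, the upper one expands the square of
  norm (q + d) - norm q. No smallness of d is involved.\<close>

lemma norm_add_expansion:
  fixes q d :: "'a::real_inner"
  assumes "q \<noteq> 0"
  shows "0 \<le> norm (q + d) - norm q - (q \<bullet> d) / norm q"
    and "norm (q + d) - norm q - (q \<bullet> d) / norm q \<le> (norm d)\<^sup>2 / (2 * norm q)"
proof -
  have n: "norm q > 0" using assms by simp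
  have "q \<bullet> (q + d) \<le> norm q * norm (q + d)" by (rule norm_cauchy_schwarz)
  then have "(norm q)\<^sup>2 + q \<bullet> d \<le> norm q * norm (q + d)"
    by (simp add: inner_add_right power2_norm_eq_inner)
  then show "0 \<le> norm (q + d) - norm q - (q \<bullet> d) / norm q"
    using n by (simp add: field_simps power2_eq_square)
  have "0 \<le> (norm (q + d) - norm q)\<^sup>2" by simp
  also have "\<dots> = (norm (q + d))\<^sup>2 - 2 * norm q * norm (q + d) + (norm q)\<^sup>2"
    by (simp add: power2_diff)
  also have "(norm (q + d))\<^sup>2 = (norm q)\<^sup>2 + 2 * (q \<bullet> d) + (norm d)\<^sup>2"
    by (simp add: power2_norm_eq_inner inner_add_left inner_add_right inner_commute)
  finally have "(2 * norm q * (norm (q + d) - norm q) - 2 * (q \<bullet> d)) / (2 * norm q) \<le> (norm d)\<^sup>2 / (2 * norm q)"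
    using n by (intro divide_right_mono) (simp_all add: algebra_simps power2_eq_square)
  then show "norm (q + d) - norm q - (q \<bullet> d) / norm q \<le> (norm d)\<^sup>2 / (2 * norm q)"
    using n by (simp add: diff_divide_distrib)
qed

lemma inverse_norm_diff:
  fixes q q' :: "'a::real_normed_vector"
  assumes "0 < c" "0 < c'" "c \<le> norm q" "c' \<le> norm q'"
  shows "\<bar>1 / norm q - 1 / norm q'\<bar> \<le> norm (q - q') / (c * c')"
proof -
  have "q \<noteq> 0" "q' \<noteq> 0" using assms by auto
  then have "1 / norm q - 1 / norm q' = (norm q' - norm q) / (norm q * norm q')"
    by (simp add: divide_simps)
  then have "\<bar>1 / norm q - 1 / norm q'\<bar> = \<bar>norm q' - norm q\<bar> / (norm q * norm q')"
    by (simp add: abs_divide abs_mult)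
  also have "\<dots> \<le> norm (q - q') / (c * c')"
    using assms norm_triangle_ineq3[of q' q] by (intro frac_le mult_mono) (auto simp: norm_minus_commute)
  finally show ?thesis .
qed

lemma unit_vector_diff:
  fixes q q' :: "'a::real_normed_vector"
  assumes "0 < c" "c \<le> norm q" "c \<le> norm q'"
  shows "norm ((1 / norm q) *\<^sub>R q - (1 / norm q') *\<^sub>R q') \<le> 2 * norm (q - q') / c"
proof -
  have "norm ((1 / norm q) *\<^sub>R q - (1 / norm q') *\<^sub>R q')
      = norm ((1 / norm q) *\<^sub>R (q - q') + (1 / norm q - 1 / norm q') *\<^sub>R q')"
    by (simp add: algebra_simps)
  also have "\<dots> \<le> (1 / norm q) * norm (q - q') + \<bar>1 / norm q - 1 / norm q'\<bar> * norm q'"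
    by (rule norm_triangle_le) simp
  also have "\<dots> \<le> (1 / c) * norm (q - q') + norm (q - q') / (c * norm q') * norm q'"
    using assms by (intro add_mono mult_right_mono inverse_norm_diff) (auto simp: frac_le)
  also have "\<dots> = 2 * norm (q - q') / c" using assms by auto
  finally show ?thesis .
qed

text \<open>The derivative of \<open>(p, q) \<mapsto> p / \<bar>q\<bar>\<close> in direction \<open>(e, d)\<close>.\<close>

definition ratio_deriv :: "plane \<Rightarrow> plane \<Rightarrow> plane \<Rightarrow> plane \<Rightarrow> plane" where
  "ratio_deriv p q e d = (1 / norm q) *\<^sub>R e - ((q \<bullet> d) / norm q ^ 3) *\<^sub>R p"

lemma ratio_deriv_add: "ratio_deriv p q (e + e') (d + d') = ratio_deriv p q e d + ratio_deriv p q e' d'"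
  and ratio_deriv_scale: "ratio_deriv p q (\<theta> *\<^sub>R e) (\<theta> *\<^sub>R d) = \<theta> *\<^sub>R ratio_deriv p q e d"
  by (simp_all add: ratio_deriv_def inner_add_right algebra_simps add_divide_distrib)

lemma ratio_deriv_bound:
  assumes "0 < c" "c \<le> norm q" "norm p \<le> A"
  shows "norm (ratio_deriv p q e d) \<le> norm e / c + A * norm d / c\<^sup>2"
proof -
  have q: "norm q > 0" using assms by linarith
  have A: "0 \<le> A" using assms(3) norm_ge_zero order_trans by blast
  have "norm (ratio_deriv p q e d) \<le> norm e / norm q + \<bar>q \<bullet> d\<bar> / norm q ^ 3 * norm p"
    unfolding ratio_deriv_def by (rule order_trans[OF norm_triangle_ineq4]) simp
  also have "\<dots> \<le> norm e / norm q + norm q * norm d / norm q ^ 3 * A"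
    using assms A by (intro add_mono mult_mono divide_right_mono Cauchy_Schwarz_ineq2) auto
  also have "norm q * norm d / norm q ^ 3 * A = A * norm d / (norm q)\<^sup>2"
    using q by (simp add: field_simps power2_eq_square power3_eq_cube)
  also have "norm e / norm q + A * norm d / (norm q)\<^sup>2 \<le> norm e / c + A * norm d / c\<^sup>2"
    using assms q A by (intro add_mono divide_left_mono power_mono) auto
  finally show ?thesis .
qed

text \<open>The bound on d keeps N = norm (q + d) above c / 2. With N = n + \<eta> + r, where \<eta>
  is linear in d and r quadratic, the error of linearizing 1 / N equals (\<eta>/n) (1/n - 1/N) -
  r/(n N), which is quadratic in d. The change of 1 / N acting on e is of mixed second
  order.\<close>

lemma ratio_expansion:
  assumes c: "0 < c" "c \<le> norm q" and d: "norm d \<le> c / 2" and p: "norm p \<le> A"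
  shows "norm ((1 / norm (q + d)) *\<^sub>R (p + e) - (1 / norm q) *\<^sub>R p - ratio_deriv p q e d)
    \<le> 2 / c\<^sup>2 * (norm d * norm e) + 3 * A / c ^ 3 * (norm d)\<^sup>2"
proof -
  define n where "n = norm q"
  define N where "N = norm (q + d)"
  define \<eta> where "\<eta> = (q \<bullet> d) / n"
  define r where "r = N - n - \<eta>"
  have n: "0 < n" "c \<le> n" using c by (auto simp: n_def)
  have N: "c / 2 \<le> N" using norm_triangle_ineq2[of q "- d"] c d by (simp add: N_def)
  then have N0: "0 < N" using c by linarith
  have r: "0 \<le> r" "r \<le> (norm d)\<^sup>2 / (2 * n)"
    using norm_add_expansion[of q d] n by (auto simp: r_def N_def n_def \<eta>_def)
  have \<eta>: "\<bar>\<eta>\<bar> \<le> norm d"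
    using Cauchy_Schwarz_ineq2[of q d] n(1) by (simp add: \<eta>_def n_def[symmetric] abs_divide pos_divide_le_eq mult.commute)
  have m: "\<bar>1 / N - 1 / n\<bar> \<le> 2 / c\<^sup>2 * norm d"
    using inverse_norm_diff[of "c / 2" c "q + d" q] N c by (simp add: N_def n_def power2_eq_square field_simps)
  have "1 / N - 1 / n + \<eta> / n\<^sup>2 = \<eta> / n * (1 / n - 1 / N) - r / (n * N)"
    using n N0 by (simp add: r_def field_simps power2_eq_square)
  then have "\<bar>1 / N - 1 / n + \<eta> / n\<^sup>2\<bar> \<le> \<bar>\<eta>\<bar> / n * \<bar>1 / n - 1 / N\<bar> + r / (n * N)"
    using n N0 r by (auto simp: abs_mult abs_divide intro: order_trans[OF abs_triangle_ineq4])
  also have "\<dots> \<le> norm d / c * (2 / c\<^sup>2 * norm d) + ((norm d)\<^sup>2 / (2 * c)) / (c * (c / 2))"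
  proof (intro add_mono mult_mono frac_le)
    show "\<bar>1 / n - 1 / N\<bar> \<le> 2 / c\<^sup>2 * norm d" using m by (simp add: abs_minus_commute)
    show "r \<le> (norm d)\<^sup>2 / (2 * c)"
      by (rule order_trans[OF r(2)]) (use n c in \<open>auto intro!: divide_left_mono\<close>)
  qed (use n N c \<eta> N0 in auto)
  also have "\<dots> = 3 / c ^ 3 * (norm d)\<^sup>2"
    using c by (simp add: field_simps power2_eq_square power3_eq_cube)
  finally have s: "\<bar>1 / N - 1 / n + \<eta> / n\<^sup>2\<bar> \<le> 3 / c ^ 3 * (norm d)\<^sup>2" .
  have "(1 / N) *\<^sub>R (p + e) - (1 / n) *\<^sub>R p - ratio_deriv p q e d = (1 / N - 1 / n) *\<^sub>R e + (1 / N - 1 / n + \<eta> / n\<^sup>2) *\<^sub>R p"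
    by (simp add: ratio_deriv_def \<eta>_def n_def[symmetric] algebra_simps power2_eq_square power3_eq_cube)
  also have "norm \<dots> \<le> \<bar>1 / N - 1 / n\<bar> * norm e + \<bar>1 / N - 1 / n + \<eta> / n\<^sup>2\<bar> * norm p"
    by (rule norm_triangle_le) simp
  also have "\<dots> \<le> (2 / c\<^sup>2 * norm d) * norm e + (3 / c ^ 3 * (norm d)\<^sup>2) * A"
    by (intro add_mono mult_mono m s p) (use c in auto)
  finally show ?thesis by (simp add: N_def n_def algebra_simps)
qed

text \<open>The price of freezing coefficients. In terms of m = 1 / norm q and the unit vector t = m
  q, the derivative is m e - (t \<bullet> d) m^2 p, and its factors are Lipschitz one by one. In 4
  A, one half comes from t and the other from m^2.\<close>

lemma ratio_deriv_Lipschitz: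
  assumes c: "0 < c" "c \<le> norm q" "c \<le> norm q'" and p: "norm p \<le> A" "norm p' \<le> A"
    and \<delta>: "norm (p - p') \<le> \<delta>" "norm (q - q') \<le> \<delta>"
  shows "norm (ratio_deriv p q e d - ratio_deriv p' q' e d)
    \<le> \<delta> * (norm e / c\<^sup>2 + norm d * (4 * A / c ^ 3 + 1 / c\<^sup>2))"
proof -
  define m m' where "m = 1 / norm q" and "m' = 1 / norm q'"
  define t t' where "t = m *\<^sub>R q" and "t' = m' *\<^sub>R q'"
  have A: "0 \<le> A" and \<delta>0: "0 \<le> \<delta>" using p \<delta> norm_ge_zero order_trans by blast+
  have m: "0 \<le> m" "m \<le> 1 / c" "0 \<le> m'" "m' \<le> 1 / c"
    using c by (auto simp: m_def m'_def frac_le)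
  have dm: "\<bar>m - m'\<bar> \<le> \<delta> / c\<^sup>2"
    unfolding m_def m'_def power2_eq_square
    by (rule order_trans[OF inverse_norm_diff[of c c]]) (use c \<delta> in \<open>auto intro!: divide_right_mono\<close>)
  have nt: "norm t = 1" "norm t' = 1" using c by (auto simp: t_def t'_def m_def m'_def)
  have dt: "norm (t - t') \<le> 2 * \<delta> / c"
    unfolding t_def t'_def m_def m'_def
    by (rule order_trans[OF unit_vector_diff[of c]]) (use c \<delta> in \<open>auto intro!: divide_right_mono\<close>)
  have rd: "ratio_deriv p q e d = m *\<^sub>R e - (t \<bullet> d) *\<^sub>R (m\<^sup>2 *\<^sub>R p)"
    "ratio_deriv p' q' e d = m' *\<^sub>R e - (t' \<bullet> d) *\<^sub>R (m'\<^sup>2 *\<^sub>R p')"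
    by (simp_all add: ratio_deriv_def t_def t'_def m_def m'_def power2_eq_square power3_eq_cube)
  have m2: "\<bar>m\<^sup>2 - m'\<^sup>2\<bar> \<le> 2 / c * (\<delta> / c\<^sup>2)"
  proof -
    have "m\<^sup>2 - m'\<^sup>2 = (m + m') * (m - m')" by (simp add: algebra_simps power2_eq_square)
    then have "\<bar>m\<^sup>2 - m'\<^sup>2\<bar> = (m + m') * \<bar>m - m'\<bar>" using m by (simp add: abs_mult)
    also have "\<dots> \<le> 2 / c * (\<delta> / c\<^sup>2)" using m dm c \<delta>0 by (intro mult_mono) auto
    finally show ?thesis .
  qed
  have m'2: "m'\<^sup>2 \<le> 1 / c\<^sup>2" "m\<^sup>2 \<le> 1 / c\<^sup>2"
    using power_mono[OF m(4,3), of 2] power_mono[OF m(2,1), of 2] by (simp_all add: power_divide)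
  have w: "norm (m\<^sup>2 *\<^sub>R p) \<le> A / c\<^sup>2"
    using mult_mono[OF m'2(2) p(1)] by simp
  have dw: "norm (m\<^sup>2 *\<^sub>R p - m'\<^sup>2 *\<^sub>R p') \<le> 2 * A * \<delta> / c ^ 3 + \<delta> / c\<^sup>2"
  proof -
    have "norm (m\<^sup>2 *\<^sub>R p - m'\<^sup>2 *\<^sub>R p') = norm ((m\<^sup>2 - m'\<^sup>2) *\<^sub>R p + m'\<^sup>2 *\<^sub>R (p - p'))"
      by (simp add: algebra_simps)
    also have "\<dots> \<le> \<bar>m\<^sup>2 - m'\<^sup>2\<bar> * norm p + m'\<^sup>2 * norm (p - p')"
      by (rule norm_triangle_le) simp
    also have "\<dots> \<le> (2 / c * (\<delta> / c\<^sup>2)) * A + 1 / c\<^sup>2 * \<delta>"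
      using c \<delta>0 by (intro add_mono mult_mono m2 p m'2 \<delta>) auto
    finally show ?thesis by (simp add: field_simps power2_eq_square power3_eq_cube)
  qed
  have "ratio_deriv p q e d - ratio_deriv p' q' e d
      = (m - m') *\<^sub>R e - (((t - t') \<bullet> d) *\<^sub>R (m\<^sup>2 *\<^sub>R p) + (t' \<bullet> d) *\<^sub>R (m\<^sup>2 *\<^sub>R p - m'\<^sup>2 *\<^sub>R p'))"
    by (simp add: rd algebra_simps inner_diff_left)
  also have "norm \<dots> \<le> \<bar>m - m'\<bar> * norm e + (\<bar>(t - t') \<bullet> d\<bar> * norm (m\<^sup>2 *\<^sub>R p) + \<bar>t' \<bullet> d\<bar> * norm (m\<^sup>2 *\<^sub>R p - m'\<^sup>2 *\<^sub>R p'))"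
    by (intro order_trans[OF norm_triangle_ineq4] order_trans[OF norm_triangle_ineq] add_mono) (simp_all add: abs_mult)
  also have "\<dots> \<le> \<delta> / c\<^sup>2 * norm e + ((2 * \<delta> / c * norm d) * (A / c\<^sup>2) + norm d * (2 * A * \<delta> / c ^ 3 + \<delta> / c\<^sup>2))"
  proof (intro add_mono mult_mono dm w dw)
    show "\<bar>(t - t') \<bullet> d\<bar> \<le> 2 * \<delta> / c * norm d"
      by (rule order_trans[OF Cauchy_Schwarz_ineq2]) (intro mult_right_mono dt norm_ge_zero)
    show "\<bar>t' \<bullet> d\<bar> \<le> norm d" using Cauchy_Schwarz_ineq2[of t' d] nt by simp
  qed (use c \<delta>0 A in auto)
  also have "\<dots> = \<delta> * (norm e / c\<^sup>2 + norm d * (4 * A / c ^ 3 + 1 / c\<^sup>2))"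
    using c by (simp add: field_simps power2_eq_square power3_eq_cube)
  finally show ?thesis .
qed

text \<open>The derivative of \<open>q \<mapsto> (v \<bullet> J q) J q / \<bar>q\<bar>\<close> in direction \<open>d\<close>, in terms of the unit vector \<open>t = q / \<bar>q\<bar>\<close>.\<close>

definition proj_deriv :: "plane \<Rightarrow> plane \<Rightarrow> plane \<Rightarrow> plane" where
  "proj_deriv t v d = (v \<bullet> J d) *\<^sub>R J t + (v \<bullet> J t) *\<^sub>R J d - ((v \<bullet> J t) * (t \<bullet> d)) *\<^sub>R J t"

lemma proj_deriv_add: "proj_deriv t v (d + d') = proj_deriv t v d + proj_deriv t v d'"
  and proj_deriv_scale: "proj_deriv t v (\<theta> *\<^sub>R d) = \<theta> *\<^sub>R proj_deriv t v d"
  and proj_deriv_0: "proj_deriv t v 0 = 0"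
  by (simp_all add: proj_deriv_def J_add J_scale J_0 inner_add_right algebra_simps)

lemma proj_deriv_sum: "proj_deriv t v (\<Sum>i\<in>I. f i) = (\<Sum>i\<in>I. proj_deriv t v (f i))"
  by (induction I rule: infinite_finite_induct) (auto simp: proj_deriv_add proj_deriv_0)

lemma inner_J_le: "\<bar>v \<bullet> J d\<bar> \<le> norm v * norm d"
  using Cauchy_Schwarz_ineq2[of v "J d"] by (simp add: norm_J)

lemma proj_deriv_bound:
  assumes "norm t = 1" shows "norm (proj_deriv t v d) \<le> 3 * (norm v * norm d)"
proof -
  have "norm (proj_deriv t v d) \<le> \<bar>v \<bullet> J d\<bar> * 1 + \<bar>v \<bullet> J t\<bar> * norm d + (\<bar>v \<bullet> J t\<bar> * \<bar>t \<bullet> d\<bar>) * 1"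
    unfolding proj_deriv_def using assms
    by (intro order_trans[OF norm_triangle_ineq4] add_mono norm_triangle_le) (simp_all add: norm_J abs_mult)
  also have "\<dots> \<le> (norm v * norm d) * 1 + norm v * norm d + (norm v * norm d) * 1"
    using inner_J_le[of v d] inner_J_le[of v t] Cauchy_Schwarz_ineq2[of t d] assms
    by (intro add_mono mult_mono) auto
  finally show ?thesis by (simp add: mult.commute)
qed

text \<open>The price of replacing velocity and tangent at a node by their values at the left end of
  the element.\<close>

lemma proj_deriv_Lipschitz:
  assumes t: "norm t = 1" "norm t' = 1"
  shows "norm (proj_deriv t v d - proj_deriv t' v' d) \<le> norm d * (3 * norm (v - v') + 5 * (norm v' * norm (t - t')))"
proof -
  define a a' where "a = v \<bullet> J t" and "a' = v' \<bullet> J t'"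
  have a': "\<bar>a'\<bar> \<le> norm v'" using inner_J_le[of v' t'] t by (simp add: a'_def)
  have "a - a' = (v - v') \<bullet> J t + v' \<bullet> J (t - t')"
    by (simp add: a_def a'_def J_minus inner_diff_left inner_diff_right)
  then have da: "\<bar>a - a'\<bar> \<le> norm (v - v') + norm v' * norm (t - t')"
    using inner_J_le[of "v - v'" t] inner_J_le[of v' "t - t'"] t by simp
  have td: "\<bar>t \<bullet> d\<bar> \<le> norm d" "\<bar>t' \<bullet> d\<bar> \<le> norm d" "\<bar>(t - t') \<bullet> d\<bar> \<le> norm (t - t') * norm d"
    using Cauchy_Schwarz_ineq2[of t d] Cauchy_Schwarz_ineq2[of t' d] Cauchy_Schwarz_ineq2[of "t - t'" d] t by auto
  have "proj_deriv t v d - proj_deriv t' v' d =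
      (((v - v') \<bullet> J d) *\<^sub>R J t + (v' \<bullet> J d) *\<^sub>R J (t - t')) + (a - a') *\<^sub>R J d
      - (((a - a') * (t \<bullet> d)) *\<^sub>R J t + (a' * ((t - t') \<bullet> d)) *\<^sub>R J t + (a' * (t' \<bullet> d)) *\<^sub>R J (t - t'))"
    by (simp add: proj_deriv_def a_def[symmetric] a'_def[symmetric] J_minus algebra_simps inner_diff_left)
  also have "norm \<dots> \<le> ((\<bar>(v - v') \<bullet> J d\<bar> * 1 + \<bar>v' \<bullet> J d\<bar> * norm (t - t')) + \<bar>a - a'\<bar> * norm d)
      + ((\<bar>a - a'\<bar> * \<bar>t \<bullet> d\<bar>) * 1 + (\<bar>a'\<bar> * \<bar>(t - t') \<bullet> d\<bar>) * 1 + (\<bar>a'\<bar> * \<bar>t' \<bullet> d\<bar>) * norm (t - t'))"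
    using t by (intro order_trans[OF norm_triangle_ineq4] add_mono norm_triangle_le) (simp_all add: norm_J abs_mult)
  also have "\<dots> \<le> (((norm (v - v') * norm d) * 1 + (norm v' * norm d) * norm (t - t')) + (norm (v - v') + norm v' * norm (t - t')) * norm d)
      + (((norm (v - v') + norm v' * norm (t - t')) * norm d) * 1 + (norm v' * (norm (t - t') * norm d)) * 1 + (norm v' * norm d) * norm (t - t'))"
    by (intro add_mono mult_mono inner_J_le da td a') auto
  also have "\<dots> = norm d * (3 * norm (v - v') + 5 * (norm v' * norm (t - t')))"
    by (simp add: algebra_simps)
  finally show ?thesis .
qed

text \<open>The lumped form at one node. Its linear part is additive over the elements meeting at the node, so that the
  cancellation can be exploited element by element, although the averaged normal couples the elements.\<close>

lemma nodal_expansion: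
  fixes d :: "'i \<Rightarrow> plane" and W :: "'i \<Rightarrow> real"
  assumes I: "finite I" "I \<noteq> {}" and W: "\<And>i. i \<in> I \<Longrightarrow> 0 < W i"
    and c: "0 < c" "c \<le> norm q" and d: "\<And>i. i \<in> I \<Longrightarrow> norm (d i) \<le> c / 2"
  defines "t \<equiv> (1 / norm q) *\<^sub>R q"
  defines "\<mu> \<equiv> (\<Sum>i\<in>I. W i * norm (q + d i))" and "Q \<equiv> (\<Sum>i\<in>I. W i *\<^sub>R (q + d i))"
  shows "\<bar>(v \<bullet> J Q) * (\<phi> \<bullet> J Q) / \<mu>
      - (\<Sum>i\<in>I. W i * ((v \<bullet> J q) * (\<phi> \<bullet> J q) / norm q + \<phi> \<bullet> proj_deriv t v (d i)))\<bar>
    \<le> 11 / c * (\<Sum>i\<in>I. W i * (norm (d i))\<^sup>2) * (norm v * norm \<phi>)"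
proof -
  define n where "n = norm q"
  define w where "w = (\<Sum>i\<in>I. W i)"
  define D where "D = (\<Sum>i\<in>I. W i *\<^sub>R d i)"
  define S where "S = (\<Sum>i\<in>I. W i * (norm (d i))\<^sup>2)"
  define \<eta> where "\<eta> = t \<bullet> D"
  define r where "r = \<mu> - w * n - \<eta>"
  \<comment> \<open>The claimed expansion, summed over I. As \<open>proj_deriv\<close> is linear in
    its last argument, the \<open>d i\<close> enter it only through their weighted sum D.\<close>
  define target where "target = w * (v \<bullet> J q) * (\<phi> \<bullet> J q) / n + \<phi> \<bullet> proj_deriv t v D"
  have n: "0 < n" "c \<le> n" using c by (auto simp: n_def)
  have w: "0 < w" unfolding w_def using I W by (intro sum_pos)
  have nt: "norm t = 1" and qt: "q = n *\<^sub>R t" using n by (auto simp: t_def n_def)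
  have S0: "0 \<le> S" unfolding S_def using W by (intro sum_nonneg) (simp add: less_imp_le)
  have Q: "Q = w *\<^sub>R q + D"
    by (simp add: Q_def w_def D_def scaleR_add_right sum.distrib scaleR_sum_left)
  have D1: "norm D \<le> (\<Sum>i\<in>I. W i * norm (d i))"
    unfolding D_def using W by (intro sum_norm_le) (simp add: less_imp_le)
  also have "\<dots> \<le> (\<Sum>i\<in>I. W i * (c / 2))"
    using W d by (intro sum_mono mult_left_mono) (auto simp: less_imp_le)
  also have "\<dots> \<le> w * (n / 2)"
    unfolding w_def sum_distrib_right[symmetric] using w n by (intro mult_left_mono) (auto simp: w_def)
  finally have Dn: "norm D \<le> w * (n / 2)" .
  \<comment> \<open>Cauchy-Schwarz with each weight \<open>W i\<close> split into two square
    roots.\<close>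
  have D2: "(norm D)\<^sup>2 \<le> w * S"
  proof -
    have "(norm D)\<^sup>2 \<le> (\<Sum>i\<in>I. W i * norm (d i))\<^sup>2" using D1 by (intro power_mono) auto
    also have "\<dots> = (\<Sum>i\<in>I. sqrt (W i) * (sqrt (W i) * norm (d i)))\<^sup>2"
      using W by (intro arg_cong[of _ _ "\<lambda>x. x\<^sup>2"] sum.cong) (auto simp: mult.assoc[symmetric] less_imp_le)
    also have "\<dots> \<le> (\<Sum>i\<in>I. (sqrt (W i))\<^sup>2) * (\<Sum>i\<in>I. (sqrt (W i) * norm (d i))\<^sup>2)"
      by (rule Cauchy_Schwarz_ineq_sum)
    also have "\<dots> = w * S"
      unfolding w_def S_def using W
      by (intro arg_cong2[of _ _ _ _ "(*)"] sum.cong) (auto simp: power_mult_distrib less_imp_le)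
    finally show ?thesis .
  qed
  have r_eq: "r = (\<Sum>i\<in>I. W i * (norm (q + d i) - n - (q \<bullet> d i) / n))"
    by (simp add: r_def \<mu>_def w_def \<eta>_def t_def D_def n_def[symmetric] right_diff_distrib sum_subtractf
        sum_distrib_right inner_sum_right sum_divide_distrib)
  have r: "0 \<le> r" "r \<le> S / (2 * n)"
  proof -
    have q: "q \<noteq> 0" using n by (auto simp: n_def)
    show "0 \<le> r"
      unfolding r_eq using norm_add_expansion(1)[OF q] W by (intro sum_nonneg mult_nonneg_nonneg) (auto simp: n_def less_imp_le)
    have "r \<le> (\<Sum>i\<in>I. W i * ((norm (d i))\<^sup>2 / (2 * n)))"
      unfolding r_eq using norm_add_expansion(2)[OF q] W by (intro sum_mono mult_left_mono) (auto simp: n_def less_imp_le)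
    then show "r \<le> S / (2 * n)" by (simp add: S_def sum_divide_distrib)
  qed
  have \<eta>: "\<bar>\<eta>\<bar> \<le> norm D" using Cauchy_Schwarz_ineq2[of t D] nt by (simp add: \<eta>_def)
  have \<mu>: "w * (n / 2) \<le> \<mu>"
  proof -
    have "\<mu> = w * n + \<eta> + r" by (simp add: r_def)
    then show ?thesis using r(1) \<eta> Dn by (simp add: algebra_simps abs_le_iff)
  qed
  have \<mu>0: "0 < \<mu>" using \<mu> w n by (smt (verit) mult_pos_pos half_gt_zero)
  have sum_eq: "(\<Sum>i\<in>I. W i * ((v \<bullet> J q) * (\<phi> \<bullet> J q) / norm q + \<phi> \<bullet> proj_deriv t v (d i))) = target"
    by (simp add: target_def n_def w_def D_def distrib_left sum.distrib proj_deriv_sum proj_deriv_scale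
        inner_sum_right sum_distrib_right sum_divide_distrib mult.assoc)
  define \<alpha> \<beta> \<alpha>' \<beta>' where "\<alpha> = v \<bullet> J t" and "\<beta> = \<phi> \<bullet> J t" and "\<alpha>' = v \<bullet> J D" and "\<beta>' = \<phi> \<bullet> J D"
  have bnd: "\<bar>\<alpha>\<bar> \<le> norm v" "\<bar>\<beta>\<bar> \<le> norm \<phi>" "\<bar>\<alpha>'\<bar> \<le> norm v * norm D" "\<bar>\<beta>'\<bar> \<le> norm \<phi> * norm D"
    using inner_J_le[of v t] inner_J_le[of \<phi> t] inner_J_le[of v D] inner_J_le[of \<phi> D] nt
    by (auto simp: \<alpha>_def \<beta>_def \<alpha>'_def \<beta>'_def)
  have JQ: "v \<bullet> J Q = w * n * \<alpha> + \<alpha>'" "\<phi> \<bullet> J Q = w * n * \<beta> + \<beta>'"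
    by (simp_all add: Q qt J_add J_scale inner_add_right \<alpha>_def \<beta>_def \<alpha>'_def \<beta>'_def mult.assoc)
  have target: "target = w * n * \<alpha> * \<beta> + (\<alpha>' * \<beta> + \<alpha> * \<beta>' - \<alpha> * \<beta> * \<eta>)"
    using n by (simp add: target_def proj_deriv_def qt J_scale inner_add_right inner_diff_right \<alpha>_def \<beta>_def \<alpha>'_def \<beta>'_def \<eta>_def)
  \<comment> \<open>All first-order terms cancel. What remains is a product of two first-order
    factors and the second-order remainder r of \<mu>.\<close>
  have key: "(v \<bullet> J Q) * (\<phi> \<bullet> J Q) - \<mu> * target = (\<alpha>' - \<alpha> * \<eta>) * (\<beta>' - \<beta> * \<eta>) - r * target"
  proof -
    have "\<mu> = w * n + \<eta> + r" by (simp add: r_def)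
    then show ?thesis unfolding JQ target by (simp add: algebra_simps)
  qed
  have "\<bar>\<phi> \<bullet> proj_deriv t v D\<bar> \<le> norm \<phi> * (3 * (norm v * norm D))"
    by (rule order_trans[OF Cauchy_Schwarz_ineq2]) (intro mult_left_mono proj_deriv_bound nt norm_ge_zero)
  moreover have "\<bar>w * (v \<bullet> J q) * (\<phi> \<bullet> J q) / n\<bar> \<le> w * n * (norm v * norm \<phi>)"
  proof -
    have "\<bar>w * (v \<bullet> J q) * (\<phi> \<bullet> J q) / n\<bar> = w * n * (\<bar>\<alpha>\<bar> * \<bar>\<beta>\<bar>)"
      using n w by (simp add: qt J_scale \<alpha>_def \<beta>_def abs_mult)
    also have "\<dots> \<le> w * n * (norm v * norm \<phi>)"
      using w n bnd by (intro mult_left_mono mult_mono) auto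
    finally show ?thesis .
  qed
  ultimately have "\<bar>target\<bar> \<le> w * n * (norm v * norm \<phi>) + norm \<phi> * (3 * (norm v * norm D))"
    unfolding target_def by linarith
  also have "\<dots> \<le> w * n * (norm v * norm \<phi>) + norm \<phi> * (3 * (norm v * (w * (n / 2))))"
    by (intro add_left_mono mult_left_mono Dn) auto
  finally have tb: "\<bar>target\<bar> \<le> 5 / 2 * (w * n) * (norm v * norm \<phi>)" by (simp add: algebra_simps)
  have rt: "\<bar>r * target\<bar> \<le> 5 / 4 * (w * S) * (norm v * norm \<phi>)"
  proof -
    have "\<bar>r * target\<bar> \<le> S / (2 * n) * (5 / 2 * (w * n) * (norm v * norm \<phi>))"
      unfolding abs_mult using r tb S0 n by (intro mult_mono) auto
    then show ?thesis using n by (simp add: field_simps)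
  qed
  have f: "\<bar>\<alpha>' - \<alpha> * \<eta>\<bar> \<le> 2 * (norm v * norm D)" "\<bar>\<beta>' - \<beta> * \<eta>\<bar> \<le> 2 * (norm \<phi> * norm D)"
    using bnd mult_mono[OF bnd(1) \<eta>] mult_mono[OF bnd(2) \<eta>]
    by (auto simp: abs_mult[symmetric] intro!: order_trans[OF abs_triangle_ineq4])
  have "\<bar>(\<alpha>' - \<alpha> * \<eta>) * (\<beta>' - \<beta> * \<eta>)\<bar> \<le> 2 * (norm v * norm D) * (2 * (norm \<phi> * norm D))"
    unfolding abs_mult by (intro mult_mono f) auto
  also have "\<dots> = 4 * (norm D)\<^sup>2 * (norm v * norm \<phi>)" by (simp add: power2_eq_square)
  also have "\<dots> \<le> 4 * (w * S) * (norm v * norm \<phi>)"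
    using D2 by (intro mult_right_mono mult_left_mono) auto
  finally have "\<bar>(v \<bullet> J Q) * (\<phi> \<bullet> J Q) - \<mu> * target\<bar> \<le> 4 * (w * S) * (norm v * norm \<phi>) + 5 / 4 * (w * S) * (norm v * norm \<phi>)"
    unfolding key using rt by (intro order_trans[OF abs_triangle_ineq4] add_mono)
  \<comment> \<open>A round bound for 4 + 5/4. Dividing by \<mu> \<ge> w (c/2) doubles it to the
    final 11 / c.\<close>
  also have "\<dots> \<le> 11 / 2 * (w * S) * (norm v * norm \<phi>)"
  proof -
    have "0 \<le> (w * S) * (norm v * norm \<phi>)" using w S0 by simp
    then show ?thesis by (simp add: algebra_simps)
  qed
  finally have num: "\<bar>(v \<bullet> J Q) * (\<phi> \<bullet> J Q) - \<mu> * target\<bar> \<le> 11 / 2 * (w * S) * (norm v * norm \<phi>)" .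
  have "\<bar>(v \<bullet> J Q) * (\<phi> \<bullet> J Q) / \<mu> - target\<bar> = \<bar>(v \<bullet> J Q) * (\<phi> \<bullet> J Q) - \<mu> * target\<bar> / \<mu>"
    using \<mu>0 by (simp add: field_simps abs_divide)
  also have "\<dots> \<le> 11 / 2 * (w * S) * (norm v * norm \<phi>) / (w * (c / 2))"
  proof (intro frac_le num)
    show "w * (c / 2) \<le> \<mu>" by (rule order_trans[OF _ \<mu>]) (use w n in auto)
  qed (use w c S0 in auto)
  also have "\<dots> = 11 / c * S * (norm v * norm \<phi>)" using w c by (simp add: field_simps)
  finally show ?thesis unfolding sum_eq S_def .
qed

section \<open>Interpolation and quadrature errors on one element\<close>

text \<open>Provides the derivative families to which the Taylor estimates on [0,1] apply: the m-th
  member carries the factor L^m.\<close>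

lemma bounded_smooth_pullback:
  assumes "bounded_smooth n B f"
  shows "((\<lambda>s. L ^ m * ((dd ^^ m) f (a + L * s) $ i)) has_real_derivative
     L ^ Suc m * ((dd ^^ Suc m) f (a + L * s) $ i)) (at s)"
proof -
  have "((\<lambda>s. a + L * s) has_vector_derivative L) (at s)" by (auto intro!: derivative_eq_intros)
  from vector_diff_chain_at[OF this bounded_smooth_deriv[OF assms]]
  have "((\<lambda>s. (dd ^^ m) f (a + L * s)) has_vector_derivative L *\<^sub>R (dd ^^ Suc m) f (a + L * s)) (at s)"
    by (simp add: o_def)
  from bounded_linear.has_vector_derivative[OF bounded_linear_vec_nth this]
  have "((\<lambda>s. (dd ^^ m) f (a + L * s) $ i) has_real_derivative L * ((dd ^^ Suc m) f (a + L * s) $ i)) (at s)"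
    by (simp add: has_real_derivative_iff_has_vector_derivative)
  from DERIV_cmult[OF this, of "L ^ m"] show ?thesis by (simp add: mult_ac)
qed

text \<open>This is \<open>ref_interp_error\<close> for each component of the pullback, with M =
  L^(k+2) B, divided by L. The vector c is minus the derivative of order k + 1 at the left end over
  (k+1)!; it does not depend on s, and the same polynomial \<open>res_poly\<close> serves every
  f.\<close>

lemma (in lobatto_rule) interp_deriv_error:
  "\<exists>C\<ge>0. \<forall>f B a L. bounded_smooth (k + 2) B f \<and> 0 < L \<longrightarrow> (\<exists>c. norm c \<le> B \<and> (\<forall>s\<in>{0..1}.
     norm ((1 / L) *\<^sub>R (\<chi> i. poly (pderiv (ref_interp (\<lambda>s. f (a + L * s) $ i))) s)
       - dd f (a + L * s) - (L ^ k * poly res_poly s) *\<^sub>R c) \<le> C * B * L ^ (k + 1)))"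
proof -
  obtain C where C: "0 \<le> C" and est: "\<And>g M s. (\<And>m s. m < k + 2 \<Longrightarrow> (g m has_real_derivative g (Suc m) s) (at s)) \<Longrightarrow>
      (\<And>s. \<bar>g (k + 2) s\<bar> \<le> M) \<Longrightarrow> s \<in> {0..1} \<Longrightarrow>
      \<bar>poly (pderiv (ref_interp (g 0))) s - g 1 s + g (k + 1) 0 / fact (k + 1) * poly res_poly s\<bar> \<le> C * M"
    using ref_interp_error by blast
  have "\<exists>c. norm c \<le> B \<and> (\<forall>s\<in>{0..1}.
     norm ((1 / L) *\<^sub>R (\<chi> i. poly (pderiv (ref_interp (\<lambda>s. f (a + L * s) $ i))) s)
       - dd f (a + L * s) - (L ^ k * poly res_poly s) *\<^sub>R c) \<le> 2 * C * B * L ^ (k + 1))"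
    if f: "bounded_smooth (k + 2) B f" and L: "0 < L" for f B a L
  proof (intro exI[of _ "- (1 / fact (k + 1)) *\<^sub>R (dd ^^ (k + 1)) f a"] conjI ballI)
    have "norm ((dd ^^ (k + 1)) f a) / fact (k + 1) \<le> B / 1"
      using bounded_smooth_bound[OF f, of "k + 1" a] fact_ge_1[of "k + 1", where 'a = real]
        order_trans[OF norm_ge_zero bounded_smooth_bound[OF f, of 0 a]]
      by (intro frac_le) auto
    then show "norm (- (1 / fact (k + 1)) *\<^sub>R (dd ^^ (k + 1)) f a) \<le> B" by simp
    fix s :: real assume s: "s \<in> {0..1}"
    define E where "E = (1 / L) *\<^sub>R (\<chi> i. poly (pderiv (ref_interp (\<lambda>s. f (a + L * s) $ i))) s)
       - dd f (a + L * s) - (L ^ k * poly res_poly s) *\<^sub>R (- (1 / fact (k + 1)) *\<^sub>R (dd ^^ (k + 1)) f a)"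
    have "\<bar>E $ i\<bar> \<le> C * B * L ^ (k + 1)" for i
    proof -
      define g where "g = (\<lambda>m s. L ^ m * ((dd ^^ m) f (a + L * s) $ i))"
      have "\<bar>g (k + 2) s\<bar> \<le> L ^ (k + 2) * B" for s
      proof -
        have "\<bar>(dd ^^ (k + 2)) f (a + L * s) $ i\<bar> \<le> B"
          using component_le_norm_cart bounded_smooth_bound[OF f, of "k + 2"] order_trans by blast
        then show ?thesis using L by (simp add: g_def abs_mult del: funpow.simps)
      qed
      then have "\<bar>poly (pderiv (ref_interp (g 0))) s - g 1 s + g (k + 1) 0 / fact (k + 1) * poly res_poly s\<bar> \<le> C * (L ^ (k + 2) * B)"
        using bounded_smooth_pullback[OF f] s by (intro est) (auto simp: g_def)
      also have "poly (pderiv (ref_interp (g 0))) s - g 1 s + g (k + 1) 0 / fact (k + 1) * poly res_poly s = L * E $ i"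
        using L by (simp add: g_def E_def field_simps)
      finally have "L * \<bar>E $ i\<bar> \<le> L * (C * B * L ^ (k + 1))"
        using L by (simp add: abs_mult algebra_simps)
      then show ?thesis using L by (simp only: mult_le_cancel_left_pos)
    qed
    \<comment> \<open>The two components account for the factor 2 in the constant.\<close>
    then have "(\<Sum>i\<in>UNIV. \<bar>E $ i\<bar>) \<le> (\<Sum>i\<in>(UNIV :: 2 set). C * B * L ^ (k + 1))" by (intro sum_mono)
    then show "norm E \<le> 2 * C * B * L ^ (k + 1)"
      using norm_le_l1_cart[of E] by simp
  qed
  moreover have "0 \<le> 2 * C" using C by simp
  ultimately show ?thesis by (intro exI[of _ "2 * C"]) auto
qed

section \<open>Quadrature error for a smooth function times a polynomial\<close>

context lobatto_rule
begin

text \<open>The rule and the integral are both averages, the weights being positive with sum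
  1.\<close>

lemma quadrature_error_le:
  assumes f: "continuous_on {0..1} f" and M: "\<And>s. 0 \<le> s \<Longrightarrow> s \<le> 1 \<Longrightarrow> \<bar>f s\<bar> \<le> M"
  shows "\<bar>(\<Sum>l\<le>k. w l * f (\<xi> l)) - integral {0..1} f\<bar> \<le> 2 * M"
proof -
  have "\<bar>\<Sum>l\<le>k. w l * f (\<xi> l)\<bar> \<le> (\<Sum>l\<le>k. w l * M)"
    using w_pos xi_bounds M
    by (intro order_trans[OF sum_abs] sum_mono) (auto simp: abs_mult abs_of_pos)
  also have "\<dots> = M" using sum_w by (simp add: sum_distrib_right[symmetric])
  finally have 1: "\<bar>\<Sum>l\<le>k. w l * f (\<xi> l)\<bar> \<le> M" .
  have "norm (integral {0..1} f) \<le> M * (1 - 0)"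
    using f M by (intro integral_bound) auto
  with 1 show ?thesis by simp
qed

text \<open>Split p into p(0) and p - p(0). Against the constant, g is replaced by its Taylor
  polynomial of degree k, within the exactness 2k - 1. Against p - p(0), of degree k, exactness
  allows only degree k - 1 for g; the derivative lost is made up for by the small variation
  V.\<close>

lemma quadrature_error:
  assumes g: "\<And>m s. (g m has_real_derivative g (Suc m) s) (at s)"
    and M: "\<And>s. \<bar>g k s\<bar> \<le> M" "\<And>s. \<bar>g (k + 1) s\<bar> \<le> M'"
    and p: "degree p \<le> k" "\<bar>poly p 0\<bar> \<le> \<Phi>" "\<And>s. 0 \<le> s \<Longrightarrow> s \<le> 1 \<Longrightarrow> \<bar>poly p s - poly p 0\<bar> \<le> V"
  shows "\<bar>(\<Sum>l\<le>k. w l * (g 0 (\<xi> l) * poly p (\<xi> l))) - integral {0..1} (\<lambda>s. g 0 s * poly p s)\<bar>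
    \<le> 2 * (M' * \<Phi>) + 2 * (M * V)"
proof -
  define T T' where "T = taylor_poly (k + 1) g" and "T' = taylor_poly k g"
  have M0: "0 \<le> M" "0 \<le> M'" using M[of 0] by auto
  have cont: "continuous_on S (g 0)" for S
    using g by (auto intro!: continuous_at_imp_continuous_on DERIV_isCont)
  define f1 f2 q where "f1 = (\<lambda>s. (g 0 s - poly T s) * poly p 0)"
    and "f2 = (\<lambda>s. (g 0 s - poly T' s) * (poly p s - poly p 0))"
    and "q = smult (poly p 0) T + T' * (p - [:poly p 0:])"
  have c1: "continuous_on {0..1} f1" and c2: "continuous_on {0..1} f2"
    unfolding f1_def f2_def by (intro continuous_intros cont)+
  have "degree (p - [:poly p 0:]) \<le> k" using p(1) by (intro degree_diff_le) auto
  then have "degree (T' * (p - [:poly p 0:])) \<le> 2 * k - 1"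
    using degree_mult_le[of T' "p - [:poly p 0:]"] degree_taylor_poly[of k g] k_pos by (simp add: T'_def)
  moreover have "degree (smult (poly p 0) T) \<le> 2 * k - 1"
    using degree_smult_le[of "poly p 0" T] degree_taylor_poly[of "k + 1" g] k_pos by (simp add: T_def)
  ultimately have dq: "degree q \<le> 2 * k - 1" unfolding q_def by (intro degree_add_le)
  have split: "g 0 s * poly p s = f1 s + f2 s + poly q s" for s
    by (simp add: f1_def f2_def q_def algebra_simps)
  have "integral {0..1} (\<lambda>s. g 0 s * poly p s) = integral {0..1} f1 + integral {0..1} f2 + integral {0..1} (poly q)"
    unfolding split using c1 c2
    by (simp add: integral_add integrable_add integrable_continuous_real continuous_on_poly)
  moreover have "(\<Sum>l\<le>k. w l * (g 0 (\<xi> l) * poly p (\<xi> l)))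
      = (\<Sum>l\<le>k. w l * f1 (\<xi> l)) + (\<Sum>l\<le>k. w l * f2 (\<xi> l)) + (\<Sum>l\<le>k. w l * poly q (\<xi> l))"
    unfolding split by (simp add: distrib_left sum.distrib)
  moreover have "\<bar>(\<Sum>l\<le>k. w l * f1 (\<xi> l)) - integral {0..1} f1\<bar> \<le> 2 * (M' * \<Phi>)"
  proof (rule quadrature_error_le[OF c1])
    fix s :: real assume "0 \<le> s" "s \<le> 1"
    then have "\<bar>g 0 s - poly T s\<bar> \<le> M'"
      unfolding T_def using g M(2) by (intro taylor_poly_error) auto
    then show "\<bar>f1 s\<bar> \<le> M' * \<Phi>" unfolding f1_def abs_mult using p(2) M0 by (intro mult_mono) auto
  qed
  moreover have "\<bar>(\<Sum>l\<le>k. w l * f2 (\<xi> l)) - integral {0..1} f2\<bar> \<le> 2 * (M * V)"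
  proof (rule quadrature_error_le[OF c2])
    fix s :: real assume s: "0 \<le> s" "s \<le> 1"
    then have "\<bar>g 0 s - poly T' s\<bar> \<le> M"
      unfolding T'_def using g M(1) by (intro taylor_poly_error) auto
    then show "\<bar>f2 s\<bar> \<le> M * V" unfolding f2_def abs_mult using p(3)[OF s] M0 by (intro mult_mono) auto
  qed
  ultimately show ?thesis using exact[OF dq] by linarith
qed

end

section \<open>Consistency of the discrete scheme\<close>

text \<open>One mesh and one input, with the constants that bound them. The condition
  \<open>mesh_small\<close> keeps the error of the derivative of the interpolant y below c / 2, so
  that y stays regular.\<close>

locale consistency = fem +
  fixes c B C\<^sub>I \<Lambda> :: real and x X v z :: "real \<Rightarrow> plane"
  assumes c: "0 < c" and C\<^sub>I: "0 \<le> C\<^sub>I"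
    and \<Lambda>: "\<And>s. s \<in> {0..1} \<Longrightarrow> \<bar>poly res_poly s\<bar> \<le> \<Lambda>"
    and interp_err: "\<And>f a L. bounded_smooth (k + 2) B f \<Longrightarrow> 0 < L \<Longrightarrow> \<exists>d. norm d \<le> B \<and> (\<forall>s\<in>{0..1}.
      norm ((1 / L) *\<^sub>R (\<chi> i. poly (pderiv (ref_interp (\<lambda>s. f (a + L * s) $ i))) s)
       - dd f (a + L * s) - (L ^ k * poly res_poly s) *\<^sub>R d) \<le> C\<^sub>I * B * L ^ (k + 1))"
    and x: "bounded_smooth (k + 2) B x" and X: "bounded_smooth (k + 2) B X"
    and v: "bounded_smooth 1 B v" and z: "bounded_smooth (k + 1) B z"
    and speed_ge: "\<And>\<rho>. c \<le> norm (dd x \<rho>)"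
    and z_eq: "\<And>\<rho>. z \<rho> = ((v \<rho> \<bullet> J (dd x \<rho>)) / norm (dd x \<rho>)) *\<^sub>R J (dd x \<rho>)"
    and mesh_le_1: "mesh_size P \<le> 1" and mesh_small: "(B * \<Lambda> + C\<^sub>I * B) * mesh_size P \<le> c / 2"
begin

abbreviation "h \<equiv> mesh_size P"

text \<open>The constant of the plain estimate D L^k for the derivative of the interpolation error:
  leading part plus remainder, using L \<le> 1.\<close>

definition "D = B * \<Lambda> + C\<^sub>I * B"

abbreviation "y \<equiv> interp k \<xi> P x"

lemma \<Lambda>_nonneg: "0 \<le> \<Lambda>"
  using \<Lambda>[of 0] by simp

lemma B_nonneg: "0 \<le> B"
  using order_trans[OF norm_ge_zero bounded_smooth_bound[OF x, of 0 0]] by simp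

lemma D_nonneg: "0 \<le> D"
  using \<Lambda>_nonneg B_nonneg C\<^sub>I by (simp add: D_def)

lemma len_powers:
  assumes "j < cells P"
  shows "len P j \<le> 1" "len P j ^ (k + 1) \<le> len P j ^ k" "len P j ^ (2 * k) \<le> len P j ^ (k + 1)"
    "len P j ^ (k + 1) \<le> h ^ (k + 1)" "D * len P j ^ k \<le> c / 2"
proof -
  have L: "0 < len P j" by (rule len_pos[OF assms])
  show L1: "len P j \<le> 1" using len_le[OF assms] mesh_le_1 by linarith
  show "len P j ^ (k + 1) \<le> len P j ^ k" "len P j ^ (2 * k) \<le> len P j ^ (k + 1)"
    using L L1 k_pos by (intro power_decreasing; simp)+
  show "len P j ^ (k + 1) \<le> h ^ (k + 1)" using L len_le[OF assms] by (intro power_mono) auto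
  have "len P j ^ k \<le> len P j ^ 1" using L L1 k_pos by (intro power_decreasing) auto
  then have "D * len P j ^ k \<le> D * h" using len_le[OF assms] D_nonneg by (intro mult_left_mono) auto
  then show "D * len P j ^ k \<le> c / 2" using mesh_small by (simp add: D_def)
qed

lemma cderiv_interp:
  assumes "periodic1 f" "j < cells P"
  shows "cderiv (interp k \<xi> P f) j s = (1 / len P j) *\<^sub>R (\<chi> i. poly (pderiv (ref_interp (\<lambda>s. f (loc j s) $ i))) s)"
  using cpoly_interp[OF assms] by (simp add: cderiv_def) (simp add: cpoly_def)

text \<open>The first estimate keeps the leading part, for the linear terms. The second forgets it
  and serves the quadratic terms.\<close>

lemma interp_cell_error:
  assumes f: "bounded_smooth (k + 2) B f" and j: "j < cells P"
  obtains d where "norm d \<le> B"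
    and "\<And>s. 0 \<le> s \<Longrightarrow> s \<le> 1 \<Longrightarrow>
      norm (cderiv (interp k \<xi> P f) j s - dd f (loc j s) - (len P j ^ k * poly res_poly s) *\<^sub>R d) \<le> C\<^sub>I * B * len P j ^ (k + 1)"
    and "\<And>s. 0 \<le> s \<Longrightarrow> s \<le> 1 \<Longrightarrow> norm (cderiv (interp k \<xi> P f) j s - dd f (loc j s)) \<le> D * len P j ^ k"
proof -
  obtain d where d: "norm d \<le> B" and err: "\<And>s. s \<in> {0..1} \<Longrightarrow>
      norm ((1 / len P j) *\<^sub>R (\<chi> i. poly (pderiv (ref_interp (\<lambda>s. f (pt P j + len P j * s) $ i))) s)
       - dd f (pt P j + len P j * s) - (len P j ^ k * poly res_poly s) *\<^sub>R d) \<le> C\<^sub>I * B * len P j ^ (k + 1)"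
    using interp_err[OF f len_pos[OF j]] by blast
  have e: "norm (cderiv (interp k \<xi> P f) j s - dd f (loc j s) - (len P j ^ k * poly res_poly s) *\<^sub>R d) \<le> C\<^sub>I * B * len P j ^ (k + 1)"
    if "0 \<le> s" "s \<le> 1" for s
    unfolding cderiv_interp[OF bounded_smooth_periodic[OF f] j] loc_def using err[of s] that by simp
  have "norm (cderiv (interp k \<xi> P f) j s - dd f (loc j s)) \<le> D * len P j ^ k" if s: "0 \<le> s" "s \<le> 1" for s
  proof -
    have "norm ((len P j ^ k * poly res_poly s) *\<^sub>R d) \<le> len P j ^ k * \<Lambda> * B"
      using \<Lambda>[of s] s d len_pos[OF j] \<Lambda>_nonneg by (simp add: abs_mult) (intro mult_mono, auto)
    moreover have "C\<^sub>I * B * len P j ^ (k + 1) \<le> C\<^sub>I * B * len P j ^ k"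
      using len_powers(2)[OF j] C\<^sub>I B_nonneg by (intro mult_left_mono) auto
    moreover note e[OF s] norm_triangle_sub[of "cderiv (interp k \<xi> P f) j s - dd f (loc j s)" "(len P j ^ k * poly res_poly s) *\<^sub>R d"]
    ultimately show ?thesis by (simp add: D_def algebra_simps)
  qed
  with d e show ?thesis using that by blast
qed

lemma y_Vh2: "y \<in> Vh2 k P" and Z_Vh2: "interp k \<xi> P X \<in> Vh2 k P"
  using interp_Vh2 bounded_smooth_periodic x X by blast+

lemma cderiv_y_ge:
  assumes "j < cells P" "0 \<le> s" "s \<le> 1" shows "c / 2 \<le> norm (cderiv y j s)"
proof -
  have "norm (cderiv y j s - dd x (loc j s)) \<le> c / 2"
    using interp_cell_error[OF x assms(1)] len_powers(5)[OF assms(1)] assms(2,3) order_trans by metis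
  moreover have "norm (dd x (loc j s)) - norm (cderiv y j s) \<le> norm (cderiv y j s - dd x (loc j s))"
    using norm_triangle_ineq2[of "dd x (loc j s)" "cderiv y j s"] by (simp add: norm_minus_commute)
  ultimately show ?thesis using speed_ge[of "loc j s"] by linarith
qed

lemma cderiv_y_nz: "j < cells P \<Longrightarrow> 0 \<le> s \<Longrightarrow> s \<le> 1 \<Longrightarrow> cderiv y j s \<noteq> 0"
  using cderiv_y_ge[of j s] c by auto

section \<open>Consistency of the stiffness form\<close>

lemma a_form_cells:
  assumes u: "u \<in> Vh2 k P" and \<phi>: "\<phi> \<in> Vh2 k P"
  shows "a_form y u \<phi> = (\<Sum>j<cells P. len P j * integral {0..1} (\<lambda>s. (cderiv u j s \<bullet> cderiv \<phi> j s) / norm (cderiv y j s)))"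
proof -
  have "((\<lambda>\<rho>. (dd u \<rho> \<bullet> dd \<phi> \<rho>) / norm (dd y \<rho>)) has_integral
     (\<Sum>j<cells P. len P j *\<^sub>R integral {0..1} (\<lambda>s. (cderiv u j s \<bullet> cderiv \<phi> j s) / norm (cderiv y j s)))) {0..1}"
    using periodic1_dd[OF Vh2_periodic[OF u]] periodic1_dd[OF Vh2_periodic[OF \<phi>]] periodic1_dd[OF Vh2_periodic[OF y_Vh2]]
    by (intro has_integral_cells continuous_intros cderiv_continuous)
       (auto simp: periodic1_def Vh2_dd u \<phi> y_Vh2 cderiv_y_nz)
  then show ?thesis by (simp add: a_form_def integral_unique)
qed

lemma dd_continuous: "bounded_smooth m A f \<Longrightarrow> continuous_on S (\<lambda>s. dd f (loc j s))"
  using bounded_smooth_continuous[of m A f UNIV 1]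
  by (intro continuous_on_compose2[of UNIV "dd f" S "loc j"]) (auto simp: loc_def intro!: continuous_intros)

lemma loc_diff: "j < cells P \<Longrightarrow> 0 \<le> s \<Longrightarrow> s \<le> 1 \<Longrightarrow> \<bar>loc j s - pt P j\<bar> \<le> len P j"
  using len_pos[of j] mult_left_le[of s "len P j"] by (simp add: loc_def)

lemma dd_x_nz: "dd x \<rho> \<noteq> 0"
  using speed_ge[of \<rho>] c by auto

text \<open>The leading part \<open>L\<^bsup>k\<^esup> res_poly\<close> of the error is orthogonal to \<open>cderiv \<phi> j\<close>, whose components have degree below \<open>k\<close>.\<close>

lemma cell_orthogonality:
  assumes \<Psi>: "continuous_on {0..1} \<Psi>"
    and err: "\<And>s. 0 \<le> s \<Longrightarrow> s \<le> 1 \<Longrightarrow> norm (\<Psi> s - (\<theta> * poly res_poly s) *\<^sub>R \<gamma>) \<le> E"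
  shows "\<bar>integral {0..1} (\<lambda>s. \<Psi> s \<bullet> cderiv \<phi> j s)\<bar> \<le> E * integral {0..1} (\<lambda>s. norm (cderiv \<phi> j s))"
proof -
  define q where "q = (\<Sum>i\<in>UNIV. smult (\<gamma> $ i / len P j) (pderiv (cpoly \<phi> j i)))"
  have q: "\<gamma> \<bullet> cderiv \<phi> j s = poly q s" for s
    by (simp add: q_def cderiv_def inner_vec_def poly_sum sum_divide_distrib)
  have "degree (pderiv (cpoly \<phi> j i)) \<le> k - 1" for i
    using degree_cpoly[of \<phi> j i] by (simp add: degree_pderiv)
  then have "degree q \<le> k - 1"
    unfolding q_def by (intro degree_sum_le) (auto intro: order_trans[OF degree_smult_le])
  from res_poly_orthogonal[OF this] have zero: "integral {0..1} (\<lambda>s. \<theta> * (poly res_poly s * poly q s)) = 0"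
    by simp
  have "integral {0..1} (\<lambda>s. \<Psi> s \<bullet> cderiv \<phi> j s)
      = integral {0..1} (\<lambda>s. (\<Psi> s - (\<theta> * poly res_poly s) *\<^sub>R \<gamma>) \<bullet> cderiv \<phi> j s + \<theta> * (poly res_poly s * poly q s))"
    by (simp add: inner_diff_left q)
  also have "\<dots> = integral {0..1} (\<lambda>s. (\<Psi> s - (\<theta> * poly res_poly s) *\<^sub>R \<gamma>) \<bullet> cderiv \<phi> j s)"
    using zero
    by (subst integral_add) (auto intro!: integrable_continuous_real continuous_intros \<Psi> cderiv_continuous)
  also have "norm \<dots> \<le> integral {0..1} (\<lambda>s. E * norm (cderiv \<phi> j s))"
  proof (rule integral_norm_bound_integral)
    fix s :: real assume "s \<in> {0..1}"
    then show "norm ((\<Psi> s - (\<theta> * poly res_poly s) *\<^sub>R \<gamma>) \<bullet> cderiv \<phi> j s) \<le> E * norm (cderiv \<phi> j s)"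
      using err[of s] by (intro order_trans[OF Cauchy_Schwarz_ineq2[unfolded real_norm_def[symmetric]]] mult_right_mono) auto
  qed (intro integrable_continuous_real continuous_intros \<Psi> cderiv_continuous)+
  finally show ?thesis by simp
qed

text \<open>The summands bound, in this order, the quadratic remainder, the interpolation error
  beyond its leading part, and the freezing of coefficients at \<open>pt P j\<close>.\<close>

definition "K\<^sub>a = (2 / c\<^sup>2 + 3 * B / c ^ 3) * D\<^sup>2 + (C\<^sub>I * B / c + B * (C\<^sub>I * B) / c\<^sup>2)
  + \<Lambda> * (B * (B / c\<^sup>2 + B * (4 * B / c ^ 3 + 1 / c\<^sup>2)))"

text \<open>The derivative errors of x and X have the same scalar factor L^k
  \<open>res_poly\<close>(s). By linearity of \<open>ratio_deriv\<close> the leading error of the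
  flux is this factor times one vector, and freezing the base point at the left end makes that
  vector constant.\<close>

lemma flux_error:
  assumes j: "j < cells P"
  obtains \<gamma> where "\<And>s. 0 \<le> s \<Longrightarrow> s \<le> 1 \<Longrightarrow>
    norm ((1 / norm (cderiv y j s)) *\<^sub>R cderiv (interp k \<xi> P X) j s - (1 / norm (dd x (loc j s))) *\<^sub>R dd X (loc j s)
      - (len P j ^ k * poly res_poly s) *\<^sub>R \<gamma>) \<le> K\<^sub>a * len P j ^ (k + 1)"
proof -
  define L where "L = len P j"
  have L: "0 < L" unfolding L_def by (rule len_pos[OF j])
  note pow = len_powers[OF j, folded L_def]
  obtain dx where dx: "norm dx \<le> B" and ex: "\<And>s. 0 \<le> s \<Longrightarrow> s \<le> 1 \<Longrightarrow>
      norm (cderiv y j s - dd x (loc j s) - (L ^ k * poly res_poly s) *\<^sub>R dx) \<le> C\<^sub>I * B * L ^ (k + 1)"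
    "\<And>s. 0 \<le> s \<Longrightarrow> s \<le> 1 \<Longrightarrow> norm (cderiv y j s - dd x (loc j s)) \<le> D * L ^ k"
    using interp_cell_error[OF x j] unfolding L_def by blast
  obtain dX where dX: "norm dX \<le> B" and eX: "\<And>s. 0 \<le> s \<Longrightarrow> s \<le> 1 \<Longrightarrow>
      norm (cderiv (interp k \<xi> P X) j s - dd X (loc j s) - (L ^ k * poly res_poly s) *\<^sub>R dX) \<le> C\<^sub>I * B * L ^ (k + 1)"
    "\<And>s. 0 \<le> s \<Longrightarrow> s \<le> 1 \<Longrightarrow> norm (cderiv (interp k \<xi> P X) j s - dd X (loc j s)) \<le> D * L ^ k"
    using interp_cell_error[OF X j] unfolding L_def by blast
  define \<gamma> where "\<gamma> = ratio_deriv (dd X (pt P j)) (dd x (pt P j)) dX dx"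
  show ?thesis
  proof (rule that[of \<gamma>])
    fix s :: real assume s: "0 \<le> s" "s \<le> 1"
    define q p where "q = dd x (loc j s)" and "p = dd X (loc j s)"
    define d e where "d = cderiv y j s - q" and "e = cderiv (interp k \<xi> P X) j s - p"
    define \<theta> where "\<theta> = L ^ k * poly res_poly s"
    have bp: "norm p \<le> B" "norm (dd X (pt P j)) \<le> B"
      using bounded_smooth_bound[OF X, of 1] by (auto simp: p_def)
    have de: "norm d \<le> D * L ^ k" "norm e \<le> D * L ^ k"
      using ex(2) eX(2) s by (auto simp: d_def e_def q_def p_def)
    have \<theta>: "\<bar>\<theta>\<bar> \<le> L ^ k * \<Lambda>"
      unfolding \<theta>_def abs_mult using L \<Lambda>[of s] s by (intro mult_mono) auto
    have "norm ((1 / norm (q + d)) *\<^sub>R (p + e) - (1 / norm q) *\<^sub>R p - ratio_deriv p q e d)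
        \<le> 2 / c\<^sup>2 * (norm d * norm e) + 3 * B / c ^ 3 * (norm d)\<^sup>2"
      using speed_ge[of "loc j s"] de(1) pow(5) bp by (intro ratio_expansion c) (auto simp: q_def)
    also have "\<dots> \<le> 2 / c\<^sup>2 * ((D * L ^ k) * (D * L ^ k)) + 3 * B / c ^ 3 * (D * L ^ k)\<^sup>2"
      using de c B_nonneg D_nonneg L by (intro add_mono mult_left_mono mult_mono power_mono) auto
    also have "\<dots> = (2 / c\<^sup>2 + 3 * B / c ^ 3) * D\<^sup>2 * L ^ (2 * k)"
      by (simp add: power_mult_distrib power_mult[symmetric] distrib_right power2_eq_square[symmetric] mult.commute[of k])
    also have "\<dots> \<le> (2 / c\<^sup>2 + 3 * B / c ^ 3) * D\<^sup>2 * L ^ (k + 1)"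
      using pow(3) c B_nonneg by (intro mult_left_mono) auto
    finally have 1: "norm ((1 / norm (q + d)) *\<^sub>R (p + e) - (1 / norm q) *\<^sub>R p - ratio_deriv p q e d)
        \<le> (2 / c\<^sup>2 + 3 * B / c ^ 3) * D\<^sup>2 * L ^ (k + 1)" .
    have "norm (ratio_deriv p q (e - \<theta> *\<^sub>R dX) (d - \<theta> *\<^sub>R dx))
        \<le> norm (e - \<theta> *\<^sub>R dX) / c + B * norm (d - \<theta> *\<^sub>R dx) / c\<^sup>2"
      using speed_ge[of "loc j s"] bp by (intro ratio_deriv_bound c) (auto simp: q_def)
    also have "\<dots> \<le> (C\<^sub>I * B * L ^ (k + 1)) / c + B * (C\<^sub>I * B * L ^ (k + 1)) / c\<^sup>2"
      using ex(1)[OF s] eX(1)[OF s] c B_nonneg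
      by (intro add_mono divide_right_mono mult_left_mono) (auto simp: d_def e_def q_def p_def \<theta>_def)
    finally have 2: "norm (ratio_deriv p q (e - \<theta> *\<^sub>R dX) (d - \<theta> *\<^sub>R dx))
        \<le> (C\<^sub>I * B / c + B * (C\<^sub>I * B) / c\<^sup>2) * L ^ (k + 1)"
      by (simp add: algebra_simps)
    have "norm (ratio_deriv p q dX dx - \<gamma>) \<le> (B * L) * (norm dX / c\<^sup>2 + norm dx * (4 * B / c ^ 3 + 1 / c\<^sup>2))"
      unfolding \<gamma>_def
    proof (rule ratio_deriv_Lipschitz[OF c _ _ bp])
      have "B * \<bar>loc j s - pt P j\<bar> \<le> B * L" using loc_diff[OF j s] B_nonneg by (simp add: L_def mult_left_mono)
      then show "norm (p - dd X (pt P j)) \<le> B * L" "norm (q - dd x (pt P j)) \<le> B * L"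
        using bounded_smooth_Lipschitz[OF X, of 1 "loc j s" "pt P j"] bounded_smooth_Lipschitz[OF x, of 1 "loc j s" "pt P j"]
        by (auto simp: p_def q_def)
    qed (auto simp: q_def speed_ge)
    also have "\<dots> \<le> (B * L) * (B / c\<^sup>2 + B * (4 * B / c ^ 3 + 1 / c\<^sup>2))"
      using dx dX c B_nonneg L by (intro mult_left_mono add_mono divide_right_mono mult_right_mono) auto
    finally have "norm (\<theta> *\<^sub>R (ratio_deriv p q dX dx - \<gamma>))
        \<le> (L ^ k * \<Lambda>) * ((B * L) * (B / c\<^sup>2 + B * (4 * B / c ^ 3 + 1 / c\<^sup>2)))"
      using \<theta> L \<Lambda>_nonneg by (simp only: norm_scaleR) (intro mult_mono, auto)
    then have 3: "norm (\<theta> *\<^sub>R (ratio_deriv p q dX dx - \<gamma>))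
        \<le> \<Lambda> * (B * (B / c\<^sup>2 + B * (4 * B / c ^ 3 + 1 / c\<^sup>2))) * L ^ (k + 1)"
      by (simp add: mult_ac)
    have "ratio_deriv p q e d = ratio_deriv p q (e - \<theta> *\<^sub>R dX) (d - \<theta> *\<^sub>R dx) + \<theta> *\<^sub>R ratio_deriv p q dX dx"
      by (simp add: ratio_deriv_add[symmetric] ratio_deriv_scale[symmetric])
    then have "(1 / norm (q + d)) *\<^sub>R (p + e) - (1 / norm q) *\<^sub>R p - \<theta> *\<^sub>R \<gamma>
        = ((1 / norm (q + d)) *\<^sub>R (p + e) - (1 / norm q) *\<^sub>R p - ratio_deriv p q e d)
          + ratio_deriv p q (e - \<theta> *\<^sub>R dX) (d - \<theta> *\<^sub>R dx) + \<theta> *\<^sub>R (ratio_deriv p q dX dx - \<gamma>)"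
      by (simp add: scaleR_diff_right)
    also have "norm \<dots> \<le> (2 / c\<^sup>2 + 3 * B / c ^ 3) * D\<^sup>2 * L ^ (k + 1) + (C\<^sub>I * B / c + B * (C\<^sub>I * B) / c\<^sup>2) * L ^ (k + 1)
        + \<Lambda> * (B * (B / c\<^sup>2 + B * (4 * B / c ^ 3 + 1 / c\<^sup>2))) * L ^ (k + 1)"
      by (intro norm_triangle_le add_mono 1 2 3 order_trans[OF norm_triangle_ineq])
    also have "\<dots> = K\<^sub>a * L ^ (k + 1)" by (simp only: K\<^sub>a_def distrib_right)
    finally show "norm ((1 / norm (cderiv y j s)) *\<^sub>R cderiv (interp k \<xi> P X) j s - (1 / norm (dd x (loc j s))) *\<^sub>R dd X (loc j s)
      - (len P j ^ k * poly res_poly s) *\<^sub>R \<gamma>) \<le> K\<^sub>a * len P j ^ (k + 1)"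
      by (simp add: d_def e_def q_def p_def \<theta>_def L_def)
  qed
qed

lemma K\<^sub>a_nonneg: "0 \<le> K\<^sub>a"
  unfolding K\<^sub>a_def using c B_nonneg C\<^sub>I \<Lambda>_nonneg by (intro add_nonneg_nonneg mult_nonneg_nonneg) auto

lemma a_consistency:
  assumes \<phi>: "\<phi> \<in> Vh2 k P"
  shows "\<bar>a_form y (interp k \<xi> P X) \<phi> - integral {0..1} (\<lambda>\<rho>. (dd X \<rho> \<bullet> dd \<phi> \<rho>) / norm (dd x \<rho>))\<bar>
    \<le> K\<^sub>a * h ^ (k + 1) * H1_norm \<phi>"
proof -
  define \<Psi> where "\<Psi> = (\<lambda>j s. (1 / norm (cderiv y j s)) *\<^sub>R cderiv (interp k \<xi> P X) j s - (1 / norm (dd x (loc j s))) *\<^sub>R dd X (loc j s))"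
  note cont = continuous_intros cderiv_continuous dd_continuous[OF x] dd_continuous[OF X]
  have "((\<lambda>\<rho>. (dd X \<rho> \<bullet> dd \<phi> \<rho>) / norm (dd x \<rho>)) has_integral
     (\<Sum>j<cells P. len P j *\<^sub>R integral {0..1} (\<lambda>s. (dd X (loc j s) \<bullet> cderiv \<phi> j s) / norm (dd x (loc j s))))) {0..1}"
    using periodic1_dd[OF bounded_smooth_periodic[OF X]] periodic1_dd[OF Vh2_periodic[OF \<phi>]] periodic1_dd[OF bounded_smooth_periodic[OF x]]
    by (intro has_integral_cells cont) (auto simp: periodic1_def Vh2_dd \<phi> dd_x_nz)
  then have "a_form y (interp k \<xi> P X) \<phi> - integral {0..1} (\<lambda>\<rho>. (dd X \<rho> \<bullet> dd \<phi> \<rho>) / norm (dd x \<rho>))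
      = (\<Sum>j<cells P. len P j * (integral {0..1} (\<lambda>s. (cderiv (interp k \<xi> P X) j s \<bullet> cderiv \<phi> j s) / norm (cderiv y j s))
        - integral {0..1} (\<lambda>s. (dd X (loc j s) \<bullet> cderiv \<phi> j s) / norm (dd x (loc j s)))))"
    by (simp add: a_form_cells Z_Vh2 \<phi> integral_unique right_diff_distrib sum_subtractf)
  also have "\<dots> = (\<Sum>j<cells P. len P j * integral {0..1} (\<lambda>s. \<Psi> j s \<bullet> cderiv \<phi> j s))"
  proof (intro sum.cong refl arg_cong2[of _ _ _ _ "(*)"])
    fix j assume "j \<in> {..<cells P}"
    then have j: "j < cells P" by simp
    show "integral {0..1} (\<lambda>s. (cderiv (interp k \<xi> P X) j s \<bullet> cderiv \<phi> j s) / norm (cderiv y j s))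
        - integral {0..1} (\<lambda>s. (dd X (loc j s) \<bullet> cderiv \<phi> j s) / norm (dd x (loc j s)))
        = integral {0..1} (\<lambda>s. \<Psi> j s \<bullet> cderiv \<phi> j s)"
      using cderiv_y_nz[OF j] dd_x_nz unfolding \<Psi>_def inner_diff_left inner_scaleR_left
      by (subst integral_diff[symmetric]) (auto intro!: integrable_continuous_real cont)
  qed
  finally have eq: "a_form y (interp k \<xi> P X) \<phi> - integral {0..1} (\<lambda>\<rho>. (dd X \<rho> \<bullet> dd \<phi> \<rho>) / norm (dd x \<rho>))
      = (\<Sum>j<cells P. len P j * integral {0..1} (\<lambda>s. \<Psi> j s \<bullet> cderiv \<phi> j s))" .
  have "\<bar>\<Sum>j<cells P. len P j * integral {0..1} (\<lambda>s. \<Psi> j s \<bullet> cderiv \<phi> j s)\<bar> \<le> (\<Sum>j<cells P. K\<^sub>a * h ^ (k + 1) * cvar \<phi> j)"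
  proof (intro order_trans[OF sum_abs] sum_mono)
    fix j assume "j \<in> {..<cells P}"
    then have j: "j < cells P" by simp
    obtain \<gamma> where \<gamma>: "\<And>s. 0 \<le> s \<Longrightarrow> s \<le> 1 \<Longrightarrow> norm (\<Psi> j s - (len P j ^ k * poly res_poly s) *\<^sub>R \<gamma>) \<le> K\<^sub>a * len P j ^ (k + 1)"
      using flux_error[OF j] unfolding \<Psi>_def by blast
    have "continuous_on {0..1} (\<Psi> j)"
      unfolding \<Psi>_def using cderiv_y_nz[OF j] dd_x_nz by (intro cont) auto
    from cell_orthogonality[OF this \<gamma>]
    have "\<bar>integral {0..1} (\<lambda>s. \<Psi> j s \<bullet> cderiv \<phi> j s)\<bar> \<le> K\<^sub>a * len P j ^ (k + 1) * integral {0..1} (\<lambda>s. norm (cderiv \<phi> j s))"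
      by simp
    then have "\<bar>len P j * integral {0..1} (\<lambda>s. \<Psi> j s \<bullet> cderiv \<phi> j s)\<bar> \<le> K\<^sub>a * len P j ^ (k + 1) * cvar \<phi> j"
      using len_pos[OF j] by (simp add: abs_mult cvar_def mult_ac)
    also have "\<dots> \<le> K\<^sub>a * h ^ (k + 1) * cvar \<phi> j"
      using len_powers(4)[OF j] K\<^sub>a_nonneg cvar_nonneg[OF j] by (intro mult_right_mono mult_left_mono)
    finally show "\<bar>len P j * integral {0..1} (\<lambda>s. \<Psi> j s \<bullet> cderiv \<phi> j s)\<bar> \<le> K\<^sub>a * h ^ (k + 1) * cvar \<phi> j" .
  qed
  also have "\<dots> \<le> K\<^sub>a * h ^ (k + 1) * H1_norm \<phi>"
    unfolding sum_distrib_left[symmetric]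
    using sum_cvar[OF \<phi>] K\<^sub>a_nonneg mesh_size_pos by (intro mult_left_mono) auto
  finally show ?thesis unfolding eq .
qed

section \<open>Consistency of the lumped form\<close>

definition nodal_err :: "nat \<Rightarrow> nat \<Rightarrow> plane" where
  "nodal_err j l = cderiv y j (\<xi> l) - dd x (loc j (\<xi> l))"

definition unit_tangent :: "real \<Rightarrow> plane" where
  "unit_tangent \<rho> = (1 / norm (dd x \<rho>)) *\<^sub>R dd x \<rho>"

lemma norm_unit_tangent: "norm (unit_tangent \<rho>) = 1"
  using dd_x_nz[of \<rho>] by (simp add: unit_tangent_def)

lemma norm_nodal_err:
  assumes "j < cells P" "l \<le> k" shows "norm (nodal_err j l) \<le> D * len P j ^ k"
  using interp_cell_error[OF x assms(1)] xi_bounds[OF assms(2)] unfolding nodal_err_def by metis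

lemma z_inner: "z \<rho> \<bullet> a = (v \<rho> \<bullet> J (dd x \<rho>)) * (a \<bullet> J (dd x \<rho>)) / norm (dd x \<rho>)"
  by (simp add: z_eq inner_commute)

lemma incident_elem_deriv:
  assumes "(j, l) \<in> incident k \<xi> P \<rho>"
  shows "elem_deriv \<xi> P y j l = dd x \<rho> + nodal_err j l"
proof -
  have "j < cells P" "l \<le> k" using assms by (auto simp: incident_def)
  then show ?thesis
    using elem_deriv_eq[OF y_Vh2] incident_value[OF periodic1_dd[OF bounded_smooth_periodic[OF x]] assms]
    by (simp add: nodal_err_def)
qed

text \<open>The share of one element in the linearized lumped form: the quadrature term of the limit
  integrand plus the first-order effect of the error in the normal. At a vertex it involves no data
  of the neighbouring element.\<close>

definition lumped :: "(real \<Rightarrow> plane) \<Rightarrow> nat \<Rightarrow> nat \<Rightarrow> real" where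
  "lumped \<phi> j l = len P j * w l * (z (loc j (\<xi> l)) \<bullet> \<phi> (loc j (\<xi> l))
     + \<phi> (loc j (\<xi> l)) \<bullet> proj_deriv (unit_tangent (loc j (\<xi> l))) (v (loc j (\<xi> l))) (nodal_err j l))"

text \<open>An instance of \<open>nodal_expansion\<close> over the pairs incident to the node. Since
  the averaged normal is J Q / \<mu>, the summand of the lumped form is precisely the quotient
  expanded there.\<close>

lemma node_consistency:
  assumes \<phi>: "\<phi> \<in> Vh2 k P" and \<rho>: "\<rho> \<in> nodes k \<xi> P"
  shows "\<bar>mu k \<xi> w P y \<rho> * (v \<rho> \<bullet> omega k \<xi> w P y \<rho>) * (\<phi> \<rho> \<bullet> omega k \<xi> w P y \<rho>)
      - (\<Sum>(j, l)\<in>incident k \<xi> P \<rho>. lumped \<phi> j l)\<bar>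
    \<le> (\<Sum>(j, l)\<in>incident k \<xi> P \<rho>. len P j * w l * (11 / c * D\<^sup>2 * h ^ (k + 1) * (B * (2 * H1_norm \<phi>))))"
proof -
  define I where "I = incident k \<xi> P \<rho>"
  define W where "W = (\<lambda>p. len P (fst p) * w (snd p))"
  define d where "d = (\<lambda>p. nodal_err (fst p) (snd p))"
  define q where "q = dd x \<rho>"
  define \<mu> where "\<mu> = (\<Sum>p\<in>I. W p * norm (q + d p))"
  define Q where "Q = (\<Sum>p\<in>I. W p *\<^sub>R (q + d p))"
  have inI: "fst p < cells P" "snd p \<le> k" if "p \<in> I" for p
    using that by (auto simp: I_def incident_def)
  have "finite I"
    unfolding I_def by (rule finite_subset[of _ "{..<cells P} \<times> {..k}"]) (auto simp: incident_def)
  moreover have "I \<noteq> {}" using incident_nonempty[OF \<rho>] by (simp add: I_def)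
  moreover have W: "0 < W p" if "p \<in> I" for p
    using len_pos w_pos inI[OF that] by (simp add: W_def)
  moreover have "norm (d p) \<le> c / 2" if "p \<in> I" for p
    using norm_nodal_err len_powers(5) inI[OF that] order_trans unfolding d_def by blast
  ultimately have exp: "\<bar>(v \<rho> \<bullet> J Q) * (\<phi> \<rho> \<bullet> J Q) / \<mu>
      - (\<Sum>p\<in>I. W p * ((v \<rho> \<bullet> J q) * (\<phi> \<rho> \<bullet> J q) / norm q + \<phi> \<rho> \<bullet> proj_deriv ((1 / norm q) *\<^sub>R q) (v \<rho>) (d p)))\<bar>
    \<le> 11 / c * (\<Sum>p\<in>I. W p * (norm (d p))\<^sup>2) * (norm (v \<rho>) * norm (\<phi> \<rho>))"
    unfolding \<mu>_def Q_def by (intro nodal_expansion c) (auto simp: q_def speed_ge)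
  have mu: "mu k \<xi> w P y \<rho> = \<mu>"
    unfolding mu_def \<mu>_def I_def
    by (intro sum.cong refl) (auto simp: W_def d_def q_def incident_elem_deriv)
  have "(\<Sum>(j, l)\<in>I. (len P j * w l) *\<^sub>R J (elem_deriv \<xi> P y j l)) = J Q"
    unfolding Q_def J_sum I_def
    by (intro sum.cong refl) (auto simp: W_def d_def q_def incident_elem_deriv J_scale)
  then have om: "omega k \<xi> w P y \<rho> = (1 / \<mu>) *\<^sub>R J Q"
    by (simp add: omega_def mu I_def)
  have "mu k \<xi> w P y \<rho> * (v \<rho> \<bullet> omega k \<xi> w P y \<rho>) * (\<phi> \<rho> \<bullet> omega k \<xi> w P y \<rho>) = (v \<rho> \<bullet> J Q) * (\<phi> \<rho> \<bullet> J Q) / \<mu>"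
    by (cases "\<mu> = 0") (simp_all add: mu om)
  moreover have "(\<Sum>(j, l)\<in>incident k \<xi> P \<rho>. lumped \<phi> j l)
      = (\<Sum>p\<in>I. W p * ((v \<rho> \<bullet> J q) * (\<phi> \<rho> \<bullet> J q) / norm q + \<phi> \<rho> \<bullet> proj_deriv ((1 / norm q) *\<^sub>R q) (v \<rho>) (d p)))"
    unfolding I_def
  proof (intro sum.cong refl, clarify)
    fix j l assume jl: "(j, l) \<in> incident k \<xi> P \<rho>"
    show "lumped \<phi> j l = W (j, l) * ((v \<rho> \<bullet> J q) * (\<phi> \<rho> \<bullet> J q) / norm q
        + \<phi> \<rho> \<bullet> proj_deriv ((1 / norm q) *\<^sub>R q) (v \<rho>) (d (j, l)))"
      using incident_value[OF bounded_smooth_periodic[OF v] jl] incident_value[OF Vh2_periodic[OF \<phi>] jl]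
        incident_value[OF periodic1_dd[OF bounded_smooth_periodic[OF x]] jl]
      by (simp add: lumped_def W_def d_def q_def z_inner unit_tangent_def)
  qed
  ultimately have "\<bar>mu k \<xi> w P y \<rho> * (v \<rho> \<bullet> omega k \<xi> w P y \<rho>) * (\<phi> \<rho> \<bullet> omega k \<xi> w P y \<rho>)
      - (\<Sum>(j, l)\<in>incident k \<xi> P \<rho>. lumped \<phi> j l)\<bar> \<le> 11 / c * (\<Sum>p\<in>I. W p * (norm (d p))\<^sup>2) * (norm (v \<rho>) * norm (\<phi> \<rho>))"
    using exp by simp
  also have "\<dots> \<le> 11 / c * (\<Sum>p\<in>I. W p * (D\<^sup>2 * h ^ (k + 1))) * (B * (2 * H1_norm \<phi>))"
  proof (intro mult_mono mult_left_mono sum_mono)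
    fix p assume p: "p \<in> I"
    have "(norm (d p))\<^sup>2 \<le> (D * len P (fst p) ^ k)\<^sup>2"
      using norm_nodal_err inI[OF p] by (intro power_mono) (auto simp: d_def)
    also have "\<dots> = D\<^sup>2 * len P (fst p) ^ (2 * k)"
      by (simp add: power_mult_distrib power_mult[symmetric] mult.commute[of k])
    also have "\<dots> \<le> D\<^sup>2 * h ^ (k + 1)"
      using len_powers(3,4)[OF inI(1)[OF p]] by (intro mult_left_mono) auto
    finally show "(norm (d p))\<^sup>2 \<le> D\<^sup>2 * h ^ (k + 1)" .
    show "0 \<le> W p" using W[OF p] by simp
  next
    show "norm (v \<rho>) \<le> B" using bounded_smooth_bound[OF v, of 0 \<rho>] by simp
    show "norm (\<phi> \<rho>) \<le> 2 * H1_norm \<phi>" by (rule H1_norm_sup[OF Vh2_H1[OF \<phi>]])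
    show "0 \<le> 11 / c * (\<Sum>p\<in>I. W p * (D\<^sup>2 * h ^ (k + 1)))"
      using W c mesh_size_pos by (intro mult_nonneg_nonneg sum_nonneg) (auto intro: less_imp_le)
  qed (use B_nonneg c W in \<open>auto intro!: sum_nonneg simp: less_imp_le\<close>)
  also have "\<dots> = (\<Sum>(j, l)\<in>I. len P j * w l * (11 / c * D\<^sup>2 * h ^ (k + 1) * (B * (2 * H1_norm \<phi>))))"
    by (simp add: sum_distrib_left sum_distrib_right W_def case_prod_unfold mult_ac)
  finally show ?thesis unfolding I_def .
qed

text \<open>Componentwise \<open>quadrature_error\<close>, with the sup norm bound for \<phi> at the
  left end and \<open>cvar\<close> for its variation. Summing two components turns 2 into 4.\<close>

lemma quadrature_cell:
  assumes \<phi>: "\<phi> \<in> Vh2 k P" and j: "j < cells P"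
  shows "\<bar>(\<Sum>l\<le>k. w l * (z (loc j (\<xi> l)) \<bullet> \<phi> (loc j (\<xi> l)))) - integral {0..1} (\<lambda>s. z (loc j s) \<bullet> \<phi> (loc j s))\<bar>
    \<le> 4 * (len P j ^ (k + 1) * B * (2 * H1_norm \<phi>) + len P j ^ k * B * cvar \<phi> j)"
proof -
  define L where "L = len P j"
  have L: "0 < L" unfolding L_def by (rule len_pos[OF j])
  have cz: "continuous_on {0..1} (\<lambda>s. z (loc j s) $ i)" for i
    using bounded_smooth_continuous[OF z, of UNIV 0]
    by (intro continuous_on_component continuous_on_compose2[of UNIV z _ "loc j"])
       (auto simp: loc_def intro!: continuous_intros)
  define e where "e = (\<lambda>i. (\<Sum>l\<le>k. w l * (z (loc j (\<xi> l)) $ i * poly (cpoly \<phi> j i) (\<xi> l)))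
      - integral {0..1} (\<lambda>s. z (loc j s) $ i * poly (cpoly \<phi> j i) s))"
  have inner: "z (loc j s) \<bullet> \<phi> (loc j s) = (\<Sum>i\<in>UNIV. z (loc j s) $ i * poly (cpoly \<phi> j i) s)" if "0 \<le> s" "s \<le> 1" for s
    using Vh2_cpoly[OF \<phi> j that] by (simp add: inner_vec_def)
  have "(\<Sum>l\<le>k. w l * (z (loc j (\<xi> l)) \<bullet> \<phi> (loc j (\<xi> l)))) = (\<Sum>l\<le>k. w l * (\<Sum>i\<in>UNIV. z (loc j (\<xi> l)) $ i * poly (cpoly \<phi> j i) (\<xi> l)))"
    using xi_bounds inner by (intro sum.cong) auto
  also have "\<dots> = (\<Sum>i\<in>UNIV. \<Sum>l\<le>k. w l * (z (loc j (\<xi> l)) $ i * poly (cpoly \<phi> j i) (\<xi> l)))"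
    unfolding sum_distrib_left by (rule sum.swap)
  finally have 1: "(\<Sum>l\<le>k. w l * (z (loc j (\<xi> l)) \<bullet> \<phi> (loc j (\<xi> l))))
      = (\<Sum>i\<in>UNIV. \<Sum>l\<le>k. w l * (z (loc j (\<xi> l)) $ i * poly (cpoly \<phi> j i) (\<xi> l)))" .
  have "integral {0..1} (\<lambda>s. z (loc j s) \<bullet> \<phi> (loc j s)) = integral {0..1} (\<lambda>s. \<Sum>i\<in>UNIV. z (loc j s) $ i * poly (cpoly \<phi> j i) s)"
    by (intro integral_cong) (simp add: inner)
  also have "\<dots> = (\<Sum>i\<in>UNIV. integral {0..1} (\<lambda>s. z (loc j s) $ i * poly (cpoly \<phi> j i) s))"
    by (intro integral_sum integrable_continuous_real continuous_intros cz) auto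
  finally have eq: "(\<Sum>l\<le>k. w l * (z (loc j (\<xi> l)) \<bullet> \<phi> (loc j (\<xi> l)))) - integral {0..1} (\<lambda>s. z (loc j s) \<bullet> \<phi> (loc j s)) = (\<Sum>i\<in>UNIV. e i)"
    unfolding 1 e_def by (simp add: sum_subtractf)
  have "\<bar>e i\<bar> \<le> 2 * ((L ^ (k + 1) * B) * (2 * H1_norm \<phi>)) + 2 * ((L ^ k * B) * cvar \<phi> j)" for i
  proof -
    define g where "g = (\<lambda>m s. L ^ m * ((dd ^^ m) z (pt P j + L * s) $ i))"
    have gb: "\<bar>g m s\<bar> \<le> L ^ m * B" if "m \<le> k + 1" for m s
    proof -
      have "\<bar>(dd ^^ m) z (pt P j + L * s) $ i\<bar> \<le> B"
        using component_le_norm_cart bounded_smooth_bound[OF z that] order_trans by blast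
      then show ?thesis using L by (simp add: g_def abs_mult)
    qed
    have p: "poly (cpoly \<phi> j i) s = \<phi> (loc j s) $ i" if "0 \<le> s" "s \<le> 1" for s
      using Vh2_cpoly[OF \<phi> j that] by simp
    have g0: "g 0 s = z (loc j s) $ i" for s by (simp add: g_def loc_def L_def)
    have "\<bar>(\<Sum>l\<le>k. w l * (g 0 (\<xi> l) * poly (cpoly \<phi> j i) (\<xi> l))) - integral {0..1} (\<lambda>s. g 0 s * poly (cpoly \<phi> j i) s)\<bar>
      \<le> 2 * ((L ^ (k + 1) * B) * (2 * H1_norm \<phi>)) + 2 * ((L ^ k * B) * cvar \<phi> j)"
    proof (rule quadrature_error)
      show "(g m has_real_derivative g (Suc m) s) (at s)" for m s
        unfolding g_def by (rule bounded_smooth_pullback[OF z])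
      show "\<bar>poly (cpoly \<phi> j i) 0\<bar> \<le> 2 * H1_norm \<phi>"
        using p[of 0] component_le_norm_cart H1_norm_sup[OF Vh2_H1[OF \<phi>]] order_trans by fastforce
      show "\<bar>poly (cpoly \<phi> j i) s - poly (cpoly \<phi> j i) 0\<bar> \<le> cvar \<phi> j" if "0 \<le> s" "s \<le> 1" for s
        using p[OF that] p[of 0] component_le_norm_cart[of "\<phi> (loc j s) - \<phi> (pt P j)" i] Vh2_cell_increment[OF \<phi> j that]
        by (simp add: loc_0 cvar_def)
    qed (use gb[of k] gb[of "k + 1"] degree_cpoly in auto)
    then show ?thesis by (simp only: g0 e_def)
  qed
  then have "\<bar>\<Sum>i\<in>UNIV. e i\<bar> \<le> (\<Sum>i\<in>(UNIV :: 2 set). 2 * ((L ^ (k + 1) * B) * (2 * H1_norm \<phi>)) + 2 * ((L ^ k * B) * cvar \<phi> j))"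
    by (intro order_trans[OF sum_abs] sum_mono)
  then show ?thesis unfolding eq by (simp add: L_def)
qed

text \<open>The linear part of the normals' error: with coefficients frozen at \<open>pt P j\<close> it vanishes, since the quadrature rule
  annihilates \<open>res_poly\<close>.\<close>

lemma projection_cell:
  assumes \<phi>: "\<phi> \<in> Vh2 k P" and j: "j < cells P"
  shows "\<bar>\<Sum>l\<le>k. w l * (\<phi> (loc j (\<xi> l)) \<bullet> proj_deriv (unit_tangent (loc j (\<xi> l))) (v (loc j (\<xi> l))) (nodal_err j l))\<bar>
    \<le> len P j ^ (k + 1) * (2 * H1_norm \<phi>) * (3 * B\<^sup>2 * C\<^sub>I + \<Lambda> * B * (3 * B + 10 * B\<^sup>2 / c))
      + len P j ^ k * cvar \<phi> j * (3 * \<Lambda> * B\<^sup>2)"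
proof -
  define L where "L = len P j"
  define H where "H = 2 * H1_norm \<phi>"
  have L: "0 < L" unfolding L_def by (rule len_pos[OF j])
  obtain d where d: "norm d \<le> B" and ed: "\<And>s. 0 \<le> s \<Longrightarrow> s \<le> 1 \<Longrightarrow>
      norm (cderiv y j s - dd x (loc j s) - (L ^ k * poly res_poly s) *\<^sub>R d) \<le> C\<^sub>I * B * L ^ (k + 1)"
  proof (rule interp_cell_error[OF x j, folded L_def])
    fix d
    assume "norm d \<le> B" "\<And>s. 0 \<le> s \<Longrightarrow> s \<le> 1 \<Longrightarrow>
      norm (cderiv y j s - dd x (loc j s) - (L ^ k * poly res_poly s) *\<^sub>R d) \<le> C\<^sub>I * B * L ^ (k + 1)"
    then show thesis by (rule that)
  qed
  have sup: "norm (\<phi> \<rho>) \<le> H" for \<rho> unfolding H_def by (rule H1_norm_sup[OF Vh2_H1[OF \<phi>]])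
  have H: "0 \<le> H" using order_trans[OF norm_ge_zero sup[of 0]] .
  have vB: "norm (v \<rho>) \<le> B" for \<rho> using bounded_smooth_bound[OF v, of 0 \<rho>] by simp
  define \<pi> where "\<pi> = (\<lambda>l a. proj_deriv (unit_tangent (loc j (\<xi> l))) (v (loc j (\<xi> l))) a)"
  define \<pi>0 where "\<pi>0 = proj_deriv (unit_tangent (pt P j)) (v (pt P j)) d"
  define R where "R = (\<lambda>l. \<phi> (loc j (\<xi> l)) \<bullet> \<pi> l (nodal_err j l) - (L ^ k * poly res_poly (\<xi> l)) * (\<phi> (pt P j) \<bullet> \<pi>0))"
  define M where "M = L ^ (k + 1) * H * (3 * B\<^sup>2 * C\<^sub>I + \<Lambda> * B * (3 * B + 10 * B\<^sup>2 / c)) + L ^ k * cvar \<phi> j * (3 * \<Lambda> * B\<^sup>2)"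
  have R: "\<bar>R l\<bar> \<le> M" if l: "l \<le> k" for l
  proof -
    define \<theta> where "\<theta> = L ^ k * poly res_poly (\<xi> l)"
    define r where "r = nodal_err j l - \<theta> *\<^sub>R d"
    define \<phi>l where "\<phi>l = \<phi> (loc j (\<xi> l))"
    have xi: "0 \<le> \<xi> l" "\<xi> l \<le> 1" using xi_bounds[OF l] by auto
    have \<theta>: "\<bar>\<theta>\<bar> \<le> L ^ k * \<Lambda>"
      unfolding \<theta>_def abs_mult using L \<Lambda>[of "\<xi> l"] xi by (intro mult_mono) auto
    have r: "norm r \<le> C\<^sub>I * B * L ^ (k + 1)" using ed[OF xi] by (simp add: r_def nodal_err_def \<theta>_def)
    have \<pi>b: "norm (\<pi> l a) \<le> 3 * (B * norm a)" for a
      unfolding \<pi>_def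
      by (rule order_trans[OF proj_deriv_bound[OF norm_unit_tangent]]) (use vB in \<open>auto intro!: mult_right_mono\<close>)
    have BL: "B * \<bar>loc j (\<xi> l) - pt P j\<bar> \<le> B * L"
      using loc_diff[OF j xi] B_nonneg by (simp add: L_def mult_left_mono)
    have dv: "norm (v (loc j (\<xi> l)) - v (pt P j)) \<le> B * L"
      using bounded_smooth_Lipschitz[OF v, of 0 "loc j (\<xi> l)" "pt P j"] BL by simp
    have dq: "norm (dd x (loc j (\<xi> l)) - dd x (pt P j)) \<le> B * L"
      using bounded_smooth_Lipschitz[OF x, of 1 "loc j (\<xi> l)" "pt P j"] BL by simp
    have du: "norm (unit_tangent (loc j (\<xi> l)) - unit_tangent (pt P j)) \<le> 2 * (B * L) / c"
      unfolding unit_tangent_def using c dq speed_ge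
      by (intro order_trans[OF unit_vector_diff[of c]]) (auto intro!: divide_right_mono)
    have "norm (\<pi> l d - \<pi>0) \<le> norm d * (3 * norm (v (loc j (\<xi> l)) - v (pt P j))
        + 5 * (norm (v (pt P j)) * norm (unit_tangent (loc j (\<xi> l)) - unit_tangent (pt P j))))"
      unfolding \<pi>_def \<pi>0_def by (intro proj_deriv_Lipschitz norm_unit_tangent)
    also have "\<dots> \<le> B * (3 * (B * L) + 5 * (B * (2 * (B * L) / c)))"
      using B_nonneg L c by (intro mult_mono add_mono d dv du vB mult_left_mono) auto
    finally have \<pi>d: "norm (\<pi> l d - \<pi>0) \<le> B * (3 * B + 10 * B\<^sup>2 / c) * L"
      by (simp add: algebra_simps power2_eq_square)
    \<comment> \<open>The three terms are the interpolation error beyond its leading part, the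
      variation of \<phi>, and the variation of tangent and velocity.\<close>
    have "R l = \<phi>l \<bullet> \<pi> l r + \<theta> * ((\<phi>l - \<phi> (pt P j)) \<bullet> \<pi> l d) + \<theta> * (\<phi> (pt P j) \<bullet> (\<pi> l d - \<pi>0))"
    proof -
      have "\<pi> l (nodal_err j l) = \<pi> l r + \<theta> *\<^sub>R \<pi> l d"
        by (simp add: \<pi>_def r_def proj_deriv_add[symmetric] proj_deriv_scale[symmetric])
      then show ?thesis
        by (simp add: R_def \<phi>l_def \<theta>_def inner_add_right inner_diff_right inner_diff_left algebra_simps)
    qed
    also have "\<bar>\<dots>\<bar> \<le> \<bar>\<phi>l \<bullet> \<pi> l r\<bar> + \<bar>\<theta>\<bar> * \<bar>(\<phi>l - \<phi> (pt P j)) \<bullet> \<pi> l d\<bar> + \<bar>\<theta>\<bar> * \<bar>\<phi> (pt P j) \<bullet> (\<pi> l d - \<pi>0)\<bar>"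
      unfolding abs_mult[symmetric] by linarith
    also have "\<dots> \<le> H * (3 * (B * (C\<^sub>I * B * L ^ (k + 1)))) + (L ^ k * \<Lambda>) * (cvar \<phi> j * (3 * (B * B)))
        + (L ^ k * \<Lambda>) * (H * (B * (3 * B + 10 * B\<^sup>2 / c) * L))"
    proof (intro add_mono mult_mono \<theta>)
      have "norm (\<pi> l r) \<le> 3 * (B * (C\<^sub>I * B * L ^ (k + 1)))"
        by (rule order_trans[OF \<pi>b]) (use r B_nonneg in \<open>auto intro!: mult_left_mono\<close>)
      then show "\<bar>\<phi>l \<bullet> \<pi> l r\<bar> \<le> H * (3 * (B * (C\<^sub>I * B * L ^ (k + 1))))"
        using sup[of "loc j (\<xi> l)"] H
        by (intro order_trans[OF Cauchy_Schwarz_ineq2] mult_mono) (auto simp: \<phi>l_def)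
      have "norm (\<phi>l - \<phi> (pt P j)) \<le> cvar \<phi> j"
        using Vh2_cell_increment[OF \<phi> j xi] by (simp add: \<phi>l_def cvar_def)
      moreover have "norm (\<pi> l d) \<le> 3 * (B * B)"
        by (rule order_trans[OF \<pi>b]) (use d B_nonneg in \<open>auto intro!: mult_left_mono\<close>)
      ultimately show "\<bar>(\<phi>l - \<phi> (pt P j)) \<bullet> \<pi> l d\<bar> \<le> cvar \<phi> j * (3 * (B * B))"
        using cvar_nonneg[OF j] by (intro order_trans[OF Cauchy_Schwarz_ineq2] mult_mono) auto
      show "\<bar>\<phi> (pt P j) \<bullet> (\<pi> l d - \<pi>0)\<bar> \<le> H * (B * (3 * B + 10 * B\<^sup>2 / c) * L)"
        using sup[of "pt P j"] \<pi>d H by (intro order_trans[OF Cauchy_Schwarz_ineq2] mult_mono) auto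
    qed (use L \<Lambda>_nonneg in auto)
    also have "\<dots> = M" by (simp add: M_def algebra_simps power2_eq_square)
    finally show ?thesis .
  qed
  have "(\<Sum>l\<le>k. w l * (\<phi> (loc j (\<xi> l)) \<bullet> \<pi> l (nodal_err j l)))
      = (\<Sum>l\<le>k. w l * R l) + (\<Sum>l\<le>k. w l * ((L ^ k * poly res_poly (\<xi> l)) * (\<phi> (pt P j) \<bullet> \<pi>0)))"
    by (simp add: R_def right_diff_distrib sum_subtractf)
  also have "(\<Sum>l\<le>k. w l * ((L ^ k * poly res_poly (\<xi> l)) * (\<phi> (pt P j) \<bullet> \<pi>0)))
      = (L ^ k * (\<phi> (pt P j) \<bullet> \<pi>0)) * (\<Sum>l\<le>k. w l * poly res_poly (\<xi> l))"
    by (simp add: sum_distrib_left mult_ac)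
  finally have "\<bar>\<Sum>l\<le>k. w l * (\<phi> (loc j (\<xi> l)) \<bullet> \<pi> l (nodal_err j l))\<bar> = \<bar>\<Sum>l\<le>k. w l * R l\<bar>"
    by (simp add: res_poly_quadrature)
  also have "\<dots> \<le> (\<Sum>l\<le>k. w l * M)"
    using w_pos R by (intro order_trans[OF sum_abs] sum_mono) (auto simp: abs_mult abs_of_pos)
  also have "\<dots> = M" using sum_w by (simp add: sum_distrib_right[symmetric])
  finally show ?thesis by (simp add: \<pi>_def M_def L_def H_def)
qed

text \<open>In this order: the quadratic remainder at the nodes, the quadrature error, and the
  linear effect of the error in the normals.\<close>

definition "K\<^sub>b = 22 / c * D\<^sup>2 * B + 12 * B + (2 * (3 * B\<^sup>2 * C\<^sub>I + \<Lambda> * B * (3 * B + 10 * B\<^sup>2 / c)) + 3 * \<Lambda> * B\<^sup>2)"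

lemma K\<^sub>b_nonneg: "0 \<le> K\<^sub>b"
  unfolding K\<^sub>b_def using c B_nonneg C\<^sub>I \<Lambda>_nonneg by (intro add_nonneg_nonneg mult_nonneg_nonneg) auto

lemma b_consistency:
  assumes \<phi>: "\<phi> \<in> Vh2 k P"
  shows "\<bar>b_form k \<xi> w P y v \<phi> - integral {0..1} (\<lambda>\<rho>. z \<rho> \<bullet> \<phi> \<rho>)\<bar> \<le> K\<^sub>b * h ^ (k + 1) * H1_norm \<phi>"
proof -
  define H where "H = H1_norm \<phi>"
  have H: "0 \<le> H" unfolding H_def by (rule H1_norm_nonneg[OF Vh2_H1[OF \<phi>]])
  define G where "G = 11 / c * D\<^sup>2 * h ^ (k + 1) * (B * (2 * H))"
  define Z where "Z = (\<lambda>j. (\<Sum>l\<le>k. w l * (z (loc j (\<xi> l)) \<bullet> \<phi> (loc j (\<xi> l)))) - integral {0..1} (\<lambda>s. z (loc j s) \<bullet> \<phi> (loc j s)))"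
  define Y where "Y = (\<lambda>j. \<Sum>l\<le>k. w l * (\<phi> (loc j (\<xi> l)) \<bullet> proj_deriv (unit_tangent (loc j (\<xi> l))) (v (loc j (\<xi> l))) (nodal_err j l)))"
  have "\<bar>b_form k \<xi> w P y v \<phi> - (\<Sum>\<rho>\<in>nodes k \<xi> P. \<Sum>(j, l)\<in>incident k \<xi> P \<rho>. lumped \<phi> j l)\<bar>
      \<le> (\<Sum>\<rho>\<in>nodes k \<xi> P. \<Sum>(j, l)\<in>incident k \<xi> P \<rho>. len P j * w l * G)"
    unfolding b_form_def sum_subtractf[symmetric] G_def H_def
    by (intro order_trans[OF sum_abs] sum_mono node_consistency \<phi>)
  also have "\<dots> = G"
    using sum_len sum_w by (simp add: sum_nodes_incident sum_distrib_right[symmetric] sum_distrib_left[symmetric])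
  finally have 1: "\<bar>b_form k \<xi> w P y v \<phi> - (\<Sum>j<cells P. \<Sum>l\<le>k. lumped \<phi> j l)\<bar> \<le> G"
    by (simp add: sum_nodes_incident)
  have "continuous_on UNIV z" using bounded_smooth_continuous[OF z, of UNIV 0] by simp
  then have "((\<lambda>\<rho>. z \<rho> \<bullet> \<phi> \<rho>) has_integral (\<Sum>j<cells P. len P j *\<^sub>R integral {0..1} (\<lambda>s. z (loc j s) \<bullet> \<phi> (loc j s)))) {0..1}"
    using bounded_smooth_periodic[OF z] Vh2_periodic[OF \<phi>] Vh2_continuous[OF \<phi>, of UNIV]
    by (intro has_integral_cells)
       (auto simp: periodic1_def loc_def intro!: continuous_intros elim!: continuous_on_compose2)
  then have I: "integral {0..1} (\<lambda>\<rho>. z \<rho> \<bullet> \<phi> \<rho>) = (\<Sum>j<cells P. len P j * integral {0..1} (\<lambda>s. z (loc j s) \<bullet> \<phi> (loc j s)))"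
    by (simp add: integral_unique)
  have "(\<Sum>l\<le>k. lumped \<phi> j l) = len P j * (Z j + integral {0..1} (\<lambda>s. z (loc j s) \<bullet> \<phi> (loc j s)) + Y j)" for j
    by (simp add: lumped_def Z_def Y_def sum_distrib_left distrib_left sum.distrib mult_ac)
  then have 2: "(\<Sum>j<cells P. \<Sum>l\<le>k. lumped \<phi> j l) - integral {0..1} (\<lambda>\<rho>. z \<rho> \<bullet> \<phi> \<rho>) = (\<Sum>j<cells P. len P j * (Z j + Y j))"
    unfolding I sum_subtractf[symmetric] by (simp add: algebra_simps)
  \<comment> \<open>K1 collects the terms in the sup norm of \<phi>, summed with the lengths as
    weights; K2 collects those in \<open>cvar\<close>.\<close>
  define K1 K2 where "K1 = 8 * B + 2 * (3 * B\<^sup>2 * C\<^sub>I + \<Lambda> * B * (3 * B + 10 * B\<^sup>2 / c))" and "K2 = 4 * B + 3 * \<Lambda> * B\<^sup>2"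
  have K: "0 \<le> K1" "0 \<le> K2"
    using c B_nonneg C\<^sub>I \<Lambda>_nonneg by (auto simp: K1_def K2_def intro!: add_nonneg_nonneg mult_nonneg_nonneg)
  have "\<bar>\<Sum>j<cells P. len P j * (Z j + Y j)\<bar> \<le> (\<Sum>j<cells P. h ^ (k + 1) * (K1 * H * len P j + K2 * cvar \<phi> j))"
  proof (intro order_trans[OF sum_abs] sum_mono)
    fix j assume "j \<in> {..<cells P}"
    then have j: "j < cells P" by simp
    define L where "L = len P j"
    have L: "0 < L" unfolding L_def by (rule len_pos[OF j])
    have "\<bar>Z j + Y j\<bar> \<le> 4 * (L ^ (k + 1) * B * (2 * H) + L ^ k * B * cvar \<phi> j)
        + (L ^ (k + 1) * (2 * H) * (3 * B\<^sup>2 * C\<^sub>I + \<Lambda> * B * (3 * B + 10 * B\<^sup>2 / c)) + L ^ k * cvar \<phi> j * (3 * \<Lambda> * B\<^sup>2))"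
      using quadrature_cell[OF \<phi> j] projection_cell[OF \<phi> j] unfolding Z_def Y_def L_def H_def
      by (intro order_trans[OF abs_triangle_ineq] add_mono)
    also have "\<dots> = L ^ (k + 1) * (K1 * H) + L ^ k * (K2 * cvar \<phi> j)"
      by (simp add: K1_def K2_def algebra_simps)
    finally have "\<bar>L * (Z j + Y j)\<bar> \<le> L * (L ^ (k + 1) * (K1 * H) + L ^ k * (K2 * cvar \<phi> j))"
      using L by (simp add: abs_mult)
    also have "\<dots> = L ^ (k + 1) * (K1 * H * L + K2 * cvar \<phi> j)" by (simp add: algebra_simps)
    also have "\<dots> \<le> h ^ (k + 1) * (K1 * H * L + K2 * cvar \<phi> j)"
      using len_powers(4)[OF j] K H L cvar_nonneg[OF j] by (intro mult_right_mono) (auto simp: L_def)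
    finally show "\<bar>len P j * (Z j + Y j)\<bar> \<le> h ^ (k + 1) * (K1 * H * len P j + K2 * cvar \<phi> j)"
      by (simp add: L_def)
  qed
  also have "\<dots> = h ^ (k + 1) * (K1 * H * (\<Sum>j<cells P. len P j) + K2 * (\<Sum>j<cells P. cvar \<phi> j))"
    by (simp only: sum_distrib_left[symmetric] sum.distrib)
  also have "\<dots> \<le> h ^ (k + 1) * (K1 * H * 1 + K2 * H)"
    using sum_cvar[OF \<phi>] sum_len K H mesh_size_pos by (intro mult_left_mono add_mono) (auto simp: H_def)
  finally have 3: "\<bar>(\<Sum>j<cells P. \<Sum>l\<le>k. lumped \<phi> j l) - integral {0..1} (\<lambda>\<rho>. z \<rho> \<bullet> \<phi> \<rho>)\<bar> \<le> h ^ (k + 1) * (K1 * H * 1 + K2 * H)"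
    unfolding 2 .
  have "\<bar>b_form k \<xi> w P y v \<phi> - integral {0..1} (\<lambda>\<rho>. z \<rho> \<bullet> \<phi> \<rho>)\<bar> \<le> G + h ^ (k + 1) * (K1 * H * 1 + K2 * H)"
    using 1 3 by linarith
  also have "\<dots> = K\<^sub>b * h ^ (k + 1) * H"
    by (simp add: G_def K\<^sub>b_def K1_def K2_def algebra_simps)
  finally show ?thesis by (simp add: H_def)
qed

end

section \<open>Solvability of the discrete problem\<close>

text \<open>Linearity is asked for on V only, as additivity of the stiffness form rests on
  integrability that finite element functions provide.\<close>

definition linear_functional_on :: "('a \<Rightarrow> plane) set \<Rightarrow> (('a \<Rightarrow> plane) \<Rightarrow> real) \<Rightarrow> bool" where
  "linear_functional_on V f \<longleftrightarrow>
     (\<forall>u\<in>V. \<forall>v\<in>V. \<forall>a b. f (\<lambda>x. a *\<^sub>R u x + b *\<^sub>R v x) = a * f u + b * f v)"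

lemma linear_functional_onD:
  "linear_functional_on V f \<Longrightarrow> u \<in> V \<Longrightarrow> v \<in> V \<Longrightarrow> f (\<lambda>x. a *\<^sub>R u x + b *\<^sub>R v x) = a * f u + b * f v"
  by (simp add: linear_functional_on_def)

lemma linear_functional_on_subset: "linear_functional_on V f \<Longrightarrow> W \<subseteq> V \<Longrightarrow> linear_functional_on W f"
  by (auto simp: linear_functional_on_def)

text \<open>The finite set \<open>S\<close> of functionals separates the points of \<open>V\<close>, which is thus finite-dimensional; the kernel of
  one functional and an orthogonal complement of it give the induction.\<close>

lemma riesz_representation:
  fixes V :: "('a \<Rightarrow> plane) set"
  assumes "finite S"
    and "\<And>u v a b. u \<in> V \<Longrightarrow> v \<in> V \<Longrightarrow> (\<lambda>x. a *\<^sub>R u x + b *\<^sub>R v x) \<in> V" and "(\<lambda>_. 0) \<in> V"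
    and "\<And>w. w \<in> V \<Longrightarrow> linear_functional_on V (\<lambda>u. A u w)" and "\<And>u v. u \<in> V \<Longrightarrow> v \<in> V \<Longrightarrow> A u v = A v u"
    and "\<And>u. u \<in> V \<Longrightarrow> u \<noteq> (\<lambda>_. 0) \<Longrightarrow> 0 < A u u"
    and "linear_functional_on V l" and "\<And>s. s \<in> S \<Longrightarrow> linear_functional_on V s"
    and "\<And>u. u \<in> V \<Longrightarrow> (\<And>s. s \<in> S \<Longrightarrow> s u = 0) \<Longrightarrow> u = (\<lambda>_. 0)"
  shows "\<exists>u\<in>V. \<forall>\<phi>\<in>V. A u \<phi> = l \<phi>"
  using assms
proof (induction S arbitrary: V l rule: finite_induct)
  case empty
  have zero: "f (\<lambda>_. 0) = 0" if "linear_functional_on V f" for f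
    using linear_functional_onD[OF that empty(2,2), of 0 0] by simp
  have "\<phi> = (\<lambda>_. 0)" if "\<phi> \<in> V" for \<phi> using empty(8)[OF that] by simp
  then have "A (\<lambda>_. 0) \<phi> = l \<phi>" if "\<phi> \<in> V" for \<phi>
    using zero[OF empty(3)[OF that]] zero[OF empty(6)] that by metis
  then show ?case using empty(2) by blast
next
  case (insert s S)
  note comb = insert.prems(1) and zeroV = insert.prems(2) and linA = insert.prems(3) and sym = insert.prems(4)
    and pos = insert.prems(5) and linl = insert.prems(6)
  have lins: "linear_functional_on V s" using insert.prems(7) by simp
  define W where "W = {u \<in> V. s u = 0}"
  have WV: "W \<subseteq> V" by (auto simp: W_def)
  have s0: "s (\<lambda>_. 0) = 0" using linear_functional_onD[OF lins zeroV zeroV, of 0 0] by simp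
  have riesz_W: "\<exists>u\<in>W. \<forall>\<phi>\<in>W. A u \<phi> = f \<phi>" if "linear_functional_on V f" for f
  proof (rule insert.IH)
    show "(\<lambda>x. a *\<^sub>R u x + b *\<^sub>R v x) \<in> W" if "u \<in> W" "v \<in> W" for u v a b
      using comb[of u v a b] linear_functional_onD[OF lins, of u v a b] that by (simp add: W_def)
    show "u = (\<lambda>_. 0)" if "u \<in> W" "\<And>t. t \<in> S \<Longrightarrow> t u = 0" for u
      using insert.prems(8)[of u] that by (auto simp: W_def)
    show "(\<lambda>_. 0) \<in> W" using zeroV s0 by (simp add: W_def)
    show "linear_functional_on W (\<lambda>u. A u a)" if "a \<in> W" for a
      using that WV by (intro linear_functional_on_subset[OF linA WV]) blast
    show "A u v = A v u" if "u \<in> W" "v \<in> W" for u v using sym that WV by blast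
    show "0 < A u u" if "u \<in> W" "u \<noteq> (\<lambda>_. 0)" for u using pos that WV by blast
    show "linear_functional_on W f" by (rule linear_functional_on_subset[OF that WV])
    show "linear_functional_on W t" if "t \<in> S" for t
      using that by (intro linear_functional_on_subset[OF insert.prems(7) WV]) simp
  qed
  show ?case
  proof (cases "\<forall>u\<in>V. s u = 0")
    case True
    then have "W = V" by (auto simp: W_def)
    then show ?thesis using riesz_W[OF linl] by simp
  next
    case False
    then obtain b where b: "b \<in> V" "s b \<noteq> 0" by blast
    have "linear_functional_on V (A b)"
      unfolding linear_functional_on_def
    proof (intro ballI allI)
      fix u v \<alpha> \<beta> assume uv: "u \<in> V" "v \<in> V"
      show "A b (\<lambda>x. \<alpha> *\<^sub>R u x + \<beta> *\<^sub>R v x) = \<alpha> * A b u + \<beta> * A b v"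
        using linear_functional_onD[OF linA[OF b(1)] uv, of \<alpha> \<beta>] sym[OF b(1)] comb[OF uv] uv by metis
    qed
    then obtain g where g: "g \<in> W" "\<And>\<phi>. \<phi> \<in> W \<Longrightarrow> A g \<phi> = A b \<phi>" using riesz_W by blast
    obtain u where u: "u \<in> W" "\<And>\<phi>. \<phi> \<in> W \<Longrightarrow> A u \<phi> = l \<phi>" using riesz_W[OF linl] by blast
    have gV: "g \<in> V" and uV: "u \<in> V" using g u WV by auto
    \<comment> \<open>As g is the A-orthogonal projection of b onto the kernel W, the difference e
      is orthogonal to W and lies outside it.\<close>
    define e where "e = (\<lambda>x. 1 *\<^sub>R b x + (- 1) *\<^sub>R g x)"
    have eV: "e \<in> V" unfolding e_def by (rule comb[OF b(1) gV])
    have se: "s e = s b"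
      using linear_functional_onD[OF lins b(1) gV, of 1 "- 1"] g by (simp add: e_def W_def)
    then have "e \<noteq> (\<lambda>_. 0)" using b(2) s0 by auto
    then have Ae: "0 < A e e" by (rule pos[OF eV])
    have orth: "A e \<phi> = 0" if "\<phi> \<in> W" for \<phi>
      using linear_functional_onD[OF linA b(1) gV, of \<phi> 1 "- 1"] g(2)[OF that] that WV by (auto simp: e_def)
    \<comment> \<open>Adding a multiple of e does not disturb the equation on W, so \<alpha> is free
      to match l on e.\<close>
    define \<alpha> where "\<alpha> = l e / A e e"
    define y where "y = (\<lambda>x. 1 *\<^sub>R u x + \<alpha> *\<^sub>R e x)"
    have yV: "y \<in> V" unfolding y_def by (rule comb[OF uV eV])
    have Ay: "A y \<phi> = A u \<phi> + \<alpha> * A e \<phi>" if "\<phi> \<in> V" for \<phi>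
      using linear_functional_onD[OF linA[OF that] uV eV, of 1 \<alpha>] by (simp add: y_def)
    have "A y \<phi> = l \<phi>" if \<phi>: "\<phi> \<in> V" for \<phi>
    proof -
      define \<beta> where "\<beta> = s \<phi> / s e"
      define r where "r = (\<lambda>x. 1 *\<^sub>R \<phi> x + (- \<beta>) *\<^sub>R e x)"
      have rV: "r \<in> V" unfolding r_def by (rule comb[OF \<phi> eV])
      have "s r = 0"
        using linear_functional_onD[OF lins \<phi> eV, of 1 "- \<beta>"] se b(2) by (simp add: r_def \<beta>_def)
      then have rW: "r \<in> W" using rV by (simp add: W_def)
      have split: "\<phi> = (\<lambda>x. 1 *\<^sub>R r x + \<beta> *\<^sub>R e x)" by (auto simp: r_def)
      have "A y e = l e"
        using Ay[OF eV] orth[OF u(1)] sym[OF uV eV] Ae by (simp add: \<alpha>_def)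
      moreover have "A y r = l r" using Ay[OF rV] orth[OF rW] u(2)[OF rW] by simp
      moreover have "A y \<phi> = 1 * A y r + \<beta> * A y e"
      proof -
        have "A y \<phi> = A \<phi> y" by (rule sym[OF yV \<phi>])
        also have "\<dots> = 1 * A r y + \<beta> * A e y"
          by (subst split) (rule linear_functional_onD[OF linA[OF yV] rV eV])
        finally show ?thesis using sym[OF yV rV] sym[OF yV eV] by simp
      qed
      moreover have "l \<phi> = 1 * l r + \<beta> * l e"
        by (subst split) (rule linear_functional_onD[OF linl rV eV])
      ultimately show ?thesis by simp
    qed
    then show ?thesis using yV by blast
  qed
qed

section \<open>Coercivity, unique solvability and the error equation\<close>

context consistency
begin

lemma mu_nonneg: "0 \<le> mu k \<xi> w P y \<rho>"
  unfolding mu_def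
  by (intro sum_nonneg) (auto simp: incident_def intro!: mult_nonneg_nonneg less_imp_le[OF len_pos] less_imp_le[OF w_pos])

lemma b_form_nonneg: "0 \<le> b_form k \<xi> w P y u u"
  unfolding b_form_def
  by (intro sum_nonneg) (simp add: mult.assoc mu_nonneg)

lemma b_form_commute: "b_form k \<xi> w P y u \<phi> = b_form k \<xi> w P y \<phi> u"
  by (simp add: b_form_def mult_ac)

lemma b_form_linear: "b_form k \<xi> w P y (\<lambda>\<rho>. a *\<^sub>R u \<rho> + b *\<^sub>R u' \<rho>) \<phi> = a * b_form k \<xi> w P y u \<phi> + b * b_form k \<xi> w P y u' \<phi>"
  by (simp add: b_form_def inner_add_left sum_distrib_left sum.distrib[symmetric] algebra_simps)

lemma b_form_cong: "(\<And>\<rho>. \<rho> \<in> nodes k \<xi> P \<Longrightarrow> u \<rho> = u' \<rho>) \<Longrightarrow> b_form k \<xi> w P y u \<phi> = b_form k \<xi> w P y u' \<phi>"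
  by (simp add: b_form_def)

lemma a_form_commute: "a_form y u \<phi> = a_form y \<phi> u"
  by (simp add: a_form_def inner_commute)

lemma a_form_linear:
  assumes u: "u \<in> Vh2 k P" "u' \<in> Vh2 k P" and \<phi>: "\<phi> \<in> Vh2 k P"
  shows "a_form y (\<lambda>\<rho>. a *\<^sub>R u \<rho> + b *\<^sub>R u' \<rho>) \<phi> = a * a_form y u \<phi> + b * a_form y u' \<phi>"
proof -
  have V: "(\<lambda>\<rho>. a *\<^sub>R u \<rho> + b *\<^sub>R u' \<rho>) \<in> Vh2 k P" by (intro Vh2_add Vh2_scale u)
  have "integral {0..1} (\<lambda>s. (cderiv (\<lambda>\<rho>. a *\<^sub>R u \<rho> + b *\<^sub>R u' \<rho>) j s \<bullet> cderiv \<phi> j s) / norm (cderiv y j s))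
      = a * integral {0..1} (\<lambda>s. (cderiv u j s \<bullet> cderiv \<phi> j s) / norm (cderiv y j s))
        + b * integral {0..1} (\<lambda>s. (cderiv u' j s \<bullet> cderiv \<phi> j s) / norm (cderiv y j s))" if j: "j < cells P" for j
  proof -
    have int: "(\<lambda>s. (cderiv u j s \<bullet> cderiv \<phi> j s) / norm (cderiv y j s)) integrable_on {0..1}" for u
      using cderiv_y_nz[OF j] by (intro integrable_continuous_real continuous_intros cderiv_continuous) auto
    have "((\<lambda>s. a * ((cderiv u j s \<bullet> cderiv \<phi> j s) / norm (cderiv y j s)) + b * ((cderiv u' j s \<bullet> cderiv \<phi> j s) / norm (cderiv y j s)))
      has_integral a * integral {0..1} (\<lambda>s. (cderiv u j s \<bullet> cderiv \<phi> j s) / norm (cderiv y j s))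
        + b * integral {0..1} (\<lambda>s. (cderiv u' j s \<bullet> cderiv \<phi> j s) / norm (cderiv y j s))) {0..1}"
      by (intro has_integral_add has_integral_mult_right integrable_integral int)
    then show ?thesis
      by (simp add: cderiv_add cderiv_scale inner_add_left add_divide_distrib integral_unique)
  qed
  then show ?thesis
    using V u \<phi> by (simp add: a_form_cells sum_distrib_left sum.distrib[symmetric] algebra_simps)
qed

definition scheme :: "real \<Rightarrow> (real \<Rightarrow> plane) \<Rightarrow> (real \<Rightarrow> plane) \<Rightarrow> real" where
  "scheme \<tau> u \<phi> = a_form y u \<phi> + (1 / \<tau>) * b_form k \<xi> w P y u \<phi>"

lemma scheme_linear:
  assumes "u \<in> Vh2 k P" "u' \<in> Vh2 k P" "\<phi> \<in> Vh2 k P"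
  shows "scheme \<tau> (\<lambda>\<rho>. a *\<^sub>R u \<rho> + b *\<^sub>R u' \<rho>) \<phi> = a * scheme \<tau> u \<phi> + b * scheme \<tau> u' \<phi>"
  using assms by (simp add: scheme_def a_form_linear b_form_linear algebra_simps)

context
  fixes \<tau> \<gamma> :: real
  assumes \<tau>: "0 < \<tau>" "\<tau> \<le> 1" and \<gamma>: "0 < \<gamma>"
    and coercive: "\<And>u. u \<in> Vh2 k P \<Longrightarrow> \<gamma> * (H1_norm u)\<^sup>2 \<le> a_form y u u + b_form k \<xi> w P y u u"
begin

text \<open>The lumped form is nonnegative on the diagonal, so weighting it with 1/\<tau> \<ge> 1
  preserves the lower bound, with a constant that does not depend on \<tau>.\<close>

lemma scheme_coercive:
  assumes "u \<in> Vh2 k P" shows "\<gamma> * (H1_norm u)\<^sup>2 \<le> scheme \<tau> u u"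
proof -
  have "1 * b_form k \<xi> w P y u u \<le> 1 / \<tau> * b_form k \<xi> w P y u u"
    using \<tau> b_form_nonneg by (intro mult_right_mono) auto
  then show ?thesis using coercive[OF assms] by (simp add: scheme_def)
qed

lemma scheme_pos:
  assumes u: "u \<in> Vh2 k P" and "u \<noteq> (\<lambda>_. 0)" shows "0 < scheme \<tau> u u"
proof -
  have "H1_norm u \<noteq> 0" using H1_norm_eq_0[OF u] assms(2) by blast
  then have "0 < \<gamma> * (H1_norm u)\<^sup>2" using \<gamma> by simp
  then show ?thesis using scheme_coercive[OF u] by linarith
qed

text \<open>Because \<open>fe_step\<close> is a definite description, nothing can be said of it
  before existence and uniqueness. The separating functionals are the components of the nodal
  values; definiteness is coercivity.\<close>

lemma scheme_solvable:
  assumes l: "linear_functional_on (Vh2 k P) l"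
  shows "\<exists>!u. u \<in> Vh2 k P \<and> (\<forall>\<phi>\<in>Vh2 k P. scheme \<tau> u \<phi> = l \<phi>)"
proof (rule ex_ex1I)
  define S where "S = (\<lambda>(\<rho>, i) (u :: real \<Rightarrow> plane). u \<rho> $ i) ` (nodes k \<xi> P \<times> UNIV)"
  have "(\<lambda>\<rho>. 0 *\<^sub>R y \<rho>) \<in> Vh2 k P" by (rule Vh2_scale[OF y_Vh2])
  then have zeroV: "(\<lambda>_. 0) \<in> Vh2 k P" by simp
  have "\<exists>u\<in>Vh2 k P. \<forall>\<phi>\<in>Vh2 k P. scheme \<tau> u \<phi> = l \<phi>"
  proof (rule riesz_representation[where S = S])
    show "finite S" unfolding S_def by (intro finite_imageI finite_cartesian_product finite_nodes) simp
    show "scheme \<tau> u v = scheme \<tau> v u" for u v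
      by (simp add: scheme_def a_form_commute b_form_commute)
    show "u = (\<lambda>_. 0)" if "u \<in> Vh2 k P" "\<And>s. s \<in> S \<Longrightarrow> s u = 0" for u
    proof (rule Vh2_nodal_unique[OF that(1) zeroV])
      fix \<rho> assume "\<rho> \<in> nodes k \<xi> P"
      then have "u \<rho> $ i = 0" for i using that(2)[of "\<lambda>u. u \<rho> $ i"] by (force simp: S_def)
      then show "u \<rho> = 0" by (simp add: vec_eq_iff)
    qed
  qed (use l zeroV scheme_pos in \<open>auto simp: linear_functional_on_def scheme_linear S_def intro: Vh2_add Vh2_scale\<close>)
  then show "\<exists>u. u \<in> Vh2 k P \<and> (\<forall>\<phi>\<in>Vh2 k P. scheme \<tau> u \<phi> = l \<phi>)" by blast
next
  fix u u' assume u: "u \<in> Vh2 k P \<and> (\<forall>\<phi>\<in>Vh2 k P. scheme \<tau> u \<phi> = l \<phi>)"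
    and u': "u' \<in> Vh2 k P \<and> (\<forall>\<phi>\<in>Vh2 k P. scheme \<tau> u' \<phi> = l \<phi>)"
  define e where "e = (\<lambda>\<rho>. 1 *\<^sub>R u \<rho> + (- 1) *\<^sub>R u' \<rho>)"
  have e: "e \<in> Vh2 k P" unfolding e_def using u u' by (intro Vh2_add Vh2_scale) auto
  have "scheme \<tau> e e = 1 * scheme \<tau> u e + (- 1) * scheme \<tau> u' e"
    using u u' e scheme_linear[of u u' e \<tau> 1 "- 1"] unfolding e_def by blast
  then have "scheme \<tau> e e = 0" using u u' e by simp
  then have "e = (\<lambda>_. 0)" using scheme_pos[OF e] by force
  then show "u = u'" by (auto simp: e_def fun_eq_iff)
qed

lemma fe_step:
  shows fe_step_Vh2: "fe_step k \<xi> w P \<tau> y \<in> Vh2 k P"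
    and fe_step_scheme: "\<phi> \<in> Vh2 k P \<Longrightarrow> scheme \<tau> (fe_step k \<xi> w P \<tau> y) \<phi> = (1 / \<tau>) * b_form k \<xi> w P y y \<phi>"
proof -
  have "linear_functional_on (Vh2 k P) (\<lambda>\<phi>. (1 / \<tau>) * b_form k \<xi> w P y y \<phi>)"
    unfolding linear_functional_on_def b_form_commute[of y] b_form_linear by (simp add: algebra_simps)
  from scheme_solvable[OF this]
  have ex: "\<exists>!Y. Y \<in> Vh2 k P \<and> (\<forall>\<phi>\<in>Vh2 k P. scheme \<tau> Y \<phi> = (1 / \<tau>) * b_form k \<xi> w P y y \<phi>)" .
  have eq: "a_form y Y \<phi> + (1 / \<tau>) * b_form k \<xi> w P y (\<lambda>\<rho>. Y \<rho> - y \<rho>) \<phi> = 0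
      \<longleftrightarrow> scheme \<tau> Y \<phi> = (1 / \<tau>) * b_form k \<xi> w P y y \<phi>" for Y \<phi>
  proof -
    have "b_form k \<xi> w P y (\<lambda>\<rho>. Y \<rho> - y \<rho>) \<phi> = b_form k \<xi> w P y Y \<phi> - b_form k \<xi> w P y y \<phi>"
      using b_form_linear[of 1 Y "- 1" y \<phi>] by simp
    then show ?thesis by (simp add: scheme_def right_diff_distrib) linarith
  qed
  have "fe_step k \<xi> w P \<tau> y \<in> Vh2 k P \<and> (\<forall>\<phi>\<in>Vh2 k P. scheme \<tau> (fe_step k \<xi> w P \<tau> y) \<phi> = (1 / \<tau>) * b_form k \<xi> w P y y \<phi>)"
    unfolding fe_step_def eq by (rule theI'[OF ex])
  then show "fe_step k \<xi> w P \<tau> y \<in> Vh2 k P"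
    "\<phi> \<in> Vh2 k P \<Longrightarrow> scheme \<tau> (fe_step k \<xi> w P \<tau> y) \<phi> = (1 / \<tau>) * b_form k \<xi> w P y y \<phi>" by auto
qed

lemma step_error:
  assumes X_eq: "\<And>\<rho>. X \<rho> = x \<rho> + \<tau> *\<^sub>R v \<rho>"
    and weak: "\<And>\<phi>. \<phi> \<in> H1 \<Longrightarrow>
      integral {0..1} (\<lambda>\<rho>. z \<rho> \<bullet> \<phi> \<rho>) + integral {0..1} (\<lambda>\<rho>. (dd X \<rho> \<bullet> dd \<phi> \<rho>) / norm (dd x \<rho>)) = 0"
  shows "H1_norm (\<lambda>\<rho>. fe_step k \<xi> w P \<tau> y \<rho> - interp k \<xi> P X \<rho>) \<le> (K\<^sub>a + K\<^sub>b) / \<gamma> * h ^ (k + 1)"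
proof -
  define Z where "Z = interp k \<xi> P X"
  define e where "e = (\<lambda>\<rho>. fe_step k \<xi> w P \<tau> y \<rho> - Z \<rho>)"
  have Z: "Z \<in> Vh2 k P" unfolding Z_def by (rule Z_Vh2)
  have e: "e \<in> Vh2 k P" unfolding e_def by (rule Vh2_diff[OF fe_step_Vh2 Z])
  have "b_form k \<xi> w P y Z e = b_form k \<xi> w P y (\<lambda>\<rho>. 1 *\<^sub>R y \<rho> + \<tau> *\<^sub>R v \<rho>) e"
    using interp_node bounded_smooth_periodic[OF x] bounded_smooth_periodic[OF X]
    by (intro b_form_cong) (simp add: Z_def X_eq)
  then have "b_form k \<xi> w P y y e = b_form k \<xi> w P y Z e - \<tau> * b_form k \<xi> w P y v e"
    by (simp add: b_form_linear del: scaleR_one)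
  then have "scheme \<tau> (fe_step k \<xi> w P \<tau> y) e = (1 / \<tau>) * b_form k \<xi> w P y Z e - b_form k \<xi> w P y v e"
    using fe_step_scheme[OF e] \<tau> by (simp add: diff_divide_distrib)
  moreover have "scheme \<tau> e e = scheme \<tau> (fe_step k \<xi> w P \<tau> y) e - scheme \<tau> Z e"
    using scheme_linear[OF fe_step_Vh2 Z e, of \<tau> 1 "- 1"] by (simp add: e_def)
  ultimately have "scheme \<tau> e e = - (a_form y Z e + b_form k \<xi> w P y v e)"
    by (simp add: scheme_def)
  also have "\<dots> \<le> K\<^sub>a * h ^ (k + 1) * H1_norm e + K\<^sub>b * h ^ (k + 1) * H1_norm e"
    \<comment> \<open>The weak form, tested with the discrete error e itself, makes the two exact
      integrals cancel.\<close>
    using a_consistency[OF e] b_consistency[OF e] weak[OF Vh2_H1[OF e]] unfolding Z_def by linarith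
  finally have "\<gamma> * (H1_norm e)\<^sup>2 \<le> (K\<^sub>a + K\<^sub>b) * h ^ (k + 1) * H1_norm e"
    using scheme_coercive[OF e] by (simp add: algebra_simps)
  then have le: "(\<gamma> * H1_norm e) * H1_norm e \<le> ((K\<^sub>a + K\<^sub>b) * h ^ (k + 1)) * H1_norm e"
    by (simp add: power2_eq_square mult.assoc)
  have "\<gamma> * H1_norm e \<le> (K\<^sub>a + K\<^sub>b) * h ^ (k + 1)"
  proof (cases "H1_norm e = 0")
    case True
    then show ?thesis using K\<^sub>a_nonneg K\<^sub>b_nonneg mesh_size_pos by simp
  next
    case False
    then have "0 < H1_norm e" using H1_norm_nonneg[OF Vh2_H1[OF e]] by simp
    then show ?thesis using le by simp
  qed
  then show ?thesis using \<gamma> by (simp add: e_def Z_def field_simps)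
qed

end

end

section \<open>From the input class to the error estimate\<close>

lemma bgn_step_weak:
  assumes step: "bgn_step \<tau> x X" and nz: "\<And>\<rho>. dd x \<rho> \<noteq> 0" and \<phi>: "\<phi> \<in> H1"
  shows "integral {0..1} (\<lambda>\<rho>. (speed x \<rho> *\<^sub>R ((velocity \<tau> x X \<rho> \<bullet> normal x \<rho>) *\<^sub>R normal x \<rho>)) \<bullet> \<phi> \<rho>)
    + integral {0..1} (\<lambda>\<rho>. (dd X \<rho> \<bullet> dd \<phi> \<rho>) / norm (dd x \<rho>)) = 0"
proof -
  \<comment> \<open>The weight |x'| of ds turns the mass term into an integral against |x'| (v
    \<bullet> n) n, the field whose norms the input class bounds.\<close>
  have 1: "arc_integral x (\<lambda>\<rho>. (((1 / \<tau>) *\<^sub>R (X \<rho> - x \<rho>)) \<bullet> normal x \<rho>) * (\<phi> \<rho> \<bullet> normal x \<rho>))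
      = integral {0..1} (\<lambda>\<rho>. (speed x \<rho> *\<^sub>R ((velocity \<tau> x X \<rho> \<bullet> normal x \<rho>) *\<^sub>R normal x \<rho>)) \<bullet> \<phi> \<rho>)"
    unfolding arc_integral_def velocity_def
    by (intro integral_cong) (simp add: inner_commute[of "normal x _" "\<phi> _"] mult_ac)
  have 2: "arc_integral x (\<lambda>\<rho>. arc_deriv x X \<rho> \<bullet> arc_deriv x \<phi> \<rho>) = integral {0..1} (\<lambda>\<rho>. (dd X \<rho> \<bullet> dd \<phi> \<rho>) / norm (dd x \<rho>))"
    unfolding arc_integral_def arc_deriv_def speed_def
    using nz by (intro integral_cong) simp
  show ?thesis
    using bspec[OF conjunct2[OF step[unfolded bgn_step_def]] \<phi>] unfolding 1 2 .
qed

text \<open>The factor 2 serves X = x + \<tau> v, where x and v contribute one bound each; the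
  absolute value provides a nonnegative constant.\<close>

lemma admissible_inputD:
  assumes adm: "admissible_input c_low c_up Cr \<tau> x X" and \<tau>: "0 < \<tau>" "\<tau> \<le> 1" and r: "1 \<le> r"
  defines "v \<equiv> velocity \<tau> x X"
  defines "z \<equiv> \<lambda>\<rho>. speed x \<rho> *\<^sub>R ((v \<rho> \<bullet> normal x \<rho>) *\<^sub>R normal x \<rho>)"
  shows "bounded_smooth r (2 * \<bar>Cr r\<bar>) x" "bounded_smooth r (2 * \<bar>Cr r\<bar>) X"
    "bounded_smooth r (2 * \<bar>Cr r\<bar>) v" "bounded_smooth r (2 * \<bar>Cr r\<bar>) z"
    "\<And>\<rho>. X \<rho> = x \<rho> + \<tau> *\<^sub>R v \<rho>"
proof -
  have W: "x \<in> Winf (r + 1)" "v \<in> Winf r" "z \<in> Winf r"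
    and sum: "Winf_norm (r + 1) x + Winf_norm r v + Winf_norm r z \<le> ereal (Cr r)" if "r \<ge> 1" for r
    using adm that unfolding admissible_input_def Let_def v_def z_def by blast+
  \<comment> \<open>The class speaks of x from order 2 on; order 1 is recovered from order 2, whose
    norm only has more nonnegative terms.\<close>
  have Wx: "x \<in> Winf r" if "r \<ge> 1" for r
  proof (cases "r = 1")
    case True
    then show ?thesis using W(1)[of 1] by (auto simp: Winf_def Winf_norm_def numeral_2_eq_2 esssup_norm_nonneg ereal_plus_eq_PInfty elim: order_le_less_trans[rotated])
  next
    case False
    then show ?thesis using W(1)[of "r - 1"] that by simp
  qed
  have "Winf_norm (r + 1) x \<le> Winf_norm (r + 1) x + (Winf_norm r v + Winf_norm r z)"
    "Winf_norm r v \<le> Winf_norm r v + (Winf_norm (r + 1) x + Winf_norm r z)"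
    "Winf_norm r z \<le> Winf_norm r z + (Winf_norm (r + 1) x + Winf_norm r v)"
    using Winf_norm_nonneg by (simp_all add: add_increasing2)
  then have "Winf_norm (r + 1) x \<le> ereal (Cr r)" "Winf_norm r v \<le> ereal (Cr r)" "Winf_norm r z \<le> ereal (Cr r)"
    using sum[OF r] by (auto simp: ac_simps intro: order_trans)
  then have S: "bounded_smooth (r + 1) (Cr r) x" "bounded_smooth r (Cr r) v" "bounded_smooth r (Cr r) z"
    using Winf_bounded_smooth Wx W(2,3) by blast+
  show "bounded_smooth r (2 * \<bar>Cr r\<bar>) x" "bounded_smooth r (2 * \<bar>Cr r\<bar>) v" "bounded_smooth r (2 * \<bar>Cr r\<bar>) z"
    using S by (auto intro!: bounded_smooth_mono[OF S(1)] bounded_smooth_mono[OF S(2)] bounded_smooth_mono[OF S(3)])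
  show X_eq: "X \<rho> = x \<rho> + \<tau> *\<^sub>R v \<rho>" for \<rho>
    using \<tau> by (simp add: v_def velocity_def)
  have "bounded_smooth r (\<bar>Cr r\<bar> + \<bar>\<tau>\<bar> * \<bar>Cr r\<bar>) (\<lambda>\<rho>. x \<rho> + \<tau> *\<^sub>R v \<rho>)"
    using S by (intro bounded_smooth_add_scale) (auto intro!: bounded_smooth_mono[OF S(1)] bounded_smooth_mono[OF S(2)])
  moreover have "\<bar>Cr r\<bar> + \<bar>\<tau>\<bar> * \<bar>Cr r\<bar> \<le> 2 * \<bar>Cr r\<bar>"
    using \<tau> mult_right_mono[of \<tau> 1 "\<bar>Cr r\<bar>"] by simp
  ultimately have "bounded_smooth r (2 * \<bar>Cr r\<bar>) (\<lambda>\<rho>. x \<rho> + \<tau> *\<^sub>R v \<rho>)"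
    using bounded_smooth_mono[OF _ order_refl] by blast
  moreover have "(\<lambda>\<rho>. x \<rho> + \<tau> *\<^sub>R v \<rho>) = X" using X_eq by auto
  ultimately show "bounded_smooth r (2 * \<bar>Cr r\<bar>) X" by simp
qed

theorem lemma5p1:
  fixes k :: nat and \<xi> w :: "nat \<Rightarrow> real"
    and \<T> :: "mesh set" and \<sigma> :: real
    and c_low c_up :: real and Cr :: "nat \<Rightarrow> real"
    and T \<tau>0 :: real and \<Gamma> :: "real \<Rightarrow> real \<Rightarrow> plane" and x0 :: "real \<Rightarrow> plane"
    and N :: "(real \<Rightarrow> plane) set"
  assumes "k \<ge> 1"
    and "gauss_lobatto k \<xi> w"
    and "\<And>P. P \<in> \<T> \<Longrightarrow> is_mesh P \<and> quasi_uniform \<sigma> P"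
    and "0 < c_low"
    and "0 < T" and "0 < \<tau>0"
    and "curve_shortening_flow T \<Gamma>"
    and "const_speed_param x0 (path_image (\<Gamma> 0))"
    and "bgn_neighborhood T \<tau>0 x0 N"
    and "uniformly_regular N"
    and "uniformly_coercive k \<xi> w \<T> N"
  shows "\<exists>C h0. 0 < h0 \<and>
    (\<forall>P\<in>\<T>. \<forall>\<tau> x X. mesh_size P \<le> h0 \<and> 0 < \<tau> \<and> \<tau> \<le> 1 \<and>
       admissible_input c_low c_up Cr \<tau> x X \<and> interp k \<xi> P x \<in> N \<longrightarrow>
       H1_norm (\<lambda>\<rho>. fe_step k \<xi> w P \<tau> (interp k \<xi> P x) \<rho> - interp k \<xi> P X \<rho>)
         \<le> C * mesh_size P ^ (k + 1))"
proof -
  interpret lobatto_rule k \<xi> w using assms(1,2) by unfold_locales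
  obtain \<gamma> h1 where \<gamma>: "0 < \<gamma>" "0 < h1" and coercive: "\<And>P y u. P \<in> \<T> \<Longrightarrow> mesh_size P \<le> h1 \<Longrightarrow> y \<in> Vh2 k P \<inter> N \<Longrightarrow>
      u \<in> Vh2 k P \<Longrightarrow> \<gamma> * (H1_norm u)\<^sup>2 \<le> a_form y u u + b_form k \<xi> w P y u u"
    using assms(11) unfolding uniformly_coercive_def by blast
  obtain C\<^sub>I where C\<^sub>I: "0 \<le> C\<^sub>I" and interp_err: "\<And>f B a L. bounded_smooth (k + 2) B f \<Longrightarrow> 0 < L \<Longrightarrow> \<exists>d. norm d \<le> B \<and> (\<forall>s\<in>{0..1}.
      norm ((1 / L) *\<^sub>R (\<chi> i. poly (pderiv (ref_interp (\<lambda>s. f (a + L * s) $ i))) s)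
       - dd f (a + L * s) - (L ^ k * poly res_poly s) *\<^sub>R d) \<le> C\<^sub>I * B * L ^ (k + 1))"
    using interp_deriv_error by blast
  obtain \<Lambda> where \<Lambda>: "0 \<le> \<Lambda>" "\<And>s. s \<in> {0..1} \<Longrightarrow> \<bar>poly res_poly s\<bar> \<le> \<Lambda>"
    using poly_bounded_01[of res_poly] by blast
  \<comment> \<open>Order k + 2 is what the interpolation estimate takes; the bounds on v and z are
    used at lower order.\<close>
  define B where "B = 2 * \<bar>Cr (k + 2)\<bar>"
  define D where "D = B * \<Lambda> + C\<^sub>I * B"
  have D: "0 \<le> D" using \<Lambda> C\<^sub>I by (simp add: D_def B_def)
  \<comment> \<open>The three bounds give coercivity, comparable powers of h, and D h \<le> c_low /
    2; D + 1 avoids dividing by 0.\<close>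
  define h0 where "h0 = min h1 (min 1 (c_low / (2 * (D + 1))))"
  have h0: "0 < h0" using \<gamma> assms(4) D by (simp add: h0_def)
  \<comment> \<open>Outside the locale both constants take just these four arguments, none of which
    involves the mesh, \<tau> or the input: this is the uniformity.\<close>
  define C where "C = (consistency.K\<^sub>a c_low B C\<^sub>I \<Lambda> + consistency.K\<^sub>b c_low B C\<^sub>I \<Lambda>) / \<gamma>"
  have "H1_norm (\<lambda>\<rho>. fe_step k \<xi> w P \<tau> (interp k \<xi> P x) \<rho> - interp k \<xi> P X \<rho>) \<le> C * mesh_size P ^ (k + 1)"
    if P: "P \<in> \<T>" and h: "mesh_size P \<le> h0" and \<tau>: "0 < \<tau>" "\<tau> \<le> 1"
      and adm: "admissible_input c_low c_up Cr \<tau> x X" and N: "interp k \<xi> P x \<in> N" for P \<tau> x X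
  proof -
    interpret fem k \<xi> w P using assms(3)[OF P] by unfold_locales simp
    define v where "v = velocity \<tau> x X"
    define z where "z = (\<lambda>\<rho>. speed x \<rho> *\<^sub>R ((v \<rho> \<bullet> normal x \<rho>) *\<^sub>R normal x \<rho>))"
    have "1 \<le> k + 2" by simp
    note adm' = admissible_inputD[OF adm \<tau> this, folded v_def, folded z_def B_def]
    have speed: "c_low \<le> norm (dd x \<rho>)" for \<rho>
      using adm by (simp add: admissible_input_def speed_def)
    then have nz: "dd x \<rho> \<noteq> 0" for \<rho> using assms(4) by (metis norm_zero not_less)
    interpret consistency k \<xi> w P c_low B C\<^sub>I \<Lambda> x X v z
    proof unfold_locales
      show "z \<rho> = ((v \<rho> \<bullet> J (dd x \<rho>)) / norm (dd x \<rho>)) *\<^sub>R J (dd x \<rho>)" for \<rho>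
        using nz[of \<rho>] by (simp add: z_def normal_def tangent_def speed_def J_scale)
      show "(B * \<Lambda> + C\<^sub>I * B) * mesh_size P \<le> c_low / 2"
      proof -
        have "D * mesh_size P \<le> D * (c_low / (2 * (D + 1)))"
          using h D by (intro mult_left_mono) (auto simp: h0_def)
        also have "\<dots> \<le> c_low / 2" using D assms(4) by (simp add: field_simps)
        finally show ?thesis by (simp add: D_def)
      qed
      show "bounded_smooth 1 B v" "bounded_smooth (k + 1) B z"
        by (intro bounded_smooth_mono[OF adm'(3)] bounded_smooth_mono[OF adm'(4)]; simp)+
    qed (use assms(4) C\<^sub>I \<Lambda> interp_err adm' speed h in \<open>auto simp: h0_def\<close>)
    have "H1_norm (\<lambda>\<rho>. fe_step k \<xi> w P \<tau> (interp k \<xi> P x) \<rho> - interp k \<xi> P X \<rho>) \<le> (K\<^sub>a + K\<^sub>b) / \<gamma> * mesh_size P ^ (k + 1)"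
    proof (rule step_error[OF \<tau> \<gamma>(1)])
      show "\<gamma> * (H1_norm u)\<^sup>2 \<le> a_form y u u + b_form k \<xi> w P y u u" if "u \<in> Vh2 k P" for u
        using h N y_Vh2 that by (intro coercive[OF P]) (auto simp: h0_def)
      show "integral {0..1} (\<lambda>\<rho>. z \<rho> \<bullet> \<phi> \<rho>) + integral {0..1} (\<lambda>\<rho>. (dd X \<rho> \<bullet> dd \<phi> \<rho>) / norm (dd x \<rho>)) = 0" if "\<phi> \<in> H1" for \<phi>
        using bgn_step_weak[OF _ nz that, of \<tau> X] adm by (simp add: z_def v_def admissible_input_def)
    qed (rule adm'(5))
    then show ?thesis by (simp add: C_def)
  qed
  then show ?thesis using h0 by blast
qed

end
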